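(* Let $\mathbb{F}$ be an algebraically closed field of characteristic $p>0$ and let $L$ be a finite-dimensional abelian restricted Lie algebra over $\mathbb{F}$. Let $H$ be a restricted Lie algebra over $\mathbb{F}$ such that $u(L)\cong u(H)$ as associative $\mathbb{F}$-algebras. Then $L\cong H$ as restricted Lie algebras.
   Context: $u(L)$ denotes the restricted enveloping algebra of a restricted Lie algebra $L$. *)

theory Defs
  imports
    "HOL-Library.Poly_Mapping"
    "HOL-Algebra.Algebraic_Closure_Type"
    "HOL-Algebra.Module"
    "HOL-Algebra.QuotRing"
begin

section \<open>Restricted Lie algebras\<close>

locale lie_algebra = vector_space scale
  for scale :: "'k::field \<Rightarrow> 'l::ab_group_add \<Rightarrow> 'l" +
  fixes bracket :: "'l \<Rightarrow> 'l \<Rightarrow> 'l"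
  assumes bracket_linear_left: "Vector_Spaces.linear scale scale (\<lambda>x. bracket x y)"
    and bracket_linear_right: "Vector_Spaces.linear scale scale (bracket x)"
    and bracket_self: "bracket x x = 0"
    and jacobi:
      "bracket x (bracket y z) + bracket y (bracket z x) + bracket z (bracket x y) = 0"
begin

definition abelian :: bool
  where "abelian \<longleftrightarrow> (\<forall>x y. bracket x y = 0)"

text \<open>
  A polynomial with coefficients in \<open>L\<close> is regarded as an element of \<open>L[t]\<close>, the Lie algebra
  obtained from \<open>L\<close> by extension of scalars; \<open>ad_pencil x y\<close> is \<open>ad (t x + y)\<close> on \<open>L[t]\<close>.
\<close>

definition ad_pencil :: "'l \<Rightarrow> 'l \<Rightarrow> 'l poly \<Rightarrow> 'l poly"
  where "ad_pencil x y q = pCons 0 (map_poly (bracket x) q) + map_poly (bracket y) q"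

text \<open>
  Jacobson's polynomials: with \<open>p\<close> the characteristic, \<open>i s\<^sub>i(x, y)\<close> is the coefficient of
  \<open>t\<^bsup>i-1\<^esup>\<close> in \<open>(ad (t x + y))\<^bsup>p-1\<^esup> x\<close>, for \<open>0 < i < p\<close>.
\<close>

definition jacobson_s :: "nat \<Rightarrow> 'l \<Rightarrow> 'l \<Rightarrow> 'l"
  where "jacobson_s i x y =
    scale (inverse (of_nat i))
      (poly.coeff ((ad_pencil x y ^^ (CHAR('k) - 1)) [:x:]) (i - 1))"

end

locale restricted_lie_algebra = lie_algebra scale bracket
  for scale :: "'k::field \<Rightarrow> 'l::ab_group_add \<Rightarrow> 'l"
    and bracket :: "'l \<Rightarrow> 'l \<Rightarrow> 'l" +
  fixes pmap :: "'l \<Rightarrow> 'l"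
  assumes CHAR_pos: "CHAR('k) > 0"
    and pmap_ad: "bracket (pmap x) y = (bracket x ^^ CHAR('k)) y"
    and pmap_scale: "pmap (scale c x) = scale (c ^ CHAR('k)) (pmap x)"
    and pmap_add:
      "pmap (x + y) = pmap x + pmap y + (\<Sum>i = 1..<CHAR('k). jacobson_s i x y)"

definition restricted_lie_iso ::
  "('k::field \<Rightarrow> 'l::ab_group_add \<Rightarrow> 'l) \<Rightarrow> ('l \<Rightarrow> 'l \<Rightarrow> 'l) \<Rightarrow> ('l \<Rightarrow> 'l) \<Rightarrow>
   ('k \<Rightarrow> 'h::ab_group_add \<Rightarrow> 'h) \<Rightarrow> ('h \<Rightarrow> 'h \<Rightarrow> 'h) \<Rightarrow> ('h \<Rightarrow> 'h) \<Rightarrow> ('l \<Rightarrow> 'h) \<Rightarrow> bool"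
  where "restricted_lie_iso scale\<^sub>L bracket\<^sub>L pmap\<^sub>L scale\<^sub>H bracket\<^sub>H pmap\<^sub>H \<phi> \<longleftrightarrow>
    Vector_Spaces.linear scale\<^sub>L scale\<^sub>H \<phi> \<and> bij \<phi> \<and>
    (\<forall>x y. \<phi> (bracket\<^sub>L x y) = bracket\<^sub>H (\<phi> x) (\<phi> y)) \<and>
    (\<forall>x. \<phi> (pmap\<^sub>L x) = pmap\<^sub>H (\<phi> x))"


section \<open>Free associative algebras\<close>

text \<open>
  The free monoid, written additively because the convolution product on
  \<^typ>\<open>'m \<Rightarrow>\<^sub>0 'k\<close> is taken with respect to addition on the index type.
\<close>

datatype 'a free_monoid = Word (letters: "'a list")

instantiation free_monoid :: (type) monoid_add
begin

definition zero_free_monoid :: "'a free_monoid"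
  where "0 = Word []"

definition plus_free_monoid :: "'a free_monoid \<Rightarrow> 'a free_monoid \<Rightarrow> 'a free_monoid"
  where "v + w = Word (letters v @ letters w)"

instance
  by standard (simp_all add: zero_free_monoid_def plus_free_monoid_def)

end

type_synonym ('a, 'k) free_algebra = "'a free_monoid \<Rightarrow>\<^sub>0 'k"

definition generator :: "'a \<Rightarrow> ('a, 'k::field) free_algebra"
  where "generator x = Poly_Mapping.single (Word [x]) 1"

definition scalar :: "'k::field \<Rightarrow> ('a, 'k) free_algebra"
  where "scalar c = Poly_Mapping.single 0 c"

lemma ring_ring_of_type_algebra: "ring (ring_of_type_algebra :: 'r::ring_1 ring)"
proof -
  have "\<exists>y. x + y = 0" for x :: 'r
    using add.right_inverse by blast
  then show ?thesis
    unfolding ring_of_type_algebra_def using add.right_inverse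
    by unfold_locales (auto simp: algebra_simps Units_def)
qed


section \<open>The restricted enveloping algebra\<close>

text \<open>
  The relations express that the canonical map from \<open>L\<close> is additive, homogeneous, takes the
  bracket to the commutator, and takes the \<open>p\<close>-map to the \<open>p\<close>-th power.  Modulo the first two
  families the free algebra is the tensor algebra \<open>T(L)\<close>, modulo the first three it is \<open>U(L)\<close>.
\<close>

definition envelope_relations ::
  "('k::field \<Rightarrow> 'l::ab_group_add \<Rightarrow> 'l) \<Rightarrow> ('l \<Rightarrow> 'l \<Rightarrow> 'l) \<Rightarrow> ('l \<Rightarrow> 'l) \<Rightarrow>
   ('l, 'k) free_algebra set"
  where "envelope_relations scale bracket pmap =
    {generator (x + y) - (generator x + generator y) | x y. True} \<union>
    {generator (scale c x) - scalar c * generator x | c x. True} \<union>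
    {generator x * generator y - generator y * generator x - generator (bracket x y) | x y. True} \<union>
    {generator x ^ CHAR('k) - generator (pmap x) | x. True}"

definition envelope_ideal ::
  "('k::field \<Rightarrow> 'l::ab_group_add \<Rightarrow> 'l) \<Rightarrow> ('l \<Rightarrow> 'l \<Rightarrow> 'l) \<Rightarrow> ('l \<Rightarrow> 'l) \<Rightarrow>
   ('l, 'k) free_algebra set"
  where "envelope_ideal scale bracket pmap =
    Idl\<^bsub>ring_of_type_algebra\<^esub> (envelope_relations scale bracket pmap)"

text \<open>
  The record type \<^typ>\<open>('k, 'r) module\<close> carries a ring structure together with a
  scalar multiplication, which is what is needed for a (noncommutative) associative algebra.
\<close>

definition restricted_enveloping_algebra ::
  "('k::field \<Rightarrow> 'l::ab_group_add \<Rightarrow> 'l) \<Rightarrow> ('l \<Rightarrow> 'l \<Rightarrow> 'l) \<Rightarrow> ('l \<Rightarrow> 'l) \<Rightarrow>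
   ('k, ('l, 'k) free_algebra set) module"
  where "restricted_enveloping_algebra scale bracket pmap =
    (let R = ring_of_type_algebra; I = envelope_ideal scale bracket pmap; Q = R Quot I
     in ring.extend Q (module.fields (\<lambda>c A. (I +>\<^bsub>R\<^esub> scalar c) \<otimes>\<^bsub>Q\<^esub> A)))"

definition assoc_algebra_iso :: "('k, 'a) module \<Rightarrow> ('k, 'b) module \<Rightarrow> ('a \<Rightarrow> 'b) set"
  where "assoc_algebra_iso A B =
    {\<phi> \<in> ring_iso A B. \<forall>c. \<forall>a \<in> carrier A. \<phi> (c \<odot>\<^bsub>A\<^esub> a) = c \<odot>\<^bsub>B\<^esub> \<phi> a}"

lemma ideal_envelope_ideal:
  "ideal (envelope_ideal scale bracket pmap) ring_of_type_algebra"
  unfolding envelope_ideal_def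
  by (rule ring.genideal_ideal[OF ring_ring_of_type_algebra])
    (simp add: ring_of_type_algebra_def)

lemma ring_restricted_enveloping_algebra:
  fixes scale :: "'k::field \<Rightarrow> 'l::ab_group_add \<Rightarrow> 'l"
  shows "ring (restricted_enveloping_algebra scale bracket pmap)"
proof -
  let ?Q = "ring_of_type_algebra Quot envelope_ideal scale bracket pmap"
  interpret Q: ring ?Q
    by (rule ideal.quotient_is_ring[OF ideal_envelope_ideal])
  have "ring (ring.extend ?Q (module.fields f))" for f :: "'k \<Rightarrow> _"
  proof (intro ringI abelian_groupI monoidI)
    fix a assume "a \<in> carrier (ring.extend ?Q (module.fields f))"
    then show "\<exists>b \<in> carrier (ring.extend ?Q (module.fields f)).
        b \<oplus>\<^bsub>ring.extend ?Q (module.fields f)\<^esub> a = \<zero>\<^bsub>ring.extend ?Q (module.fields f)\<^esub>"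
      using Q.l_neg[of a] Q.a_inv_closed[of a] by (auto simp: ring.defs)
  qed (auto simp: ring.defs Q.m_assoc Q.a_ac Q.l_distr Q.r_distr)
  then show ?thesis
    by (simp add: restricted_enveloping_algebra_def Let_def)
qed

lemma smult_restricted_enveloping_algebra:
  fixes scale bracket pmap
  defines "R \<equiv> ring_of_type_algebra" and "I \<equiv> envelope_ideal scale bracket pmap"
  shows "c \<odot>\<^bsub>restricted_enveloping_algebra scale bracket pmap\<^esub> (I +>\<^bsub>R\<^esub> a) =
    I +>\<^bsub>R\<^esub> (scalar c * a)"
proof -
  interpret ideal I R
    unfolding I_def R_def by (rule ideal_envelope_ideal)
  show ?thesis
    using rcoset_mult_add[of "scalar c" a]
    by (simp add: restricted_enveloping_algebra_def Let_def ring.defs module.defs FactRing_def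
        R_def I_def ring_of_type_algebra_def)
qed

end

theory Submission
  imports Defs "HOL-Library.Multiset"
begin

text \<open>
  Write \<open>p\<close> for the characteristic and \<open>\<sigma>\<close> for the \<open>p\<close>-map.

  Commutativity of \<open>u(H)\<close> forces \<open>H\<close> to be abelian: the adjoint representation shows that all
  brackets are central, and in nilpotency class two a nonzero central element acts as a nonzero
  operator in an explicit representation on a quotient of a polynomial ring by the elements
  \<open>x\<^sup>p - \<sigma>(x)\<close> (with a modified \<open>\<sigma>\<close> if \<open>p = 2\<close>).

  If \<open>L\<close> is abelian with basis \<open>B\<close>, the monomials in \<open>B\<close> with all exponents below \<open>p\<close> are a basis of
  \<open>u(L)\<close>.  As \<open>x \<mapsto> x\<^sup>p\<close> is a ring endomorphism, the \<open>p\<^sup>k\<close>-th powers form a copy of \<open>u(\<sigma>\<^sup>k(L))\<close>, of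
  dimension \<open>p\<close> to the power \<open>dim \<sigma>\<^sup>k(L)\<close>, so \<open>u(L)\<close> determines the dimensions of all \<open>\<sigma>\<^sup>k(L)\<close>.
  Over an algebraically closed field these determine \<open>(L, \<sigma>)\<close>: on the stable image \<open>\<sigma>\<close> has a basis
  of fixed vectors by Lang's theorem, and an isomorphism \<open>\<sigma>\<^bsup>k+1\<^esup>(L) \<cong> \<sigma>\<^bsup>k+1\<^esup>(H)\<close> extends to
  \<open>\<sigma>\<^sup>k(L) \<cong> \<sigma>\<^sup>k(H)\<close>.
\<close>

section \<open>Monoid algebras and linear extension\<close>

text \<open>A full Poincare-Birkhoff-Witt theorem for \<open>u(H)\<close> is avoided:
  \<open>H\<close> is not assumed finite-dimensional, and only the survival of a central vector in
  class two is needed. This and the monomial basis in the abelian case rest on one device: the free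
  algebra acts on a polynomial ring, the relations hold modulo a stable subspace \<open>J\<close>,
  and a terminating, confluent rewriting shows that \<open>J\<close> contains no nonzero polynomial
  with all exponents below \<open>p\<close>. The natural class-two action uses half the bracket;
  characteristic two forbids this, hence a triangular form and the altered \<sigma>. An isomorphism
  of algebras need not carry \<open>L\<close> to \<open>H\<close> or respect augmentations, so only
  invariants of the ring structure can be compared, such as the space spanned by all
  \<open>p^k\<close>-th powers. The comparison is a single inequality used in both directions; its
  case k = 0 also shows that \<open>H\<close> is finite-dimensional. Algebraic closedness enters
  only in the classification of semilinear maps: scalars need \<open>p\<close>-th roots, and fixed
  vectors come from roots of polynomials.\<close>

definition mscale :: "'k::field \<Rightarrow> ('a::monoid_add \<Rightarrow>\<^sub>0 'k) \<Rightarrow> ('a \<Rightarrow>\<^sub>0 'k)"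
  where "mscale c f = Poly_Mapping.single 0 c * f"

abbreviation mon :: "'a \<Rightarrow> ('a \<Rightarrow>\<^sub>0 'k::field)"
  where "mon a \<equiv> Poly_Mapping.single a 1"

lemma lookup_mscale [simp]: "Poly_Mapping.lookup (mscale c f) a = c * Poly_Mapping.lookup f a"
  unfolding mscale_def mult_map_scale_conv_mult[symmetric]
  by (simp add: Poly_Mapping.map.rep_eq when_def)

lemma mscale_single [simp]: "mscale c (Poly_Mapping.single a d) = Poly_Mapping.single a (c * d)"
  by (simp add: mscale_def mult_single)

lemma scalar_mult_eq_mscale: "scalar c * t = mscale c t"
  by (simp add: scalar_def mscale_def)

interpretation mvec: vector_space "mscale :: 'k::field \<Rightarrow> ('a::monoid_add \<Rightarrow>\<^sub>0 'k) \<Rightarrow> _"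
  by unfold_locales (auto intro!: poly_mapping_eqI simp: lookup_add algebra_simps)

lemma mscale_mult_left: "mscale c f * g = mscale c (f * g)"
  by (simp add: mscale_def mult.assoc)

lemma mon_sum_expansion: "f = (\<Sum>a\<in>Poly_Mapping.keys f. mscale (Poly_Mapping.lookup f a) (mon a))"
proof (rule poly_mapping_eqI)
  fix k
  have "Poly_Mapping.lookup f k =
      (\<Sum>a\<in>Poly_Mapping.keys f. if a = k then Poly_Mapping.lookup f a else 0)"
    by (simp add: in_keys_iff)
  also have "\<dots> = Poly_Mapping.lookup (\<Sum>a\<in>Poly_Mapping.keys f. mscale (Poly_Mapping.lookup f a) (mon a)) k"
    by (simp add: lookup_sum lookup_single when_def)
  finally show "Poly_Mapping.lookup f k = \<dots>" .
qed

text \<open>Constants are central even when words do not commute: the exponent \<open>0\<close> is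
  neutral on both sides, so only scalars are exchanged.\<close>

lemma mult_single_zero_commute:
  "f * Poly_Mapping.single 0 (c::'k::field) = Poly_Mapping.single 0 c * (f :: 'a::monoid_add \<Rightarrow>\<^sub>0 'k)"
proof -
  have "(\<Sum>a\<in>A. Poly_Mapping.single a (g a)) * Poly_Mapping.single 0 c =
      Poly_Mapping.single 0 c * (\<Sum>a\<in>A. Poly_Mapping.single a (g a))"
    for A and g :: "'a \<Rightarrow> 'k"
    by (simp add: sum_distrib_left sum_distrib_right mult_single mult.commute)
  from this[of "Poly_Mapping.lookup f" "Poly_Mapping.keys f"] show ?thesis
    using mon_sum_expansion[of f] by (simp only: mscale_single mult_1_right)
qed

lemma mscale_mult_right: "f * mscale c g = mscale c (f * g)"
  by (simp add: mscale_def mult_single_zero_commute flip: mult.assoc)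

lemma mvec_linear_mult: "Vector_Spaces.linear mscale mscale ((*) f)"
  unfolding Vector_Spaces.linear_iff
  by (auto simp: distrib_left mscale_mult_right mvec.vector_space_axioms)

lemma mscale_power: "mscale c f ^ n = mscale (c ^ n) (f ^ n)"
  for f :: "'a::comm_monoid_add \<Rightarrow>\<^sub>0 'k::field"
  by (induction n) (simp_all add: mscale_mult_left mscale_mult_right mult_ac)

lemma CHAR_poly_mapping [simp]: "CHAR('a::monoid_add \<Rightarrow>\<^sub>0 'k::field) = CHAR('k)"
proof (rule CHAR_eqI)
  show "of_nat CHAR('k) = (0 :: 'a \<Rightarrow>\<^sub>0 'k)"
    by (metis of_nat_CHAR single_of_nat single_zero)
next
  fix n assume "of_nat n = (0 :: 'a \<Rightarrow>\<^sub>0 'k)"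
  then have "Poly_Mapping.lookup (of_nat n :: 'a \<Rightarrow>\<^sub>0 'k) 0 = 0" by simp
  then have "of_nat n = (0::'k)"
    by (simp flip: single_of_nat)
  then show "CHAR('k) dvd n" by (simp add: of_nat_eq_0_iff_char_dvd)
qed

lemma frobenius_sum:
  fixes f :: "'i \<Rightarrow> 'a::comm_semiring_1"
  assumes "prime CHAR('a)"
  shows "(\<Sum>i\<in>A. f i) ^ (CHAR('a) ^ k) = (\<Sum>i\<in>A. f i ^ (CHAR('a) ^ k))"
  using assms by (intro freshmans_dream_sum') simp_all

definition lext :: "('k::field \<Rightarrow> 'm::ab_group_add \<Rightarrow> 'm) \<Rightarrow> ('x \<Rightarrow> 'm) \<Rightarrow> ('x \<Rightarrow>\<^sub>0 'k) \<Rightarrow> 'm"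
  where "lext s g f = (\<Sum>x\<in>Poly_Mapping.keys f. s (Poly_Mapping.lookup f x) (g x))"

lemma lext_superset:
  assumes "vector_space s" "finite S" "Poly_Mapping.keys f \<subseteq> S"
  shows "lext s g f = (\<Sum>x\<in>S. s (Poly_Mapping.lookup f x) (g x))"
proof -
  interpret vector_space s by fact
  show ?thesis
    unfolding lext_def using assms(2,3) by (intro sum.mono_neutral_left) (auto simp: in_keys_iff)
qed

lemma lext_single:
  assumes "vector_space s"
  shows "lext s g (Poly_Mapping.single x c) = s c (g x)"
proof -
  interpret vector_space s by fact
  show ?thesis by (simp add: lext_def)
qed

lemma linear_lext:
  assumes "vector_space s"
  shows "Vector_Spaces.linear mscale s (lext s g)"
proof -
  interpret vector_space s by fact
  have "lext s g (f + f') = lext s g f + lext s g f'" for f f'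
  proof -
    let ?S = "Poly_Mapping.keys f \<union> Poly_Mapping.keys f'"
    have "Poly_Mapping.keys (f + f') \<subseteq> ?S" by (rule Poly_Mapping.keys_add)
    then show ?thesis
      by (simp add: lext_superset[OF assms, of ?S] lookup_add scale_left_distrib sum.distrib)
  qed
  moreover have "lext s g (mscale c f) = s c (lext s g f)" for c f
  proof -
    have "Poly_Mapping.keys (mscale c f) \<subseteq> Poly_Mapping.keys f" by (auto simp: in_keys_iff)
    then show ?thesis
      by (simp add: lext_superset[OF assms, of "Poly_Mapping.keys f"] scale_sum_right)
  qed
  ultimately show ?thesis
    unfolding Vector_Spaces.linear_iff
    using assms mvec.vector_space_axioms by blast
qed

lemma mvec_linear_eqI:
  assumes "Vector_Spaces.linear mscale s F" "Vector_Spaces.linear mscale s G"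
    and "\<And>a. F (mon a) = G (mon a)"
  shows "F f = G f"
proof -
  interpret F: Vector_Spaces.linear mscale s F by fact
  interpret G: Vector_Spaces.linear mscale s G by fact
  show ?thesis
    by (subst (1 2) mon_sum_expansion) (simp add: F.sum F.scale G.sum G.scale assms(3) del: mscale_single)
qed

lemma mvec_linear_in_subspace:
  assumes "Vector_Spaces.linear mscale s F" "module.subspace s V" "\<And>a. F (mon a) \<in> V"
  shows "F f \<in> V"
proof -
  interpret F: Vector_Spaces.linear mscale s F by fact
  show ?thesis
    by (subst mon_sum_expansion)
      (auto simp: F.sum F.scale simp del: mscale_single
        intro!: F.vs2.subspace_sum F.vs2.subspace_scale assms)
qed

section \<open>Restricted representations\<close>

lemma ideal_ring_of_type_algebraI:
  fixes I :: "'r::ring_1 set"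
  assumes "0 \<in> I" "\<And>a b. a \<in> I \<Longrightarrow> b \<in> I \<Longrightarrow> a + b \<in> I"
    and l: "\<And>a r. a \<in> I \<Longrightarrow> r * a \<in> I" and "\<And>a r. a \<in> I \<Longrightarrow> a * r \<in> I"
  shows "ideal I ring_of_type_algebra"
proof (rule idealI)
  interpret R: ring "ring_of_type_algebra :: 'r ring" by (rule ring_ring_of_type_algebra)
  show "subgroup I (add_monoid ring_of_type_algebra)"
  proof (rule R.add.subgroupI)
    fix a assume "a \<in> I"
    then have "-a \<in> I" using l[of a "-1"] by simp
    moreover have "\<ominus>\<^bsub>ring_of_type_algebra\<^esub> a = -a"
      by (rule R.minus_equality) (auto simp: ring_of_type_algebra_def)
    ultimately show "\<ominus>\<^bsub>ring_of_type_algebra\<^esub> a \<in> I" by simp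
  qed (use assms in \<open>auto simp: ring_of_type_algebra_def\<close>)
qed (use assms ring_ring_of_type_algebra in \<open>auto simp: ring_of_type_algebra_def\<close>)

lemma ideal_ring_of_type_algebraD:
  fixes I :: "'r::ring_1 set"
  assumes "ideal I ring_of_type_algebra"
  shows "0 \<in> I" "\<And>a b. a \<in> I \<Longrightarrow> b \<in> I \<Longrightarrow> a + b \<in> I"
    and "\<And>a r. a \<in> I \<Longrightarrow> r * a \<in> I" "\<And>a r. a \<in> I \<Longrightarrow> a * r \<in> I"
    and "\<And>a b. a \<in> I \<Longrightarrow> b \<in> I \<Longrightarrow> a - b \<in> I"
proof -
  interpret ideal I "ring_of_type_algebra :: 'r ring" by fact
  show "0 \<in> I" and p: "\<And>a b. a \<in> I \<Longrightarrow> b \<in> I \<Longrightarrow> a + b \<in> I"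
    and l: "\<And>a r. a \<in> I \<Longrightarrow> r * a \<in> I" and "\<And>a r. a \<in> I \<Longrightarrow> a * r \<in> I"
    using additive_subgroup.zero_closed[OF is_additive_subgroup]
      additive_subgroup.a_closed[OF is_additive_subgroup] I_l_closed I_r_closed
    by (auto simp: ring_of_type_algebra_def)
  show "a - b \<in> I" if "a \<in> I" "b \<in> I" for a b
    using p[OF that(1) l[OF that(2), of "-1"]] by simp
qed

lemma envelope_relations_subset: "envelope_relations s b p \<subseteq> envelope_ideal s b p"
  unfolding envelope_ideal_def
  by (rule ring.genideal_self[OF ring_ring_of_type_algebra]) (simp add: ring_of_type_algebra_def)

lemma envelope_ideal_minimal:
  assumes "ideal I ring_of_type_algebra" "envelope_relations s b p \<subseteq> I"
  shows "envelope_ideal s b p \<subseteq> I"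
  unfolding envelope_ideal_def
  by (rule ring.genideal_minimal[OF ring_ring_of_type_algebra assms])

lemma mon_Word_Cons: "mon (Word (x # xs)) = generator x * mon (Word xs)"
  by (simp add: generator_def mult_single plus_free_monoid_def)

lemma mon_Word_Nil: "mon (Word []) = 1"
  by (simp flip: zero_free_monoid_def)

text \<open>Requiring the relations only modulo \<open>J\<close> describes a module
  \<open>M/J\<close> over the enveloping algebra without a quotient type. The instances are the
  adjoint action with \<open>J = {0}\<close> and two actions on a polynomial ring.\<close>

locale restricted_action = M: vector_space s
  for s :: "'k::field \<Rightarrow> 'm::ab_group_add \<Rightarrow> 'm" +
  fixes scale :: "'k \<Rightarrow> 'l::ab_group_add \<Rightarrow> 'l" and bracket :: "'l \<Rightarrow> 'l \<Rightarrow> 'l"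
    and pmap :: "'l \<Rightarrow> 'l" and \<rho> :: "'l \<Rightarrow> 'm \<Rightarrow> 'm" and J :: "'m set"
  assumes linear: "Vector_Spaces.linear s s (\<rho> x)"
    and J: "M.subspace J"
    and stable: "m \<in> J \<Longrightarrow> \<rho> x m \<in> J"
    and add: "\<rho> (x + y) m - (\<rho> x m + \<rho> y m) \<in> J"
    and smult: "\<rho> (scale c x) m - s c (\<rho> x m) \<in> J"
    and commutator: "\<rho> x (\<rho> y m) - \<rho> y (\<rho> x m) - \<rho> (bracket x y) m \<in> J"
    and power: "(\<rho> x ^^ CHAR('k)) m - \<rho> (pmap x) m \<in> J"
begin

definition act :: "('l, 'k) free_algebra \<Rightarrow> 'm \<Rightarrow> 'm"
  where "act t m = lext s (\<lambda>w. foldr \<rho> (letters w) m) t"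

lemma linear_act_left: "Vector_Spaces.linear mscale s (\<lambda>t. act t m)"
  unfolding act_def by (rule linear_lext) (rule M.vector_space_axioms)

lemma act_add_left: "act (t + u) m = act t m + act u m"
  using linear_act_left[of m] by (rule module_hom.add[OF Vector_Spaces.linear.axioms(3)])

lemma act_diff_left: "act (t - u) m = act t m - act u m"
  using linear_act_left[of m] by (rule module_hom.diff[OF Vector_Spaces.linear.axioms(3)])

lemma act_mon: "act (mon w) m = foldr \<rho> (letters w) m"
  by (simp add: act_def lext_single[OF M.vector_space_axioms])

lemma act_generator [simp]: "act (generator x) = \<rho> x"
  by (rule ext) (simp add: generator_def act_mon)

lemma act_1 [simp]: "act 1 m = m"
  using act_mon[of "Word []"] by (simp add: mon_Word_Nil)

lemma linear_foldr: "Vector_Spaces.linear s s (foldr \<rho> xs)"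
proof (induction xs)
  case Nil
  then show ?case by (simp add: M.linear_ident)
next
  case (Cons x xs)
  then show ?case using Vector_Spaces.linear_compose[OF Cons linear[of x]] by (simp add: o_def)
qed

lemma linear_act: "Vector_Spaces.linear s s (act t)"
proof -
  interpret vector_space_pair s s by unfold_locales
  interpret L: Vector_Spaces.linear s s "foldr \<rho> xs" for xs by (rule linear_foldr)
  show ?thesis
    unfolding act_def[abs_def] lext_def
    by (intro linear_compose_sum ballI linear_compose_scale_right linear_foldr)
qed

lemma act_mult: "act (t * u) m = act t (act u m)"
proof -
  have 1: "act (mon v * mon w) m = act (mon v) (act (mon w) m)" for v w
    using act_mon[of "v + w" m] by (simp add: mult_single act_mon plus_free_monoid_def)
  have 2: "act (mon v * u) m = act (mon v) (act u m)" for v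
  proof (rule mvec_linear_eqI[where f = u])
    show "Vector_Spaces.linear mscale s (\<lambda>u. act (mon v * u) m)"
      using Vector_Spaces.linear_compose[OF mvec_linear_mult linear_act_left] by (simp add: o_def)
    show "Vector_Spaces.linear mscale s (\<lambda>u. act (mon v) (act u m))"
      using Vector_Spaces.linear_compose[OF linear_act_left linear_act] by (simp add: o_def)
  qed (rule 1)
  show ?thesis
  proof (rule mvec_linear_eqI[where f = t])
    have "Vector_Spaces.linear mscale mscale (\<lambda>t. t * u)"
      unfolding Vector_Spaces.linear_iff
      by (auto simp: distrib_right mscale_mult_left mvec.vector_space_axioms)
    from Vector_Spaces.linear_compose[OF this linear_act_left]
    show "Vector_Spaces.linear mscale s (\<lambda>t. act (t * u) m)" by (simp add: o_def)
  qed (use linear_act_left 2 in auto)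
qed

lemma act_power: "act (t ^ n) m = (act t ^^ n) m"
  by (induction n arbitrary: m) (simp_all add: act_mult funpow_swap1)

lemma act_mem: "m \<in> J \<Longrightarrow> act t m \<in> J"
proof -
  assume m: "m \<in> J"
  have "foldr \<rho> xs m \<in> J" for xs
    by (induction xs) (auto simp: m stable)
  then show ?thesis
    unfolding act_def lext_def by (auto intro!: M.subspace_sum M.subspace_scale J)
qed

text \<open>The elements sending every vector into \<open>J\<close> form a two-sided ideal:
  stability of \<open>J\<close> gives left multiples, quantifying over all vectors gives right
  multiples. It contains the relations.\<close>

theorem act_envelope_ideal:
  assumes "t \<in> envelope_ideal scale bracket pmap"
  shows "act t m \<in> J"
proof -
  have act_0: "act 0 m = 0" for m
    using act_diff_left[of 0 0 m] by simp
  let ?I = "{t. \<forall>m. act t m \<in> J}"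
  have "ideal ?I ring_of_type_algebra"
    by (rule ideal_ring_of_type_algebraI)
      (auto simp: act_add_left act_mult act_0 M.subspace_0[OF J] M.subspace_add[OF J] act_mem)
  moreover have "act (scalar c) m = s c m" for c m
    using act_mon[of 0 m] linear_act_left[of m]
    by (simp add: scalar_def act_def lext_single[OF M.vector_space_axioms] zero_free_monoid_def)
  then have "envelope_relations scale bracket pmap \<subseteq> ?I"
    using add smult commutator power
    by (auto simp: envelope_relations_def act_add_left act_diff_left act_mult act_power fun_eq_iff)
  ultimately have "envelope_ideal scale bracket pmap \<subseteq> ?I"
    by (rule envelope_ideal_minimal)
  with assms show ?thesis by blast
qed

end

section \<open>Normal forms modulo \<open>x\<^sub>v\<^sup>q = r\<^sub>v\<close>\<close>

type_synonym ('v, 'k) mpoly = "('v \<Rightarrow>\<^sub>0 nat) \<Rightarrow>\<^sub>0 'k"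

definition var :: "'v \<Rightarrow> ('v, 'k::field) mpoly"
  where "var v = mon (Poly_Mapping.single v 1)"

definition mdeg :: "('v \<Rightarrow>\<^sub>0 nat) \<Rightarrow> nat"
  where "mdeg \<alpha> = (\<Sum>v\<in>Poly_Mapping.keys \<alpha>. Poly_Mapping.lookup \<alpha> v)"

lemma mdeg_add: "mdeg (\<alpha> + \<beta>) = mdeg \<alpha> + mdeg \<beta>"
  unfolding mdeg_def by (rule setsum_keys_plus_distrib) auto

lemma mdeg_single [simp]: "mdeg (Poly_Mapping.single v n) = n"
  by (simp add: mdeg_def)

lemma minus_add_single:
  fixes \<alpha> :: "'v \<Rightarrow>\<^sub>0 nat"
  assumes "n \<le> Poly_Mapping.lookup \<alpha> v"
  shows "\<alpha> - Poly_Mapping.single v n + Poly_Mapping.single v n = \<alpha>"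
  using assms by (intro poly_mapping_eqI) (auto simp: lookup_add lookup_minus lookup_single when_def)

lemma var_power: "var v ^ n = mon (Poly_Mapping.single v n)"
  by (induction n) (simp_all add: var_def mult_single flip: single_add)

text \<open>The degree bound makes every replacement of \<open>var v ^ q\<close> by
  \<open>r v\<close> lower the total degree, so rewriting terminates whichever variable is
  chosen.\<close>

locale power_rewriting =
  fixes q :: nat and r :: "'v \<Rightarrow> ('v, 'k::field) mpoly"
  assumes mdeg_r: "\<gamma> \<in> Poly_Mapping.keys (r v) \<Longrightarrow> mdeg \<gamma> < q"
begin

lemma mdeg_step:
  assumes "q \<le> Poly_Mapping.lookup \<alpha> v" "\<gamma> \<in> Poly_Mapping.keys (r v)"
  shows "mdeg (\<gamma> + (\<alpha> - Poly_Mapping.single v q)) < mdeg \<alpha>"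
proof -
  have "mdeg \<alpha> = mdeg (\<alpha> - Poly_Mapping.single v q) + q"
    using mdeg_add[of "\<alpha> - Poly_Mapping.single v q" "Poly_Mapping.single v q"]
      minus_add_single[OF assms(1)] by simp
  with mdeg_r[OF assms(2)] show ?thesis by (simp add: mdeg_add)
qed

definition truncated :: "('v \<Rightarrow>\<^sub>0 nat) \<Rightarrow> bool"
  where "truncated \<alpha> \<longleftrightarrow> (\<forall>v. Poly_Mapping.lookup \<alpha> v < q)"

text \<open>An arbitrary choice of the variable to reduce; \<open>nf_mon_reduce\<close> shows that
  the result does not depend on it.\<close>

definition pivot :: "('v \<Rightarrow>\<^sub>0 nat) \<Rightarrow> 'v"
  where "pivot \<alpha> = (SOME v. q \<le> Poly_Mapping.lookup \<alpha> v)"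

lemma pivot: "\<not> truncated \<alpha> \<Longrightarrow> q \<le> Poly_Mapping.lookup \<alpha> (pivot \<alpha>)"
  unfolding pivot_def truncated_def by (rule someI_ex) (simp add: not_less)

function nf_mon :: "('v \<Rightarrow>\<^sub>0 nat) \<Rightarrow> ('v, 'k) mpoly"
  where "nf_mon \<alpha> = (if truncated \<alpha> then mon \<alpha> else
    (\<Sum>\<gamma>\<in>Poly_Mapping.keys (r (pivot \<alpha>)). mscale (Poly_Mapping.lookup (r (pivot \<alpha>)) \<gamma>)
      (nf_mon (\<gamma> + (\<alpha> - Poly_Mapping.single (pivot \<alpha>) q)))))"
  by auto
termination by (relation "measure mdeg") (auto intro!: mdeg_step pivot)

declare nf_mon.simps [simp del]

definition nf :: "('v, 'k) mpoly \<Rightarrow> ('v, 'k) mpoly"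
  where "nf = lext mscale nf_mon"

lemma linear_nf: "Vector_Spaces.linear mscale mscale nf"
  unfolding nf_def by (rule linear_lext) (rule mvec.vector_space_axioms)

sublocale nf: Vector_Spaces.linear mscale mscale nf
  by (rule linear_nf)

lemma nf_mon_eq [simp]: "nf (mon \<alpha>) = nf_mon \<alpha>"
  by (simp add: nf_def lext_single[OF mvec.vector_space_axioms])

lemma nf_times_mon:
  "nf (f * mon \<beta>) = (\<Sum>\<gamma>\<in>Poly_Mapping.keys f. mscale (Poly_Mapping.lookup f \<gamma>) (nf_mon (\<gamma> + \<beta>)))"
proof -
  have "nf (f * mon \<beta>) = nf ((\<Sum>a\<in>Poly_Mapping.keys f. mscale (Poly_Mapping.lookup f a) (mon a)) * mon \<beta>)"
    by (simp only: mon_sum_expansion[symmetric])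
  also have "\<dots> = (\<Sum>\<gamma>\<in>Poly_Mapping.keys f. mscale (Poly_Mapping.lookup f \<gamma>) (nf_mon (\<gamma> + \<beta>)))"
    by (simp add: sum_distrib_right mscale_mult_left mult_single nf.sum nf.scale del: mscale_single)
  finally show ?thesis .
qed

text \<open>
  Confluence: if the exponents of both \<open>v\<close> and \<open>w\<close> are at least \<open>q\<close>, then both reductions can be
  continued to the same \<open>r v * r w * \<dots>\<close>.
\<close>

lemma nf_mon_reduce:
  "q \<le> Poly_Mapping.lookup \<alpha> v \<Longrightarrow> nf_mon \<alpha> = nf (r v * mon (\<alpha> - Poly_Mapping.single v q))"
proof (induction "mdeg \<alpha>" arbitrary: \<alpha> v rule: less_induct)
  case less
  define w where "w = pivot \<alpha>"
  have nt: "\<not> truncated \<alpha>" using less.prems by (auto simp: truncated_def not_less)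
  have w: "q \<le> Poly_Mapping.lookup \<alpha> w" unfolding w_def by (rule pivot) (rule nt)
  have \<alpha>: "nf_mon \<alpha> = nf (r w * mon (\<alpha> - Poly_Mapping.single w q))"
    using nt by (subst nf_mon.simps) (simp add: nf_times_mon w_def)
  show ?case
  proof (cases "v = w")
    case False
    have swap: "nf (r a * mon (\<alpha> - Poly_Mapping.single a q)) =
        nf (r a * (r b * mon (\<alpha> - Poly_Mapping.single a q - Poly_Mapping.single b q)))"
      if ab: "a \<noteq> b" and a: "q \<le> Poly_Mapping.lookup \<alpha> a" and b: "q \<le> Poly_Mapping.lookup \<alpha> b" for a b
    proof -
      let ?\<beta> = "\<alpha> - Poly_Mapping.single a q"
      have b': "q \<le> Poly_Mapping.lookup ?\<beta> b"
        using ab b by (simp add: lookup_minus lookup_single when_def)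
      \<comment> \<open>The rule for \<open>a\<close> has already lowered the degree, so the
        induction hypothesis allows the rule for \<open>b\<close> next, whatever the pivot of the
        new monomial is.\<close>
      have *: "nf_mon (\<gamma> + ?\<beta>) = nf (mon \<gamma> * (r b * mon (?\<beta> - Poly_Mapping.single b q)))"
        if "\<gamma> \<in> Poly_Mapping.keys (r a)" for \<gamma>
      proof -
        have "nf_mon (\<gamma> + ?\<beta>) = nf (r b * mon (\<gamma> + ?\<beta> - Poly_Mapping.single b q))"
          using b' by (intro less.hyps mdeg_step a that) (simp add: lookup_add)
        also have "\<gamma> + ?\<beta> - Poly_Mapping.single b q = \<gamma> + (?\<beta> - Poly_Mapping.single b q)"
          using b' by (intro poly_mapping_eqI) (auto simp: lookup_minus lookup_add lookup_single when_def)
        finally show ?thesis by (simp add: mult_single mult_ac flip: mult_single[of _ "1::'k" _ 1, simplified])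
      qed
      have "nf (r a * mon ?\<beta>) = nf ((\<Sum>\<gamma>\<in>Poly_Mapping.keys (r a).
          mscale (Poly_Mapping.lookup (r a) \<gamma>) (mon \<gamma>)) * (r b * mon (?\<beta> - Poly_Mapping.single b q)))"
        by (simp add: nf_times_mon * sum_distrib_right mscale_mult_left nf.sum nf.scale del: mscale_single)
      then show ?thesis by (simp only: mon_sum_expansion[symmetric])
    qed
    have "\<alpha> - Poly_Mapping.single v q - Poly_Mapping.single w q =
        \<alpha> - Poly_Mapping.single w q - Poly_Mapping.single v q"
      by (intro poly_mapping_eqI) (simp add: lookup_minus)
    then show ?thesis
      using swap[of v w] swap[of w v] False less.prems w \<alpha> by (simp add: mult.left_commute)
  qed (use \<alpha> in simp)
qed

text \<open>With \<open>g\<close> arbitrary, \<open>nf\<close> kills the ideal generated by the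
  rules, while it fixes truncated monomials; hence it detects their independence modulo that
  ideal.\<close>

theorem nf_mult_rule: "nf (g * (var v ^ q - r v)) = 0"
proof -
  have "nf (mon \<beta> * (var v ^ q - r v)) = 0" for \<beta>
  proof -
    have "nf (mon \<beta> * var v ^ q) = nf (r v * mon \<beta>)"
      using nf_mon_reduce[of "\<beta> + Poly_Mapping.single v q" v]
      by (simp add: var_power mult_single lookup_add)
    then show ?thesis by (simp add: right_diff_distrib nf.diff mult.commute)
  qed
  moreover have "Vector_Spaces.linear mscale mscale (\<lambda>g. nf (g * (var v ^ q - r v)))"
    using Vector_Spaces.linear_compose[OF mvec_linear_mult[of "var v ^ q - r v"] linear_nf]
    by (simp add: o_def mult.commute)
  moreover have "Vector_Spaces.linear mscale mscale (\<lambda>g. 0 :: ('v,'k) mpoly)"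
    unfolding Vector_Spaces.linear_iff by (simp add: mvec.vector_space_axioms)
  ultimately show ?thesis by (rule mvec_linear_eqI[rotated 2])
qed

theorem nf_truncated: "truncated \<alpha> \<Longrightarrow> nf (mon \<alpha>) = mon \<alpha>"
  by (simp add: nf_mon.simps)

end

section \<open>The enveloping algebra of an abelian restricted Lie algebra\<close>

text \<open>The abstract form of an abelian restricted Lie algebra, where Jacobson's correction
  terms vanish. It also covers the altered map of characteristic two, which is not the given
  \<open>p\<close>-map.\<close>

locale frobenius_space = vector_space scale
  for scale :: "'k::field \<Rightarrow> 'l::ab_group_add \<Rightarrow> 'l" +
  fixes \<sigma> :: "'l \<Rightarrow> 'l"
  assumes CHAR_pos: "CHAR('k) > 0"
    and \<sigma>_add: "\<sigma> (x + y) = \<sigma> x + \<sigma> y"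
    and \<sigma>_scale: "\<sigma> (scale c x) = scale (c ^ CHAR('k)) (\<sigma> x)"
begin

lemma prime_CHAR: "prime CHAR('k)"
  using prime_CHAR_semidom CHAR_pos by blast

lemma prime_CHAR_mpoly: "prime CHAR(('v, 'k) mpoly)"
  using prime_CHAR by simp

lemma \<sigma>_0: "\<sigma> 0 = 0"
  using \<sigma>_add[of 0 0] by simp

end

locale frobenius_space_basis = frobenius_space scale \<sigma>
  for scale :: "'k::field \<Rightarrow> 'l::ab_group_add \<Rightarrow> 'l" and \<sigma> :: "'l \<Rightarrow> 'l" +
  fixes B :: "'l set"
  assumes independent_B: "independent B" and span_B: "span B = UNIV"
begin

text \<open>There is a variable for every vector of the type, but only those of \<open>B\<close>
  occur in values of \<open>\<iota>\<close>; this keeps the polynomial type independent of the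
  basis.\<close>

definition \<iota> :: "'l \<Rightarrow> ('l, 'k) mpoly"
  where "\<iota> = vector_space_pair.construct scale mscale B var"

sublocale vp: vector_space_pair scale "mscale :: 'k \<Rightarrow> ('l, 'k) mpoly \<Rightarrow> _"
  by unfold_locales

lemma linear_\<iota>: "Vector_Spaces.linear scale mscale \<iota>"
  unfolding \<iota>_def by (rule vp.linear_construct) (rule independent_B)

sublocale \<iota>: Vector_Spaces.linear scale mscale \<iota>
  by (rule linear_\<iota>)

lemma \<iota>_basis: "b \<in> B \<Longrightarrow> \<iota> b = var b"
  unfolding \<iota>_def by (rule vp.construct_basis) (rule independent_B)

lemma basis_induct:
  assumes "subspace {x. P x}" "\<And>b. b \<in> B \<Longrightarrow> P b"
  shows "P x"
  using span_minimal[OF _ assms(1), of B] assms(2) span_B by blast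

lemma mdeg_\<iota>: "\<gamma> \<in> Poly_Mapping.keys (\<iota> x) \<Longrightarrow> mdeg \<gamma> = 1"
proof -
  let ?P = "\<lambda>x. \<forall>\<gamma>. Poly_Mapping.lookup (\<iota> x) \<gamma> \<noteq> 0 \<longrightarrow> mdeg \<gamma> = 1"
  have "?P x"
  proof (rule basis_induct)
    show "subspace {x. ?P x}"
      by (rule subspaceI) (auto simp: \<iota>.add \<iota>.scale \<iota>.zero lookup_add, metis add.right_neutral)
    show "?P b" if "b \<in> B" for b
      using that by (auto simp: \<iota>_basis var_def lookup_single when_def)
  qed
  then show "\<gamma> \<in> Poly_Mapping.keys (\<iota> x) \<Longrightarrow> mdeg \<gamma> = 1" by (simp add: in_keys_iff)
qed

sublocale power_rewriting "CHAR('k)" "\<lambda>x. \<iota> (\<sigma> x)"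
  by unfold_locales (use mdeg_\<iota> prime_gt_1_nat[OF prime_CHAR] in simp)

definition prel :: "'l \<Rightarrow> ('l, 'k) mpoly"
  where "prel x = \<iota> x ^ CHAR('k) - \<iota> (\<sigma> x)"

definition J :: "('l, 'k) mpoly set"
  where "J = mvec.span {g * prel x | g x. True}"

lemma prel_add: "prel (x + y) = prel x + prel y"
  unfolding prel_def
  using freshmans_dream[OF prime_CHAR_mpoly, of "CHAR('k)" "\<iota> x" "\<iota> y"]
  by (simp add: \<iota>.add \<sigma>_add)

lemma prel_scale: "prel (scale c x) = mscale (c ^ CHAR('k)) (prel x)"
  by (simp add: prel_def \<iota>.scale \<sigma>_scale mscale_power mvec.scale_right_diff_distrib)

lemma prel_0: "prel 0 = 0"
  by (simp add: prel_def \<iota>.zero \<sigma>_0 zero_power[OF CHAR_pos])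

lemma subspace_J: "mvec.subspace J"
  unfolding J_def by (rule mvec.subspace_span)

lemma prel_mem_J: "prel x \<in> J"
  unfolding J_def by (rule mvec.span_base) (auto intro!: exI[of _ 1])

lemma J_mult: "f \<in> J \<Longrightarrow> g * f \<in> J"
proof -
  assume "f \<in> J"
  interpret M: Vector_Spaces.linear mscale mscale "(*) g" by (rule mvec_linear_mult)
  have "(*) g ` J = mvec.span ((*) g ` {g * prel x | g x. True})"
    unfolding J_def by (rule M.span_image[symmetric])
  also have "\<dots> \<subseteq> J"
    unfolding J_def by (rule mvec.span_mono) (clarsimp simp: mult.assoc[symmetric], blast)
  finally show ?thesis using \<open>f \<in> J\<close> by blast
qed

lemma J_mult_right: "f \<in> J \<Longrightarrow> f * g \<in> J"
  using J_mult[of f g] by (simp add: mult.commute)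

lemmas J_0 = mvec.subspace_0[OF subspace_J]
  and J_add = mvec.subspace_add[OF subspace_J]
  and J_diff = mvec.subspace_diff[OF subspace_J]
  and J_scale = mvec.subspace_scale[OF subspace_J]
  and J_sum = mvec.subspace_sum[OF subspace_J]

text \<open>By the freshman's dream \<open>prel\<close> is additive and \<open>p\<close>-semilinear,
  so basis vectors suffice, and there \<open>prel\<close> is one of the rewriting rules.\<close>

lemma nf_J: "f \<in> J \<Longrightarrow> nf f = 0"
proof -
  have *: "\<forall>g. nf (g * prel x) = 0" for x
  proof (rule basis_induct)
    show "subspace {x. \<forall>g. nf (g * prel x) = 0}"
      by (intro subspaceI)
        (auto simp: prel_0 prel_add prel_scale distrib_left nf.zero nf.add mscale_mult_right nf.scale)
    show "\<forall>g. nf (g * prel b) = 0" if "b \<in> B" for b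
      using nf_mult_rule[of _ b] that by (simp add: prel_def \<iota>_basis)
  qed
  have "J \<subseteq> {f. nf f = 0}"
    unfolding J_def
    by (rule mvec.span_minimal) (auto simp: * nf.add nf.scale intro!: mvec.subspaceI)
  then show "f \<in> J \<Longrightarrow> nf f = 0" by blast
qed

text \<open>\<open>nf\<close> annihilates \<open>J\<close> and fixes truncated polynomials. This is
  the independence half of the restricted Poincare-Birkhoff-Witt theorem in the abelian
  case.\<close>

theorem truncated_mem_J:
  assumes "f \<in> J" "\<And>\<alpha>. \<alpha> \<in> Poly_Mapping.keys f \<Longrightarrow> truncated \<alpha>"
  shows "f = 0"
proof -
  have "nf f = (\<Sum>\<alpha>\<in>Poly_Mapping.keys f. mscale (Poly_Mapping.lookup f \<alpha>) (nf (mon \<alpha>)))"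
    by (subst mon_sum_expansion[of f]) (simp add: nf.sum nf.scale del: mscale_single nf_mon_eq)
  also have "\<dots> = f"
    by (subst (3) mon_sum_expansion[of f]) (simp add: nf_truncated assms(2) del: nf_mon_eq cong: sum.cong)
  finally show ?thesis using nf_J[OF assms(1)] by simp
qed

lemma basis_not_mem_J:
  assumes "b \<in> B"
  shows "\<iota> b \<notin> J"
proof
  assume "\<iota> b \<in> J"
  moreover have "truncated \<alpha>" if "\<alpha> \<in> Poly_Mapping.keys (\<iota> b)" for \<alpha>
    using that prime_gt_1_nat[OF prime_CHAR] assms
    by (auto simp: \<iota>_basis truncated_def lookup_single when_def var_def split: if_splits)
  ultimately have "\<iota> b = 0" by (rule truncated_mem_J)
  then have "Poly_Mapping.lookup (\<iota> b) (Poly_Mapping.single b 1) = 0" by simp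
  then show False using assms by (simp add: \<iota>_basis var_def)
qed

sublocale ab: restricted_action mscale scale "\<lambda>_ _. 0" \<sigma> "\<lambda>x. (*) (\<iota> x)" J
proof
  have "((*) a ^^ n) m = a ^ n * m" for a m :: "('l, 'k) mpoly" and n
    by (induction n) (simp_all add: mult.assoc)
  then show "((*) (\<iota> x) ^^ CHAR('k)) m - \<iota> (\<sigma> x) * m \<in> J" for x m
    using J_mult_right[OF prel_mem_J, of x m] by (simp add: prel_def left_diff_distrib)
qed (auto simp: subspace_J J_mult J_0 \<iota>.add \<iota>.scale \<iota>.zero distrib_right distrib_left
    mscale_mult_left mscale_mult_right mult.left_commute)

section \<open>The enveloping algebra of an abelian algebra as a quotient of a polynomial
  ring\<close>

definition \<pi> :: "('l, 'k) free_algebra \<Rightarrow> ('l, 'k) mpoly"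
  where "\<pi> t = ab.act t 1"

lemma linear_\<pi>: "Vector_Spaces.linear mscale mscale \<pi>"
  unfolding \<pi>_def by (rule ab.linear_act_left)

sublocale \<pi>: Vector_Spaces.linear mscale mscale \<pi>
  by (rule linear_\<pi>)

lemma \<pi>_generator [simp]: "\<pi> (generator x) = \<iota> x"
  by (simp add: \<pi>_def)

lemma \<pi>_1 [simp]: "\<pi> 1 = 1"
  by (simp add: \<pi>_def)

lemma act_eq_\<pi>: "ab.act t m = \<pi> t * m"
proof (rule mvec_linear_eqI[where f = t])
  show "Vector_Spaces.linear mscale mscale (\<lambda>t. ab.act t m)" by (rule ab.linear_act_left)
  show "Vector_Spaces.linear mscale mscale (\<lambda>t. \<pi> t * m)"
    using Vector_Spaces.linear_compose[OF linear_\<pi> mvec_linear_mult[of m]]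
    by (simp add: o_def mult.commute)
  have "foldr (\<lambda>x. (*) (\<iota> x)) xs m = foldr (\<lambda>x. (*) (\<iota> x)) xs 1 * m" for xs
    by (induction xs) (simp_all add: mult.assoc)
  then show "ab.act (mon w) m = \<pi> (mon w) * m" for w
    by (simp add: \<pi>_def ab.act_mon)
qed

lemma \<pi>_mult [simp]: "\<pi> (t * u) = \<pi> t * \<pi> u"
  by (simp add: \<pi>_def ab.act_mult) (simp add: act_eq_\<pi>)

lemma \<pi>_power [simp]: "\<pi> (t ^ n) = \<pi> t ^ n"
  by (induction n) simp_all

text \<open>Any word with the prescribed letter counts serves, because letters commute modulo
  \<open>I\<close>. The map is multiplicative, and a left inverse of \<open>\<pi>\<close>, only
  modulo \<open>I\<close>.\<close>

definition sec :: "('l, 'k) mpoly \<Rightarrow> ('l, 'k) free_algebra"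
  where "sec = lext mscale (\<lambda>\<alpha>. mon (Word (SOME xs. \<forall>v. count_list xs v = Poly_Mapping.lookup \<alpha> v)))"

lemma linear_sec: "Vector_Spaces.linear mscale mscale sec"
  unfolding sec_def by (rule linear_lext) (rule mvec.vector_space_axioms)

sublocale sec: Vector_Spaces.linear mscale mscale sec
  by (rule linear_sec)

lemma sec_mon:
  "\<exists>xs. sec (mon \<alpha>) = mon (Word xs) \<and> (\<forall>v. count_list xs v = Poly_Mapping.lookup \<alpha> v)"
proof -
  obtain xs where "mset xs = Abs_multiset (Poly_Mapping.lookup \<alpha>)" using ex_mset by blast
  then have "\<forall>v. count_list xs v = Poly_Mapping.lookup \<alpha> v"
    by (simp flip: count_mset)
  then have "\<exists>xs. \<forall>v. count_list xs v = Poly_Mapping.lookup \<alpha> v" by blast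
  from someI_ex[OF this] show ?thesis
    by (auto simp: sec_def lext_single[OF mvec.vector_space_axioms])
qed

definition I :: "('l, 'k) free_algebra set"
  where "I = envelope_ideal scale (\<lambda>_ _. 0) \<sigma>"

lemma ideal_I: "ideal I ring_of_type_algebra"
  unfolding I_def by (rule ideal_envelope_ideal)

lemmas I_0 = ideal_ring_of_type_algebraD(1)[OF ideal_I]
  and I_add = ideal_ring_of_type_algebraD(2)[OF ideal_I]
  and I_mult = ideal_ring_of_type_algebraD(3)[OF ideal_I]
  and I_mult_right = ideal_ring_of_type_algebraD(4)[OF ideal_I]
  and I_diff = ideal_ring_of_type_algebraD(5)[OF ideal_I]

lemma subspace_I: "mvec.subspace I"
  by (rule mvec.subspaceI) (auto simp: I_0 I_add I_mult simp flip: scalar_mult_eq_mscale)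

definition eqv (infix "\<approx>" 50) where "t \<approx> u \<longleftrightarrow> t - u \<in> I"

lemma eqv_refl [simp]: "t \<approx> t"
  by (simp add: eqv_def I_0)

lemma eqv_trans [trans]: "t \<approx> u \<Longrightarrow> u \<approx> v \<Longrightarrow> t \<approx> v"
  unfolding eqv_def using I_add[of "t - u" "u - v"] by simp

lemma eqv_sym: "t \<approx> u \<Longrightarrow> u \<approx> t"
  unfolding eqv_def using I_diff[OF I_0, of "t - u"] by simp

lemma eqv_add: "t \<approx> t' \<Longrightarrow> u \<approx> u' \<Longrightarrow> t + u \<approx> t' + u'"
  unfolding eqv_def using I_add[of "t - t'" "u - u'"] by (simp add: algebra_simps)

lemma eqv_diff: "t \<approx> t' \<Longrightarrow> u \<approx> u' \<Longrightarrow> t - u \<approx> t' - u'"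
  unfolding eqv_def using I_diff[of "t - t'" "u - u'"] by (simp add: algebra_simps)

lemma eqv_mult: "t \<approx> t' \<Longrightarrow> u \<approx> u' \<Longrightarrow> t * u \<approx> t' * u'"
  unfolding eqv_def using I_add[OF I_mult_right[of "t - t'" u] I_mult[of "u - u'" t']]
  by (simp add: algebra_simps)

lemma eqv_mscale: "t \<approx> t' \<Longrightarrow> mscale c t \<approx> mscale c t'"
  unfolding eqv_def using mvec.subspace_scale[OF subspace_I, of "t - t'" c]
  by (simp add: mvec.scale_right_diff_distrib)

lemma eqv_power: "t \<approx> t' \<Longrightarrow> t ^ n \<approx> t' ^ n"
  by (induction n) (simp_all add: eqv_mult)

lemma I_relations:
  "generator (x + y) \<approx> generator x + generator y"
  "generator (scale c x) \<approx> mscale c (generator x)"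
  "generator x * generator y \<approx> generator y * generator x"
  "generator x ^ CHAR('k) \<approx> generator (\<sigma> x)"
proof -
  have sub: "envelope_relations scale (\<lambda>_ _. 0) \<sigma> \<subseteq> I"
    unfolding I_def by (rule envelope_relations_subset)
  show "generator (x + y) \<approx> generator x + generator y"
    "generator (scale c x) \<approx> mscale c (generator x)"
    "generator x ^ CHAR('k) \<approx> generator (\<sigma> x)"
    unfolding eqv_def using sub by (auto simp: envelope_relations_def scalar_mult_eq_mscale)
  \<comment> \<open>\<open>generator 0\<close> is a nonzero element of the free algebra; homogeneity
    for the scalar 0 puts it into \<open>I\<close>.\<close>
  have "generator (scale 0 0) - scalar 0 * generator 0 \<in> I"
    using sub unfolding envelope_relations_def by blast
  then have 0: "generator 0 \<in> I" by (simp add: scalar_def)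
  have "generator x * generator y - generator y * generator x - generator 0 \<in> I"
    using sub unfolding envelope_relations_def by blast
  from I_add[OF this 0] show "generator x * generator y \<approx> generator y * generator x"
    by (simp add: eqv_def)
qed

lemma mon_Word_append: "mon (Word (xs @ ys)) = mon (Word xs) * mon (Word ys)"
  by (simp add: mult_single plus_free_monoid_def)

lemma generator_commutes_Word: "generator x * mon (Word xs) \<approx> mon (Word xs) * generator x"
proof (induction xs)
  case Nil
  then show ?case by (simp add: mon_Word_Nil)
next
  case (Cons y xs)
  have "generator x * mon (Word (y # xs)) = (generator x * generator y) * mon (Word xs)"
    by (simp add: mon_Word_Cons mult.assoc)
  also have "\<dots> \<approx> (generator y * generator x) * mon (Word xs)"
    by (intro eqv_mult I_relations eqv_refl)
  also have "\<dots> = generator y * (generator x * mon (Word xs))" by (simp add: mult.assoc)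
  also have "\<dots> \<approx> generator y * (mon (Word xs) * generator x)"
    by (intro eqv_mult Cons eqv_refl)
  finally show ?case by (simp add: mon_Word_Cons mult.assoc)
qed

lemma Word_permute: "mset xs = mset ys \<Longrightarrow> mon (Word xs) \<approx> mon (Word ys)"
proof (induction xs arbitrary: ys)
  case Nil
  then show ?case by simp
next
  case (Cons x xs)
  have "x \<in> set ys" using mset_eq_setD[OF Cons.prems] by auto
  then obtain ys1 ys2 where ys: "ys = ys1 @ x # ys2" by (meson split_list)
  with Cons.prems have "mset xs = mset (ys1 @ ys2)" by simp
  from Cons.IH[OF this] have "mon (Word (x # xs)) \<approx> generator x * mon (Word (ys1 @ ys2))"
    by (simp add: mon_Word_Cons eqv_mult)
  also have "\<dots> = (generator x * mon (Word ys1)) * mon (Word ys2)"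
    by (simp add: mon_Word_append mult.assoc)
  also have "\<dots> \<approx> (mon (Word ys1) * generator x) * mon (Word ys2)"
    by (intro eqv_mult generator_commutes_Word eqv_refl)
  also have "\<dots> = mon (Word ys)" by (simp add: ys mon_Word_append mon_Word_Cons mult.assoc)
  finally show ?case .
qed

lemma Word_count_eq: "(\<And>v. count_list xs v = count_list ys v) \<Longrightarrow> mon (Word xs) \<approx> mon (Word ys)"
  by (rule Word_permute) (simp add: multiset_eq_iff count_mset)

lemma sec_mult: "sec (f * g) \<approx> sec f * sec g"
proof -
  have 1: "sec (mon \<alpha> * mon \<beta>) \<approx> sec (mon \<alpha>) * sec (mon \<beta>)" for \<alpha> \<beta>
  proof -
    obtain xs where xs: "sec (mon \<alpha>) = mon (Word xs)" "\<And>v. count_list xs v = Poly_Mapping.lookup \<alpha> v"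
      using sec_mon by blast
    obtain ys where ys: "sec (mon \<beta>) = mon (Word ys)" "\<And>v. count_list ys v = Poly_Mapping.lookup \<beta> v"
      using sec_mon by blast
    obtain zs where zs: "sec (mon (\<alpha> + \<beta>)) = mon (Word zs)"
      "\<And>v. count_list zs v = Poly_Mapping.lookup (\<alpha> + \<beta>) v"
      using sec_mon by blast
    have "mon (Word zs) \<approx> mon (Word (xs @ ys))"
      by (rule Word_count_eq) (simp add: xs ys zs lookup_add)
    then show ?thesis by (simp add: mult_single zs xs ys plus_free_monoid_def)
  qed
  have lin: "Vector_Spaces.linear mscale mscale (\<lambda>g. sec (f * g) - sec f * sec g)" for f
    unfolding Vector_Spaces.linear_iff
    by (auto simp: mvec.vector_space_axioms sec.add sec.scale distrib_left mscale_mult_right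
        mvec.scale_right_diff_distrib)
  have lin': "Vector_Spaces.linear mscale mscale (\<lambda>f. sec (f * g) - sec f * sec g)" for g
    unfolding Vector_Spaces.linear_iff
    by (auto simp: mvec.vector_space_axioms sec.add sec.scale distrib_right mscale_mult_left
        mvec.scale_right_diff_distrib)
  show ?thesis
    unfolding eqv_def
    by (rule mvec_linear_in_subspace[OF lin' subspace_I], rule mvec_linear_in_subspace[OF lin subspace_I])
      (use 1 in \<open>simp add: eqv_def\<close>)
qed

lemma sec_1: "sec 1 = 1"
proof -
  obtain xs where xs: "sec (mon 0) = mon (Word xs)" "\<And>v. count_list xs v = Poly_Mapping.lookup 0 v"
    using sec_mon by blast
  from xs(2)[of "hd xs"] have "xs = []" by (cases xs) auto
  with xs show ?thesis by (simp add: mon_Word_Nil)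
qed

lemma sec_power: "sec (f ^ n) \<approx> sec f ^ n"
proof (induction n)
  case 0
  then show ?case by (simp add: sec_1)
next
  case (Suc n)
  have "sec (f ^ Suc n) \<approx> sec f * sec (f ^ n)" by (simp add: sec_mult)
  also have "\<dots> \<approx> sec f * sec f ^ n" by (intro eqv_mult Suc eqv_refl)
  finally show ?case by simp
qed

lemma sec_\<iota>: "sec (\<iota> x) \<approx> generator x"
proof (rule basis_induct)
  show "sec (\<iota> b) \<approx> generator b" if "b \<in> B" for b
  proof -
    obtain xs where xs: "sec (var b) = mon (Word xs)"
      "\<And>v. count_list xs v = Poly_Mapping.lookup (Poly_Mapping.single b (1::nat)) v"
      using sec_mon[of "Poly_Mapping.single b 1"] by (auto simp: var_def)
    have "mon (Word xs) \<approx> mon (Word [b])"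
      by (rule Word_count_eq) (auto simp: xs lookup_single when_def)
    then show ?thesis using that by (simp add: \<iota>_basis xs generator_def)
  qed
  have "generator 0 \<approx> 0"
    using I_relations(2)[of 0 0] by simp
  then show "subspace {x. sec (\<iota> x) \<approx> generator x}"
    by (intro subspaceI)
      (auto simp: \<iota>.add \<iota>.scale \<iota>.zero sec.add sec.scale sec.zero eqv_sym
        intro: eqv_trans[OF eqv_add eqv_sym[OF I_relations(1)]]
          eqv_trans[OF eqv_mscale eqv_sym[OF I_relations(2)]])
qed

lemma sec_\<pi>: "sec (\<pi> t) \<approx> t"
proof -
  have "sec (\<pi> (mon (Word xs))) \<approx> mon (Word xs)" for xs
  proof (induction xs)
    case Nil
    then show ?case by (simp add: mon_Word_Nil sec_1)
  next
    case (Cons x xs)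
    have "sec (\<pi> (mon (Word (x # xs)))) \<approx> sec (\<iota> x) * sec (\<pi> (mon (Word xs)))"
      by (simp add: mon_Word_Cons sec_mult)
    also have "\<dots> \<approx> generator x * mon (Word xs)" by (intro eqv_mult sec_\<iota> Cons)
    finally show ?case by (simp add: mon_Word_Cons)
  qed
  then have "sec (\<pi> (mon w)) - mon w \<in> I" for w by (cases w) (simp add: eqv_def)
  moreover have "Vector_Spaces.linear mscale mscale (\<lambda>t. sec (\<pi> t) - t)"
    unfolding Vector_Spaces.linear_iff
    by (auto simp: mvec.vector_space_axioms sec.add sec.scale \<pi>.add \<pi>.scale
        mvec.scale_right_diff_distrib)
  ultimately show ?thesis
    unfolding eqv_def using mvec_linear_in_subspace[where F = "\<lambda>t. sec (\<pi> t) - t", OF _ subspace_I]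
    by blast
qed

lemma sec_J: "f \<in> J \<Longrightarrow> sec f \<in> I"
proof -
  have "sec (g * prel x) \<in> I" for g x
  proof -
    have "sec (prel x) \<approx> sec (\<iota> x) ^ CHAR('k) - sec (\<iota> (\<sigma> x))"
      by (simp add: prel_def sec.diff eqv_diff sec_power)
    also have "\<dots> \<approx> generator x ^ CHAR('k) - generator (\<sigma> x)"
      by (intro eqv_diff eqv_power sec_\<iota>)
    also have "\<dots> \<approx> 0" using I_relations(4)[of x] by (simp add: eqv_def)
    finally have "sec g * sec (prel x) \<approx> sec g * 0" by (intro eqv_mult eqv_refl)
    with sec_mult[of g "prel x"] have "sec (g * prel x) \<approx> sec g * 0" by (rule eqv_trans)
    then show ?thesis by (simp add: eqv_def)
  qed
  then have "J \<subseteq> {f. sec f \<in> I}"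
    unfolding J_def
    by (intro mvec.span_minimal)
      (auto simp: sec.add sec.scale sec.zero I_add I_0 mvec.subspace_scale[OF subspace_I] intro!: mvec.subspaceI)
  then show "f \<in> J \<Longrightarrow> sec f \<in> I" by blast
qed

text \<open>In effect \<open>u(L)\<close> is the polynomial ring modulo \<open>J\<close>. One
  direction is the action on \<open>1\<close>; the other recovers \<open>t\<close> from
  \<open>\<pi> t\<close> through \<open>sec\<close>, which maps \<open>J\<close> into
  \<open>I\<close>.\<close>

theorem mem_I_iff: "t \<in> I \<longleftrightarrow> \<pi> t \<in> J"
proof
  assume "t \<in> I"
  then show "\<pi> t \<in> J" unfolding \<pi>_def I_def by (rule ab.act_envelope_ideal)
next
  assume "\<pi> t \<in> J"
  from sec_J[OF this] have "sec (\<pi> t) \<approx> 0" by (simp add: eqv_def)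
  with eqv_sym[OF sec_\<pi>] have "t \<approx> 0" by (rule eqv_trans)
  then show "t \<in> I" by (simp add: eqv_def)
qed

end

section \<open>Derivations of polynomial rings\<close>

text \<open>The derivation with values \<open>d v\<close> on the variables: the sum over
  \<open>v\<close> of \<open>d v\<close> times the partial derivative at \<open>v\<close>.\<close>

definition deriv_ext :: "('v \<Rightarrow> ('v, 'k::field) mpoly) \<Rightarrow> ('v, 'k) mpoly \<Rightarrow> ('v, 'k) mpoly"
  where "deriv_ext d = lext mscale (\<lambda>\<alpha>. \<Sum>v\<in>Poly_Mapping.keys \<alpha>.
    of_nat (Poly_Mapping.lookup \<alpha> v) * (d v * mon (\<alpha> - Poly_Mapping.single v 1)))"

lemma linear_deriv_ext: "Vector_Spaces.linear mscale mscale (deriv_ext d)"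
  unfolding deriv_ext_def by (rule linear_lext) (rule mvec.vector_space_axioms)

lemma deriv_ext_mon:
  assumes "finite S" "Poly_Mapping.keys \<alpha> \<subseteq> S"
  shows "deriv_ext d (mon \<alpha>) =
    (\<Sum>v\<in>S. of_nat (Poly_Mapping.lookup \<alpha> v) * (d v * mon (\<alpha> - Poly_Mapping.single v 1)))"
proof -
  have "deriv_ext d (mon \<alpha>) = (\<Sum>v\<in>Poly_Mapping.keys \<alpha>.
      of_nat (Poly_Mapping.lookup \<alpha> v) * (d v * mon (\<alpha> - Poly_Mapping.single v 1)))"
    by (simp add: deriv_ext_def lext_single[OF mvec.vector_space_axioms])
  also have "\<dots> = (\<Sum>v\<in>S. of_nat (Poly_Mapping.lookup \<alpha> v) * (d v * mon (\<alpha> - Poly_Mapping.single v 1)))"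
    using assms by (intro sum.mono_neutral_left) (auto simp: in_keys_iff)
  finally show ?thesis .
qed

lemma deriv_ext_var [simp]: "deriv_ext d (var v) = d v"
  by (simp add: var_def deriv_ext_mon[of "{v}"])

lemma deriv_ext_mult_mon:
  "deriv_ext d (mon \<alpha> * mon \<beta>) = deriv_ext d (mon \<alpha>) * mon \<beta> + mon \<alpha> * deriv_ext d (mon \<beta>)"
proof -
  let ?S = "Poly_Mapping.keys \<alpha> \<union> Poly_Mapping.keys \<beta>"
  \<comment> \<open>Exponents are subtracted with truncation at 0; the factor
    \<open>lookup \<alpha> v\<close> vanishes where this could break the identity.\<close>
  have shift: "of_nat (Poly_Mapping.lookup \<alpha> v) * (d v * mon (\<alpha> + \<beta> - Poly_Mapping.single v 1)) =
      of_nat (Poly_Mapping.lookup \<alpha> v) * (d v * mon (\<alpha> - Poly_Mapping.single v 1)) * mon \<beta>"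
    for \<alpha> \<beta> :: "'a \<Rightarrow>\<^sub>0 nat" and v
  proof (cases "Poly_Mapping.lookup \<alpha> v = 0")
    case False
    then have "\<alpha> + \<beta> - Poly_Mapping.single v 1 = \<alpha> - Poly_Mapping.single v 1 + \<beta>"
      by (intro poly_mapping_eqI) (auto simp: lookup_minus lookup_add lookup_single when_def)
    then show ?thesis by (simp add: mult_single mult.assoc)
  qed simp
  have "deriv_ext d (mon \<alpha> * mon \<beta>) = deriv_ext d (mon (\<alpha> + \<beta>))" by (simp add: mult_single)
  also have "\<dots> = (\<Sum>v\<in>?S. of_nat (Poly_Mapping.lookup (\<alpha> + \<beta>) v) *
      (d v * mon (\<alpha> + \<beta> - Poly_Mapping.single v 1)))"
    by (rule deriv_ext_mon) (auto simp: Poly_Mapping.keys_add)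
  also have "\<dots> = (\<Sum>v\<in>?S. of_nat (Poly_Mapping.lookup \<alpha> v) * (d v * mon (\<alpha> + \<beta> - Poly_Mapping.single v 1)))
     + (\<Sum>v\<in>?S. of_nat (Poly_Mapping.lookup \<beta> v) * (d v * mon (\<beta> + \<alpha> - Poly_Mapping.single v 1)))"
    by (simp add: lookup_add distrib_right sum.distrib add.commute)
  also have "\<dots> = deriv_ext d (mon \<alpha>) * mon \<beta> + deriv_ext d (mon \<beta>) * mon \<alpha>"
    unfolding shift by (subst (1 2) deriv_ext_mon[of ?S]) (auto simp: sum_distrib_right)
  finally show ?thesis by (simp add: mult.commute)
qed

locale derivation = Vector_Spaces.linear mscale mscale D
  for D :: "('v, 'k::field) mpoly \<Rightarrow> ('v, 'k) mpoly" +
  assumes leibniz: "D (f * g) = D f * g + f * D g"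
begin

lemma D_1 [simp]: "D 1 = 0"
  using leibniz[of 1 1] by simp

lemma D_of_nat [simp]: "D (of_nat n) = 0"
  by (induction n) (simp_all add: add zero)

lemma D_power: "D (f ^ n) = of_nat n * f ^ (n - 1) * D f"
proof (induction n)
  case (Suc n)
  then show ?case by (cases n) (simp_all add: leibniz algebra_simps)
qed (simp add: zero)

end

lemma derivation_deriv_ext: "derivation (deriv_ext d)"
proof -
  interpret D: Vector_Spaces.linear mscale mscale "deriv_ext d" by (rule linear_deriv_ext)
  have lin: "Vector_Spaces.linear mscale mscale (\<lambda>f. deriv_ext d (f * g))"
    "Vector_Spaces.linear mscale mscale (\<lambda>f. deriv_ext d f * g + f * deriv_ext d g)"
    "Vector_Spaces.linear mscale mscale (\<lambda>f. deriv_ext d (g * f))"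
    "Vector_Spaces.linear mscale mscale (\<lambda>f. deriv_ext d g * f + g * deriv_ext d f)" for g
    unfolding Vector_Spaces.linear_iff
    by (auto simp: mvec.vector_space_axioms D.add D.scale distrib_left distrib_right
        mscale_mult_left mscale_mult_right mvec.scale_right_distrib)
  have 1: "deriv_ext d (mon \<alpha> * g) = deriv_ext d (mon \<alpha>) * g + mon \<alpha> * deriv_ext d g" for \<alpha> g
    by (rule mvec_linear_eqI[OF lin(3,4)]) (rule deriv_ext_mult_mon)
  have "deriv_ext d (f * g) = deriv_ext d f * g + f * deriv_ext d g" for f g
    by (rule mvec_linear_eqI[OF lin(1,2)]) (rule 1)
  then show ?thesis
    by (intro derivation.intro linear_deriv_ext derivation_axioms.intro)
qed

lemma mpoly_induct_var:
  assumes "Vector_Spaces.linear mscale s F" "Vector_Spaces.linear mscale s G"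
    and "F 1 = G 1" "\<And>v f. F f = G f \<Longrightarrow> F (var v * f) = G (var v * f)"
  shows "F f = G f"
proof (rule mvec_linear_eqI[OF assms(1,2)])
  show "F (mon \<alpha>) = G (mon \<alpha>)" for \<alpha>
  proof (induction "mdeg \<alpha>" arbitrary: \<alpha> rule: less_induct)
    case less
    show ?case
    proof (cases "\<alpha> = 0")
      case False
      then obtain v where v: "Poly_Mapping.lookup \<alpha> v \<noteq> 0"
        by (metis lookup_zero poly_mapping_eqI)
      let ?\<beta> = "\<alpha> - Poly_Mapping.single v 1"
      have \<alpha>: "?\<beta> + Poly_Mapping.single v 1 = \<alpha>" using v by (intro minus_add_single) simp
      then have "mdeg ?\<beta> < mdeg \<alpha>" using mdeg_add[of ?\<beta> "Poly_Mapping.single v 1"] by simp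
      from assms(4)[OF less[OF this], of v] show ?thesis
        using \<alpha> by (simp add: var_def mult_single add.commute)
    qed (use assms(3) in simp)
  qed
qed

lemma linear_mvec_zero: "Vector_Spaces.linear mscale mscale (\<lambda>_. 0)"
  unfolding Vector_Spaces.linear_iff by (simp add: mvec.vector_space_axioms)

text \<open>
  \<open>D\<^sup>n\<close> commutes with multiplication by a variable up to \<open>n\<close> times a term, because \<open>D\<^sup>2\<close> kills
  the variables.
\<close>

lemma derivation_funpow_CHAR_eq_0:
  fixes D :: "('v, 'k::field) mpoly \<Rightarrow> ('v, 'k) mpoly"
  assumes "derivation D" "\<And>v. D (D (var v)) = 0" "CHAR('k) > 0"
  shows "(D ^^ CHAR('k)) f = 0"
proof -
  interpret derivation D by fact
  have lin: "Vector_Spaces.linear mscale mscale (D ^^ n)" for n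
  proof (induction n)
    case 0
    then show ?case by (simp add: id_def mvec.linear_ident)
  next
    case (Suc n)
    then show ?case using Vector_Spaces.linear_compose[OF Suc linear_axioms] by (simp add: o_def)
  qed
  have comm: "(D ^^ n) (var v * f) = var v * (D ^^ n) f + of_nat n * D (var v) * (D ^^ (n - 1)) f" for n v f
  proof (induction n)
    case (Suc n)
    then show ?case
      by (cases n) (simp_all add: add leibniz assms(2) algebra_simps)
  qed simp
  have char: "of_nat CHAR('k) = (0 :: ('v, 'k) mpoly)"
    using of_nat_CHAR[where 'a = "('v, 'k) mpoly"] by simp
  obtain n where "CHAR('k) = Suc n" using assms(3) gr0_implies_Suc by blast
  then have "(D ^^ CHAR('k)) 1 = (D ^^ n) (D 1)" by (simp only: funpow_Suc_right o_apply)
  also have "\<dots> = 0" using module_hom.zero[OF Vector_Spaces.linear.axioms(3)[OF lin]] by simp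
  finally have one: "(D ^^ CHAR('k)) 1 = 0" .
  show ?thesis
  proof (rule mpoly_induct_var[where F = "D ^^ CHAR('k)" and G = "\<lambda>_. 0", OF lin linear_mvec_zero])
    show "(D ^^ CHAR('k)) (var v * f) = 0" if "(D ^^ CHAR('k)) f = 0" for v f
      using that unfolding comm char by simp
  qed (rule one)
qed

text \<open>Pascal's rule: on the grid \<open>g\<close> the operator acts as a sum of two commuting
  shifts. It is used with \<open>g i j\<close> equal to \<open>a ^ i\<close> times the
  \<open>j\<close>-th iterate of \<open>D\<close> at \<open>f\<close>.\<close>

lemma funpow_binomial:
  fixes g :: "nat \<Rightarrow> nat \<Rightarrow> 'r::comm_ring_1"
  assumes add: "\<And>x y. T (x + y) = T x + T y"
    and nat: "\<And>n x. T (of_nat n * x) = of_nat n * T x"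
    and step: "\<And>i j. T (g i j) = g (Suc i) j + g i (Suc j)"
  shows "(T ^^ n) (g 0 0) = (\<Sum>i\<le>n. of_nat (n choose i) * g i (n - i))"
proof (induction n)
  case (Suc n)
  have T_sum: "T (\<Sum>i\<in>A. h i) = (\<Sum>i\<in>A. T (h i))" if "finite A" for A and h :: "nat \<Rightarrow> 'r"
    using that by induction (use add nat[of 0 0] in auto)
  have "(T ^^ Suc n) (g 0 0) = (\<Sum>i\<le>n. of_nat (n choose i) * g (Suc i) (n - i)) +
      (\<Sum>i\<le>n. of_nat (n choose i) * g i (Suc n - i))"
    by (simp add: Suc T_sum nat step sum.distrib distrib_left Suc_diff_le)
  also have "(\<Sum>i\<le>n. of_nat (n choose i) * g i (Suc n - i)) =
      (\<Sum>i\<le>Suc n. of_nat (n choose i) * g i (Suc n - i))"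
    by (simp add: binomial_eq_0)
  also have "\<dots> = g 0 (Suc n) + (\<Sum>i\<le>n. of_nat (n choose Suc i) * g (Suc i) (n - i))"
    by (subst sum.atMost_Suc_shift) simp
  finally show ?case
    by (subst sum.atMost_Suc_shift) (simp add: sum.distrib distrib_right algebra_simps)
qed simp

text \<open>A freshman's dream for operators: \<open>D a = 0\<close> makes multiplication by
  \<open>a\<close> commute with \<open>D\<close>, and the middle binomial coefficients are divisible
  by \<open>p\<close>.\<close>

lemma derivation_plus_commuting_power:
  fixes D :: "('v, 'k::field) mpoly \<Rightarrow> ('v, 'k) mpoly"
  assumes "derivation D" "D a = 0" "CHAR('k) > 0"
  shows "((\<lambda>f. a * f + D f) ^^ CHAR('k)) f = a ^ CHAR('k) * f + (D ^^ CHAR('k)) f"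
proof -
  interpret derivation D by fact
  let ?p = "CHAR('k)"
  have prime: "prime ?p" using assms(3) prime_CHAR_semidom by blast
  define g where "g i j = a ^ i * (D ^^ j) f" for i j
  have D_a: "D (a ^ i) = 0" for i by (simp add: D_power assms(2))
  have "((\<lambda>f. a * f + D f) ^^ ?p) (g 0 0) = (\<Sum>i\<le>?p. of_nat (?p choose i) * g i (?p - i))"
    by (rule funpow_binomial) (auto simp: add leibniz g_def D_a algebra_simps)
  also have "\<dots> = (\<Sum>i\<in>{0, ?p}. of_nat (?p choose i) * g i (?p - i))"
  proof (intro sum.mono_neutral_right ballI)
    fix i assume "i \<in> {..?p} - {0, ?p}"
    then have "?p dvd (?p choose i)" using prime assms(3) by (intro dvd_choose_prime) auto
    then have "of_nat (?p choose i) = (0 :: ('v, 'k) mpoly)"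
      by (simp add: of_nat_eq_0_iff_char_dvd)
    then show "of_nat (?p choose i) * g i (?p - i) = 0" by simp
  qed auto
  also have "\<dots> = a ^ ?p * f + (D ^^ ?p) f" using assms(3) by (simp add: g_def)
  finally show ?thesis by (simp add: g_def)
qed

section \<open>A representation of a restricted Lie algebra of nilpotency class two\<close>

text \<open>
  The element \<open>x\<close> acts on polynomials by multiplication with \<open>\<iota> x\<close> plus the derivation sending
  \<open>\<iota> w\<close> to \<open>\<iota> (\<beta> x w)\<close>, so that brackets act by multiplication with
  \<open>\<iota> (\<beta> x y) - \<iota> (\<beta> y x)\<close>.  The \<open>p\<close>-th power of this operator is multiplication by
  \<open>\<iota> x ^ p\<close>, except that for \<open>p = 2\<close> there is an extra summand \<open>\<iota> (\<beta> x x)\<close>, which is moved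
  into \<open>\<sigma>\<close>.
\<close>

locale class_two_twist = frobenius_space_basis scale \<sigma> B
  for scale :: "'k::field \<Rightarrow> 'l::ab_group_add \<Rightarrow> 'l" and \<sigma> B +
  fixes \<beta> :: "'l \<Rightarrow> 'l \<Rightarrow> 'l" and pmap :: "'l \<Rightarrow> 'l"
  assumes linear_\<beta>_left: "Vector_Spaces.linear scale scale (\<lambda>x. \<beta> x y)"
    and linear_\<beta>_right: "Vector_Spaces.linear scale scale (\<beta> x)"
    and \<beta>_\<beta>_right: "\<beta> x (\<beta> y w) = 0"
    and \<beta>_\<beta>_left: "\<beta> (\<beta> x y) w = 0"
    and \<beta>_pmap_left: "\<beta> (pmap x) w = 0"
    and \<beta>_pmap_right: "\<beta> w (pmap x) = 0"
    and \<sigma>: "\<beta> x x = 0 \<and> \<sigma> x = pmap x \<or> CHAR('k) = 2 \<and> \<sigma> x = pmap x - \<beta> x x"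
begin

lemmas \<beta>_add_left = module_hom.add[OF Vector_Spaces.linear.axioms(3)[OF linear_\<beta>_left]]
  and \<beta>_diff_left = module_hom.diff[OF Vector_Spaces.linear.axioms(3)[OF linear_\<beta>_left]]
  and \<beta>_scale_left = module_hom.scale[OF Vector_Spaces.linear.axioms(3)[OF linear_\<beta>_left]]
  and \<beta>_add_right = module_hom.add[OF Vector_Spaces.linear.axioms(3)[OF linear_\<beta>_right]]
  and \<beta>_diff_right = module_hom.diff[OF Vector_Spaces.linear.axioms(3)[OF linear_\<beta>_right]]
  and \<beta>_scale_right = module_hom.scale[OF Vector_Spaces.linear.axioms(3)[OF linear_\<beta>_right]]
  and \<beta>_zero_right = module_hom.zero[OF Vector_Spaces.linear.axioms(3)[OF linear_\<beta>_right]]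

lemma \<beta>_\<sigma>: "\<beta> w (\<sigma> x) = 0"
  using \<sigma>[of x] by (auto simp: \<beta>_pmap_right \<beta>_diff_right \<beta>_\<beta>_right)

text \<open>The value 0 on variables outside \<open>B\<close> keeps \<open>D h\<close> linear in
  \<open>h\<close> on all variables; on the forms \<open>\<iota> w\<close> only the values at
  \<open>B\<close> matter.\<close>

definition D :: "'l \<Rightarrow> ('l, 'k) mpoly \<Rightarrow> ('l, 'k) mpoly"
  where "D h = deriv_ext (\<lambda>b. if b \<in> B then \<iota> (\<beta> h b) else 0)"

sublocale D: derivation "D h" for h
  unfolding D_def by (rule derivation_deriv_ext)

lemma D_var: "D h (var b) = (if b \<in> B then \<iota> (\<beta> h b) else 0)"
  by (simp add: D_def)

lemma D_\<iota> [simp]: "D h (\<iota> w) = \<iota> (\<beta> h w)"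
proof (rule basis_induct[where P = "\<lambda>w. D h (\<iota> w) = \<iota> (\<beta> h w)"])
  show "subspace {w. D h (\<iota> w) = \<iota> (\<beta> h w)}"
    by (rule subspaceI)
      (auto simp: \<iota>.add \<iota>.scale \<iota>.zero D.add D.scale D.zero \<beta>_add_right \<beta>_scale_right \<beta>_zero_right)
qed (simp add: \<iota>_basis D_var)

lemma derivation_eqI:
  assumes "derivation E" "derivation E'" "\<And>v. E (var v) = E' (var v)"
  shows "E f = E' f"
proof -
  interpret E: derivation E by fact
  interpret E': derivation E' by fact
  show ?thesis
    by (rule mpoly_induct_var[OF E.linear_axioms E'.linear_axioms])
      (simp_all add: E.leibniz E'.leibniz assms(3))
qed

lemma D_add_left: "D (x + y) f = D x f + D y f"
proof -
  have "derivation (\<lambda>f. D x f + D y f)"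
    by unfold_locales (auto simp: D.add D.scale D.leibniz mvec.scale_right_distrib algebra_simps)
  from derivation_eqI[OF D.derivation_axioms this] show ?thesis
    by (simp add: D_var \<beta>_add_left \<iota>.add)
qed

lemma D_scale_left: "D (scale c x) f = mscale c (D x f)"
proof -
  have "derivation (\<lambda>f. mscale c (D x f))"
    by unfold_locales
      (auto simp: D.add D.scale D.leibniz mvec.scale_right_distrib mscale_mult_left mscale_mult_right mult.commute)
  from derivation_eqI[OF D.derivation_axioms this] show ?thesis
    by (simp add: D_var \<beta>_scale_left \<iota>.scale)
qed

lemma derivation_zero: "derivation (\<lambda>_. 0)"
  by unfold_locales (auto)

lemma D_eq_0: "(\<And>w. \<beta> x w = 0) \<Longrightarrow> D x f = 0"
  using derivation_eqI[OF D.derivation_axioms derivation_zero] by (simp add: D_var \<iota>.zero)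

text \<open>A commutator of derivations is a derivation, and this one vanishes on variables because
  \<open>\<beta> x (\<beta> y w) = 0\<close>.\<close>

lemma D_D_commute: "D x (D y f) = D y (D x f)"
proof -
  have "derivation (\<lambda>f. D x (D y f) - D y (D x f))"
    by unfold_locales
      (auto simp: D.add D.scale D.leibniz mvec.scale_right_diff_distrib algebra_simps)
  from derivation_eqI[OF this derivation_zero, of f] show ?thesis
    by (simp add: D_var \<beta>_\<beta>_right \<iota>.zero D.zero)
qed

text \<open>Derivations kill \<open>p\<close>-th powers, and
  \<open>\<beta> h (\<sigma> x) = 0\<close>, so every \<open>prel x\<close> is annihilated; the
  Leibniz rule does the rest.\<close>

lemma D_J: "f \<in> J \<Longrightarrow> D h f \<in> J"
proof -
  have "D h (prel x) = 0" for x
    using of_nat_CHAR[where 'a = "('l, 'k) mpoly"]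
    by (simp add: prel_def D.diff D.D_power \<beta>_\<sigma> \<iota>.zero)
  then have "D h (g * prel x) \<in> J" for g x by (simp add: D.leibniz J_mult prel_mem_J)
  then have "{g * prel x | g x. True} \<subseteq> {f. D h f \<in> J}" by auto
  moreover have "mvec.subspace {f. D h f \<in> J}"
    by (rule mvec.subspaceI) (auto simp: D.add D.scale D.zero J_0 J_add J_scale)
  ultimately have "mvec.span {g * prel x | g x. True} \<subseteq> {f. D h f \<in> J}"
    by (rule mvec.span_minimal)
  then have "J \<subseteq> {f. D h f \<in> J}" by (simp only: J_def[symmetric])
  then show "f \<in> J \<Longrightarrow> D h f \<in> J" by blast
qed

lemma D_funpow_CHAR: "(D h ^^ CHAR('k)) f = 0"
  by (rule derivation_funpow_CHAR_eq_0[OF D.derivation_axioms _ CHAR_pos])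
    (simp add: D_var \<beta>_\<beta>_right \<iota>.zero D.zero)

lemma twist_power:
  "((\<lambda>f. \<iota> x * f + D x f) ^^ CHAR('k)) f - \<iota> (pmap x) * f = prel x * f"
proof (cases "\<beta> x x = 0 \<and> \<sigma> x = pmap x")
  case True
  then have "((\<lambda>f. \<iota> x * f + D x f) ^^ CHAR('k)) f = \<iota> x ^ CHAR('k) * f"
    by (subst derivation_plus_commuting_power[OF D.derivation_axioms _ CHAR_pos])
      (simp_all add: D_funpow_CHAR \<iota>.zero)
  with True show ?thesis by (simp add: prel_def left_diff_distrib)
next
  case False
  with \<sigma>[of x] have p: "CHAR('k) = 2" and s: "\<sigma> x = pmap x - \<beta> x x" by auto
  have two: "(2 :: ('l, 'k) mpoly) = 0"
    using of_nat_CHAR[where 'a = "('l, 'k) mpoly"] p by simp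
  have DD: "D x (D x f) = 0" using D_funpow_CHAR[of x f] by (simp add: p numeral_2_eq_2)
  \<comment> \<open>Multiplication by \<open>\<iota> x\<close> and \<open>D x\<close> fail to
    commute by \<open>\<iota> (\<beta> x x)\<close>, exactly the term absorbed by
    \<open>\<sigma> x\<close>.\<close>
  have "((\<lambda>f. \<iota> x * f + D x f) ^^ CHAR('k)) f = \<iota> x ^ 2 * f + \<iota> (\<beta> x x) * f + 2 * (\<iota> x * D x f)"
    by (simp add: p numeral_2_eq_2 D.add D.leibniz DD) (simp add: algebra_simps power2_eq_square)
  then show ?thesis by (simp add: two prel_def p s \<iota>.diff algebra_simps)
qed

sublocale twist: restricted_action mscale scale "\<lambda>x y. \<beta> x y - \<beta> y x" pmap "\<lambda>x f. \<iota> x * f + D x f" J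
proof
  \<comment> \<open>Brackets and values of \<open>pmap\<close> lie in the left radical of
    \<open>\<beta>\<close>, so they act by multiplication alone.\<close>
  have [simp]: "D (\<beta> x y - \<beta> y x) f = 0" "D (pmap x) f = 0" for x y f
    by (rule D_eq_0, simp add: \<beta>_diff_left \<beta>_\<beta>_left \<beta>_pmap_left)+
  show "\<iota> x * (\<iota> y * m + D y m) + D x (\<iota> y * m + D y m) - (\<iota> y * (\<iota> x * m + D x m) + D y (\<iota> x * m + D x m))
      - (\<iota> (\<beta> x y - \<beta> y x) * m + D (\<beta> x y - \<beta> y x) m) \<in> J" for x y m
    by (simp add: D.add D.leibniz D_D_commute[of x y] \<iota>.diff algebra_simps J_0)
  show "((\<lambda>f. \<iota> x * f + D x f) ^^ CHAR('k)) m - (\<iota> (pmap x) * m + D (pmap x) m) \<in> J" for x m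
    using J_mult_right[OF prel_mem_J] by (simp add: twist_power)
qed (auto simp: D.add D.scale D_add_left D_scale_left \<iota>.add \<iota>.scale distrib_left distrib_right
    mscale_mult_left mscale_mult_right mvec.scale_right_distrib subspace_J J_0 J_add J_mult D_J)

text \<open>Derivations kill \<open>1\<close>, so a generator sends \<open>1\<close> to the linear
  form \<open>\<iota> z\<close>; for a basis vector this is a variable, hence outside
  \<open>J\<close>.\<close>

theorem generator_basis_not_mem:
  assumes "z \<in> B" "\<And>w. \<beta> z w = 0"
  shows "generator z \<notin> envelope_ideal scale (\<lambda>x y. \<beta> x y - \<beta> y x) pmap"
proof
  assume "generator z \<in> envelope_ideal scale (\<lambda>x y. \<beta> x y - \<beta> y x) pmap"
  from twist.act_envelope_ideal[OF this, of 1] have "\<iota> z \<in> J" by simp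
  with basis_not_mem_J[OF assms(1)] show False by blast
qed

end

section \<open>Restricted Lie algebras with commutative enveloping algebra\<close>

context restricted_lie_algebra
begin

lemmas bracket_add_left = module_hom.add[OF Vector_Spaces.linear.axioms(3)[OF bracket_linear_left]]
  and bracket_scale_left = module_hom.scale[OF Vector_Spaces.linear.axioms(3)[OF bracket_linear_left]]
  and bracket_zero_left = module_hom.zero[OF Vector_Spaces.linear.axioms(3)[OF bracket_linear_left]]
  and bracket_add_right = module_hom.add[OF Vector_Spaces.linear.axioms(3)[OF bracket_linear_right]]
  and bracket_scale_right = module_hom.scale[OF Vector_Spaces.linear.axioms(3)[OF bracket_linear_right]]
  and bracket_zero_right = module_hom.zero[OF Vector_Spaces.linear.axioms(3)[OF bracket_linear_right]]
  and bracket_minus_right = module_hom.neg[OF Vector_Spaces.linear.axioms(3)[OF bracket_linear_right]]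

lemma bracket_antisym: "bracket x y = - bracket y x"
proof -
  have "bracket (x + y) (x + y) = bracket x y + bracket y x"
    unfolding bracket_add_left bracket_add_right by (simp add: bracket_self)
  then have "bracket x y + bracket y x = 0" using bracket_self[of "x + y"] by simp
  then show ?thesis by (simp add: eq_neg_iff_add_eq_0)
qed

sublocale ad: restricted_action scale scale bracket pmap bracket "{0}"
proof
  show "bracket x (bracket y m) - bracket y (bracket x m) - bracket (bracket x y) m \<in> {0}" for x y m
    using jacobi[of x y m] bracket_antisym[of m x] bracket_antisym[of m "bracket x y"]
    by (simp add: bracket_minus_right algebra_simps)
qed (auto simp: bracket_add_left bracket_scale_left bracket_add_right bracket_scale_right
    bracket_zero_right pmap_ad)

definition centre :: "'l set"
  where "centre = {z. \<forall>w. bracket z w = 0}"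

lemma subspace_centre: "subspace centre"
  by (rule subspaceI) (auto simp: centre_def bracket_add_left bracket_scale_left bracket_zero_left)

lemma bracket_centre_right: "z \<in> centre \<Longrightarrow> bracket w z = 0"
  using bracket_antisym[of w z] by (simp add: centre_def)

text \<open>\<open>\<beta>\<close> is triangular with respect to an ordered basis extending a basis of the centre.\<close>

lemma ex_triangular_form:
  obtains \<beta> where "\<And>y. Vector_Spaces.linear scale scale (\<lambda>x. \<beta> x y)"
    "\<And>x. Vector_Spaces.linear scale scale (\<beta> x)"
    "\<And>x y. \<beta> x y - \<beta> y x = bracket x y"
    "\<And>z w. z \<in> centre \<Longrightarrow> \<beta> z w = 0" "\<And>z w. z \<in> centre \<Longrightarrow> \<beta> w z = 0"
    "\<And>V x y. subspace V \<Longrightarrow> (\<And>a b. bracket a b \<in> V) \<Longrightarrow> \<beta> x y \<in> V"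
proof -
  interpret vp: vector_space_pair scale scale by unfold_locales
  obtain B0 where B0: "B0 \<subseteq> centre" "independent B0" "centre \<subseteq> span B0"
    using maximal_independent_subset[of centre] by blast
  define B where "B = extend_basis B0"
  have B: "independent B" "span B = UNIV" "B0 \<subseteq> B"
    unfolding B_def using extend_basis_superset[OF B0(2)] independent_extend_basis[OF B0(2)]
      span_extend_basis[OF B0(2)] by auto
  obtain r :: "'l rel" where "well_order_on UNIV r" using well_order_on by blast
  then have r: "antisym r" "total r"
    by (auto simp: well_order_on_def linear_order_on_def partial_order_on_def)
  \<comment> \<open>For distinct \<open>a\<close> and \<open>b\<close> exactly one of the two pairs
    lies in \<open>r\<close>, and the diagonal contributes 0, so antisymmetrising returns the
    bracket in every characteristic, with no division by two.\<close>
  define \<gamma> where "\<gamma> a b = (if (a, b) \<in> r then bracket a b else 0)" for a b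
  define \<beta> where "\<beta> x y = vp.construct B (\<lambda>a. vp.construct B (\<gamma> a) y) x" for x y
  have lin_left: "Vector_Spaces.linear scale scale (\<lambda>x. \<beta> x y)" for y
    unfolding \<beta>_def by (rule vp.linear_construct) (rule B)
  have lin: "Vector_Spaces.linear scale scale (vp.construct B (\<gamma> a))" for a
    by (rule vp.linear_construct) (rule B)
  have lin_right: "Vector_Spaces.linear scale scale (\<beta> x)" for x
    unfolding Vector_Spaces.linear_iff \<beta>_def
    by (auto simp: vp.construct_add[OF B(1), symmetric] vp.construct_scale[OF B(1), symmetric]
        vector_space_axioms module_hom.add[OF Vector_Spaces.linear.axioms(3)[OF lin]]
        module_hom.scale[OF Vector_Spaces.linear.axioms(3)[OF lin]])
  have \<beta>_basis: "\<beta> a b = \<gamma> a b" if "a \<in> B" "b \<in> B" for a b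
    using that B(1) by (simp add: \<beta>_def vp.construct_basis)
  interpret L: Vector_Spaces.linear scale scale "\<lambda>x. \<beta> x y" for y by (rule lin_left)
  interpret R: Vector_Spaces.linear scale scale "\<beta> x" for x by (rule lin_right)
  have bil: "P x y" if sub: "\<And>x. subspace {y. P x y}" "\<And>y. subspace {x. P x y}"
    and base: "\<And>a b. a \<in> A \<Longrightarrow> b \<in> C \<Longrightarrow> P a b" and x: "x \<in> span A" and y: "y \<in> span C" for P A C x y
  proof -
    have "P a y" if "a \<in> A" for a
      using span_minimal[OF _ sub(1)[of a], of C] base[OF that] y by blast
    then show ?thesis using span_minimal[OF _ sub(2)[of y], of A] x by blast
  qed
  have antisymmetrisation: "\<beta> x y - \<beta> y x = bracket x y" for x y
  proof (rule bil[where P = "\<lambda>x y. \<beta> x y - \<beta> y x = bracket x y" and A = B and C = B])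
    show "\<beta> a b - \<beta> b a = bracket a b" if ab: "a \<in> B" "b \<in> B" for a b
    proof (cases "a = b")
      case False
      then have "(a, b) \<in> r \<and> (b, a) \<notin> r \<or> (a, b) \<notin> r \<and> (b, a) \<in> r"
        using r unfolding antisym_def total_on_def by blast
      then show ?thesis
        using \<beta>_basis[OF ab] \<beta>_basis[OF ab(2,1)] bracket_antisym[of a b] by (auto simp: \<gamma>_def)
    qed (simp add: bracket_self)
  qed (auto simp: B L.add R.add L.scale R.scale L.zero R.zero bracket_add_left bracket_add_right
      bracket_scale_left bracket_scale_right bracket_zero_left bracket_zero_right
      scale_right_diff_distrib intro!: subspaceI, simp_all add: algebra_simps)
  have mem: "\<beta> x y \<in> V" if V: "subspace V" "\<And>a b. bracket a b \<in> V" for V x y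
    by (rule bil[where P = "\<lambda>x y. \<beta> x y \<in> V" and A = B and C = B])
      (auto simp: B L.add R.add L.scale R.scale L.zero R.zero \<beta>_basis \<gamma>_def V
        subspace_add[OF V(1)] subspace_scale[OF V(1)] subspace_0[OF V(1)] intro!: subspaceI)
  have centre_left: "\<beta> z w = 0" if "z \<in> centre" for z w
  proof (rule bil[where P = "\<lambda>z w. \<beta> z w = 0" and A = B0 and C = B])
    show "\<beta> a b = 0" if "a \<in> B0" "b \<in> B" for a b
      using that B B0(1) by (auto simp: \<beta>_basis subsetD \<gamma>_def centre_def)
  qed (use B0(3) B that in \<open>auto simp: L.add R.add L.scale R.scale L.zero R.zero intro!: subspaceI\<close>)
  have centre_right: "\<beta> w z = 0" if "z \<in> centre" for z w
  proof (rule bil[where P = "\<lambda>w z. \<beta> w z = 0" and A = B and C = B0])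
    show "\<beta> a b = 0" if "a \<in> B" "b \<in> B0" for a b
      using that B B0(1) by (auto simp: \<beta>_basis subsetD \<gamma>_def bracket_centre_right)
  qed (use B0(3) B that in \<open>auto simp: L.add R.add L.scale R.scale L.zero R.zero intro!: subspaceI\<close>)
  show ?thesis
    by (rule that[OF lin_left lin_right antisymmetrisation centre_left centre_right mem])
qed

lemma pmap_add_class_two:
  assumes central: "\<And>x y. bracket x y \<in> centre"
  shows "pmap (x + y) = pmap x + pmap y + (if CHAR('k) = 2 then bracket y x else 0)"
proof (cases "CHAR('k) = 2")
  case True
  then have "{1..<CHAR('k)} = {1}" by auto
  with True show ?thesis
    by (simp add: pmap_add[of x y] jacobson_s_def ad_pencil_def coeff_map_poly
        bracket_zero_right bracket_self)
next
  case False
  have "prime CHAR('k)" using CHAR_pos prime_CHAR_semidom by blast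
  then have "CHAR('k) > 1" by (rule prime_gt_1_nat)
  \<comment> \<open>For \<open>p > 2\<close> Jacobson's formula applies \<open>ad\<close> at least
    twice: one application leaves central coefficients, the next kills them.\<close>
  with False have "CHAR('k) - 1 = Suc (Suc (CHAR('k) - 3))" by simp
  moreover have "poly.coeff (ad_pencil x y q) n \<in> centre" for q n
    by (auto simp: ad_pencil_def coeff_map_poly bracket_zero_right coeff_pCons central
        intro!: subspace_add[OF subspace_centre] split: nat.split)
  then have "ad_pencil x y (ad_pencil x y q) = 0" for q
    by (intro poly_eqI) (simp add: ad_pencil_def[of x y "ad_pencil x y q"] coeff_map_poly
        bracket_zero_right coeff_pCons bracket_centre_right split: nat.split)
  moreover have "ad_pencil x y 0 = 0" by (simp add: ad_pencil_def)
  ultimately have "(ad_pencil x y ^^ (CHAR('k) - 1)) [:x:] = 0"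
    by (simp only: funpow.simps o_apply)
  then have "jacobson_s i x y = 0" for i by (simp add: jacobson_s_def)
  with False show ?thesis by (simp add: pmap_add)
qed

lemma pmap_mem_centre:
  assumes "\<And>x y. bracket x y \<in> centre"
  shows "pmap x \<in> centre"
proof -
  have "prime CHAR('k)" using CHAR_pos prime_CHAR_semidom by blast
  then have "CHAR('k) > 1" by (rule prime_gt_1_nat)
  then obtain n where n: "CHAR('k) = Suc (Suc n)" using less_imp_Suc_add[of 1] by auto
  have "(bracket x ^^ m) 0 = 0" for m
    by (induction m) (simp_all add: bracket_zero_right)
  then have "bracket (pmap x) w = 0" for w
    by (simp only: pmap_ad n funpow_Suc_right o_apply bracket_centre_right[OF assms])
  then show ?thesis by (simp add: centre_def)
qed

text \<open>Supplies the data of \<open>class_two_twist\<close> with a basis containing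
  \<open>z\<close>. In odd characteristic half the bracket is alternating and \<open>pmap\<close> is
  already additive; in characteristic two the triangular form takes over.\<close>

lemma class_two_generator_not_mem:
  assumes central: "\<And>x y. bracket x y \<in> centre" and z: "z \<in> centre" "z \<noteq> 0"
  shows "generator z \<notin> envelope_ideal scale bracket pmap"
proof -
  note pc = pmap_mem_centre[OF central]
  define B where "B = extend_basis {z}"
  have iz: "independent {z}" using z(2) by simp
  have B: "independent B" "span B = UNIV" "z \<in> B"
    unfolding B_def using extend_basis_superset[OF iz] independent_extend_basis[OF iz]
      span_extend_basis[OF iz] by auto
  obtain \<beta> \<sigma> where \<beta>: "\<And>y. Vector_Spaces.linear scale scale (\<lambda>x. \<beta> x y)"
    "\<And>x. Vector_Spaces.linear scale scale (\<beta> x)"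
    "\<And>x y. \<beta> x y - \<beta> y x = bracket x y"
    "\<And>z w. z \<in> centre \<Longrightarrow> \<beta> z w = 0" "\<And>z w. z \<in> centre \<Longrightarrow> \<beta> w z = 0"
    "\<And>x y. \<beta> x y \<in> centre"
    and \<sigma>: "\<And>x. \<beta> x x = 0 \<and> \<sigma> x = pmap x \<or> CHAR('k) = 2 \<and> \<sigma> x = pmap x - \<beta> x x"
      "\<And>x y. \<sigma> (x + y) = \<sigma> x + \<sigma> y" "\<And>c x. \<sigma> (scale c x) = scale (c ^ CHAR('k)) (\<sigma> x)"
  proof (cases "CHAR('k) = 2")
    case True
    obtain \<beta> where \<beta>: "\<And>y. Vector_Spaces.linear scale scale (\<lambda>x. \<beta> x y)"
      "\<And>x. Vector_Spaces.linear scale scale (\<beta> x)"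
      "\<And>x y. \<beta> x y - \<beta> y x = bracket x y"
      "\<And>z w. z \<in> centre \<Longrightarrow> \<beta> z w = 0" "\<And>z w. z \<in> centre \<Longrightarrow> \<beta> w z = 0"
      "\<And>V x y. subspace V \<Longrightarrow> (\<And>a b. bracket a b \<in> V) \<Longrightarrow> \<beta> x y \<in> V"
      using ex_triangular_form by blast
    interpret L: Vector_Spaces.linear scale scale "\<lambda>x. \<beta> x y" for y by (rule \<beta>)
    interpret R: Vector_Spaces.linear scale scale "\<beta> x" for x by (rule \<beta>)
    \<comment> \<open>\<open>pmap\<close> fails to be additive by a bracket, and in characteristic
      two so does the quadratic map \<open>\<beta> x x\<close>, whose polarisation is
      \<open>\<beta> x y + \<beta> y x\<close>; the difference is additive.\<close>
    define \<sigma> where "\<sigma> x = pmap x - \<beta> x x" for x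
    have two: "v + v = 0" for v :: 'l
      using scale_left_distrib[of 1 1 v] of_nat_CHAR[where 'a = 'k] True by (simp add: one_add_one)
    have "\<sigma> (x + y) = \<sigma> x + \<sigma> y" for x y
    proof -
      have "\<sigma> (x + y) = \<sigma> x + \<sigma> y + (bracket y x - \<beta> x y - \<beta> y x)"
        using True by (simp add: \<sigma>_def pmap_add_class_two[OF central] L.add R.add algebra_simps)
      also have "bracket y x - \<beta> x y - \<beta> y x = - (\<beta> x y + \<beta> x y)"
        by (simp flip: \<beta>(3))
      finally show ?thesis by (simp add: two)
    qed
    moreover have "\<sigma> (scale c x) = scale (c ^ CHAR('k)) (\<sigma> x)" for c x
      by (simp add: \<sigma>_def pmap_scale L.scale R.scale True power2_eq_square scale_right_diff_distrib)
    ultimately show ?thesis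
      using \<beta>(1-5) \<beta>(6)[OF subspace_centre central] True by (intro that[of \<beta> \<sigma>]) (auto simp: \<sigma>_def)
  next
    case False
    define \<beta> where "\<beta> x y = scale (inverse 2) (bracket x y)" for x y
    have two: "(2::'k) \<noteq> 0"
    proof
      assume "(2::'k) = 0"
      then have "CHAR('k) dvd 2" using of_nat_eq_0_iff_char_dvd[of 2, where 'a = 'k] by simp
      moreover have "prime CHAR('k)" using CHAR_pos prime_CHAR_semidom by blast
      ultimately show False using False primes_dvd_imp_eq two_is_prime_nat by blast
    qed
    interpret vp: vector_space_pair scale scale by unfold_locales
    have "\<beta> x y - \<beta> y x = bracket x y" for x y
    proof -
      have "\<beta> x y - \<beta> y x = scale (inverse 2 + inverse 2) (bracket x y)"
        by (simp only: \<beta>_def bracket_antisym[of y x] scale_left_distrib scale_minus_right diff_minus_eq_add)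
      also have "inverse 2 + inverse 2 = (1::'k)" using two by (simp add: field_simps)
      finally show ?thesis by simp
    qed
    moreover have "Vector_Spaces.linear scale scale (\<lambda>x. \<beta> x y)" "Vector_Spaces.linear scale scale (\<beta> y)" for y
      unfolding \<beta>_def using bracket_linear_left bracket_linear_right
      by (auto intro!: vp.linear_compose_scale_right)
    moreover have "\<beta> z w = 0" "\<beta> w z = 0" if "z \<in> centre" for z w
      using that by (simp_all add: \<beta>_def bracket_centre_right) (simp add: centre_def)
    moreover have "\<beta> x y \<in> centre" for x y
      unfolding \<beta>_def by (intro subspace_scale subspace_centre central)
    moreover have "\<beta> x x = 0" for x by (simp add: \<beta>_def bracket_self)
    moreover have "pmap (x + y) = pmap x + pmap y" for x y
      using False by (simp add: pmap_add_class_two[OF central])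
    ultimately show ?thesis
      by (intro that[of \<beta> pmap]) (simp_all add: pmap_scale)
  qed
  note lin = \<beta>(1,2)[unfolded Vector_Spaces.linear_iff]
  interpret class_two_twist scale \<sigma> B \<beta> pmap
  proof
    show "\<beta> (x + y) w = \<beta> x w + \<beta> y w" "\<beta> w (x + y) = \<beta> w x + \<beta> w y"
      "\<beta> (scale c x) w = scale c (\<beta> x w)" "\<beta> w (scale c x) = scale c (\<beta> w x)" for c x y w
      using lin by blast+
    show "\<beta> x x = 0 \<and> \<sigma> x = pmap x \<or> CHAR('k) = 2 \<and> \<sigma> x = pmap x - \<beta> x x" for x
      by (rule \<sigma>)
    show "\<beta> x (\<beta> y w) = 0" "\<beta> (\<beta> x y) w = 0" "\<beta> (pmap x) w = 0" "\<beta> w (pmap x) = 0" for x y w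
      by (intro \<beta>(4,5,6) pc)+
  qed (rule B \<beta> \<sigma> CHAR_pos)+
  have "(\<lambda>x y. \<beta> x y - \<beta> y x) = bracket" by (intro ext \<beta>(3))
  with generator_basis_not_mem[OF B(3) \<beta>(4)[OF z(1)]] show ?thesis by simp
qed

theorem commutative_envelope_imp_abelian:
  assumes "\<And>x y. generator x * generator y - generator y * generator x \<in> envelope_ideal scale bracket pmap"
  shows "abelian"
proof -
  have mem: "generator (bracket x y) \<in> envelope_ideal scale bracket pmap" for x y
  proof -
    have "generator x * generator y - generator y * generator x - generator (bracket x y)
        \<in> envelope_ideal scale bracket pmap"
      using envelope_relations_subset[of scale bracket pmap] unfolding envelope_relations_def by blast
    from ideal_ring_of_type_algebraD(5)[OF ideal_envelope_ideal assms[of x y] this]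
    show ?thesis by simp
  qed
  have central: "bracket x y \<in> centre" for x y
    using ad.act_envelope_ideal[OF mem[of x y]] by (simp add: centre_def)
  show ?thesis
    unfolding abelian_def using class_two_generator_not_mem[OF central central] mem by blast
qed

end

section \<open>Semilinear maps over an algebraically closed field\<close>

lemma (in vector_space) span_image_finite:
  assumes "finite A" "x \<in> span (f ` A)"
  shows "\<exists>c. x = (\<Sum>i\<in>A. scale (c i) (f i))"
  using assms
proof (induction A arbitrary: x)
  case (insert a A)
  then obtain k where "x - scale k (f a) \<in> span (f ` A)"
    by (auto simp: span_breakdown_eq)
  then obtain c where "x - scale k (f a) = (\<Sum>i\<in>A. scale (c i) (f i))"
    using insert.IH by blast
  moreover have "(\<Sum>i\<in>A. scale ((c(a := k)) i) (f i)) = (\<Sum>i\<in>A. scale (c i) (f i))"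
    using insert.hyps by (intro sum.cong) auto
  ultimately have "x = (\<Sum>i\<in>insert a A. scale ((c(a := k)) i) (f i))"
    using insert.hyps by (simp add: algebra_simps)
  then show ?case by blast
qed simp

lemma (in vector_space) span_Int_eq_0:
  assumes "independent (A \<union> D)" "A \<inter> D = {}" "x \<in> span A" "x \<in> span D"
  shows "x = 0"
proof -
  have "representation A x = representation D x"
    using representation_extend[OF assms(1,3)] representation_extend[OF assms(1,4)] by simp
  then have "representation A x b = 0" for b
    using representation_ne_zero[of A x b] representation_ne_zero[of D x b] assms(2) by auto
  moreover have "independent A" using assms(1) independent_mono by blast
  ultimately show ?thesis
    using sum_nonzero_representation_eq[of A x] assms(3) by simp
qed

locale fd_frobenius_space =
  frobenius_space scale \<sigma> + finite_dimensional_vector_space scale Basis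
  for scale :: "'k::alg_closed_field \<Rightarrow> 'l::ab_group_add \<Rightarrow> 'l" and \<sigma> Basis
begin

lemma ex_root_CHAR: "\<exists>d. d ^ CHAR('k) = (c :: 'k)"
  using nth_root_exists[OF CHAR_pos, of c] by blast

lemma frobenius_add: "(a + b) ^ CHAR('k) = a ^ CHAR('k) + (b :: 'k) ^ CHAR('k)"
  by (rule freshmans_dream[OF prime_CHAR refl])

text \<open>
  For the scalar multiplication \<open>c \<cdot> y = c\<^sup>p y\<close> on the codomain, \<open>\<sigma>\<close> is linear.  Since the
  field is perfect, subspaces and spans are the same as for the original one.
\<close>

definition fscale :: "'k \<Rightarrow> 'l \<Rightarrow> 'l"
  where "fscale c y = scale (c ^ CHAR('k)) y"

sublocale tw: vector_space fscale
  by unfold_locales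
    (auto simp: fscale_def scale_right_distrib frobenius_add scale_left_distrib power_mult_distrib)

lemma linear_\<sigma>: "Vector_Spaces.linear scale fscale \<sigma>"
  unfolding Vector_Spaces.linear_iff
  by (simp add: vector_space_axioms tw.vector_space_axioms \<sigma>_add \<sigma>_scale fscale_def)

sublocale \<sigma>: Vector_Spaces.linear scale fscale \<sigma>
  by (rule linear_\<sigma>)

lemma tw_subspace: "tw.subspace = subspace"
proof (rule ext)
  show "tw.subspace S = subspace S" for S
    unfolding tw.subspace_def subspace_def fscale_def using ex_root_CHAR by metis
qed

lemma tw_span: "tw.span = span"
  by (rule ext) (simp add: tw.span_def span_def tw_subspace)

lemma tw_dependent: "tw.dependent = dependent"
  by (rule ext) (simp add: tw.dependent_def dependent_def tw_span)

lemma subspace_image_\<sigma>: "subspace S \<Longrightarrow> subspace (\<sigma> ` S)"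
  using \<sigma>.subspace_image[of S] by (simp add: tw_subspace)

lemma span_image_\<sigma>: "span (\<sigma> ` S) = \<sigma> ` span S"
  using \<sigma>.span_image[of S] by (simp add: tw_span)

definition kern :: "'l set \<Rightarrow> 'l set"
  where "kern S = {x \<in> S. \<sigma> x = 0}"

lemma subspace_kern: "subspace S \<Longrightarrow> subspace (kern S)"
  unfolding kern_def
  by (rule subspaceI) (auto simp: subspace_0 subspace_add subspace_scale \<sigma>_0 \<sigma>_add \<sigma>_scale)

text \<open>The basis-extension proof for linear maps carries over because span and independence for
  the twisted scalars are the original ones.\<close>

lemma rank_nullity:
  assumes "subspace S"
  shows "dim (\<sigma> ` S) + dim (kern S) = dim S"
proof -
  obtain A where A: "A \<subseteq> kern S" "independent A" "kern S \<subseteq> span A"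
    using maximal_independent_subset[of "kern S"] by blast
  have AS: "A \<subseteq> S" using A(1) by (auto simp: kern_def)
  obtain B where B: "A \<subseteq> B" "B \<subseteq> S" "independent B" "S \<subseteq> span B"
    using maximal_independent_subset_extend[OF AS A(2)] by blast
  define D where "D = B - A"
  have D: "independent D" "B = A \<union> D" "A \<inter> D = {}" "D \<subseteq> S"
    using B independent_mono by (auto simp: D_def)
  have SB: "span B = S" using B(2,4) assms by (intro antisym span_minimal)
  have kA: "span A = kern S" using A(1,3) subspace_kern[OF assms] by (intro antisym span_minimal)
  have "x = 0" if x: "x \<in> span D" "\<sigma> x = 0" for x
  proof (rule span_Int_eq_0[of A D])
    show "x \<in> span A" using x span_minimal[OF D(4) assms] by (auto simp: kA kern_def)
  qed (use B(3) D x in auto)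
  then have inj: "inj_on \<sigma> (span D)" by (auto simp: \<sigma>.inj_on_iff_eq_0[OF subspace_span])
  have "independent (\<sigma> ` D)"
    using \<sigma>.independent_injective_image[OF D(1) inj] by (simp add: tw_dependent)
  moreover have "\<sigma> ` S = span (\<sigma> ` D)"
  proof -
    have "\<sigma> ` S = span (\<sigma> ` A \<union> \<sigma> ` D)"
      by (simp add: SB[symmetric] span_image_\<sigma>[symmetric] D(2) image_Un)
    also have "\<dots> = span (\<sigma> ` D)"
    proof (intro antisym span_minimal)
      show "\<sigma> ` A \<union> \<sigma> ` D \<subseteq> span (\<sigma> ` D)"
        using A(1) by (auto simp: kern_def span_zero span_base)
    qed (auto intro: span_base)
    finally show ?thesis .
  qed
  ultimately have "dim (\<sigma> ` S) = card (\<sigma> ` D)" by (simp add: dim_eq_card_independent)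
  also have "\<dots> = card D" by (rule card_image) (rule inj_on_subset[OF inj span_superset])
  finally have "dim (\<sigma> ` S) = card D" .
  moreover have "dim (kern S) = card A" using A(2) by (simp flip: kA add: dim_eq_card_independent)
  moreover have "dim S = card B" using B(3) by (simp flip: SB add: dim_eq_card_independent)
  moreover have "card B = card A + card D"
    using D finiteI_independent[OF A(2)] finiteI_independent[OF D(1)] by (simp add: card_Un_disjoint)
  ultimately show ?thesis by simp
qed

lemma inj_on_if_image_eq:
  assumes "subspace S" "\<sigma> ` S = S"
  shows "inj_on \<sigma> S"
proof -
  have "dim (kern S) = 0" using rank_nullity[OF assms(1)] assms(2) by simp
  then have "kern S \<subseteq> {0}" by (metis dim_eq_0)
  then show ?thesis by (auto simp: \<sigma>.inj_on_iff_eq_0[OF assms(1)] kern_def)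
qed

text \<open>
  Polynomials \<open>A\<^sub>i\<close> such that \<open>\<Sum>\<^sub>i A\<^sub>i(s) \<sigma>\<^sup>i(w)\<close> is fixed by \<open>\<sigma>\<close> whenever
  \<open>\<sigma>\<^sup>n(w) = \<Sum>\<^bsub>i<n\<^esub> c\<^sub>i \<sigma>\<^sup>i(w)\<close> and \<open>A\<^bsub>n-1\<^esub>(s) = s\<close>.
\<close>

primrec cyclic_poly :: "(nat \<Rightarrow> 'k) \<Rightarrow> nat \<Rightarrow> 'k poly"
  where "cyclic_poly c 0 = monom (c 0) CHAR('k)"
  | "cyclic_poly c (Suc i) = cyclic_poly c i ^ CHAR('k) + monom (c (Suc i)) CHAR('k)"

text \<open>The factor \<open>X^2\<close> is what later yields a nonzero solution \<open>s\<close>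
  of \<open>A(s) = s\<close>.\<close>

lemma cyclic_poly_dvd: "monom 1 2 dvd cyclic_poly c i"
proof -
  have p: "2 \<le> CHAR('k)" using prime_ge_2_nat[OF prime_CHAR] .
  have m: "monom 1 2 dvd monom a CHAR('k)" for a :: 'k
    using p by (intro dvdI[of _ _ "monom a (CHAR('k) - 2)"]) (simp add: mult_monom del: add_2_eq_Suc)
  show ?thesis
  proof (induction i)
    case (Suc i)
    have "cyclic_poly c i dvd cyclic_poly c i ^ CHAR('k)"
      using p by (intro dvd_power) auto
    with Suc m show ?case by (auto intro: dvd_add dvd_trans)
  qed (simp add: m)
qed

text \<open>Nothing can cancel after the first nonzero coefficient: a nonzero \<open>A\<close> has
  degree at least two by divisibility, so \<open>A^p\<close> dominates the added term of degree at
  most \<open>p\<close>.\<close>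

lemma cyclic_poly_nonzero:
  assumes "c j \<noteq> 0" "j \<le> i"
  shows "cyclic_poly c i \<noteq> 0"
  using assms(2)
proof (induction i)
  case 0
  then show ?case using assms by (simp add: monom_eq_0_iff)
next
  case (Suc i)
  let ?A = "cyclic_poly c i"
  show ?case
  proof (cases "?A = 0")
    case True
    then have "j = Suc i" using Suc by (metis le_SucE)
    then show ?thesis using assms True CHAR_pos by (simp add: monom_eq_0_iff power_0_left)
  next
    case False
    have "degree (monom (1::'k) 2) \<le> degree ?A"
      by (rule dvd_imp_degree_le[OF cyclic_poly_dvd False])
    then have "2 \<le> degree ?A" by (simp add: degree_monom_eq)
    then have "CHAR('k) < degree (?A ^ CHAR('k))"
      using False CHAR_pos by (simp add: degree_power_eq)
    then have "degree (monom (c (Suc i)) CHAR('k)) < degree (?A ^ CHAR('k))"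
      using degree_monom_le le_less_trans by blast
    then have "degree (cyclic_poly c (Suc i)) = degree (?A ^ CHAR('k))"
      by (simp add: degree_add_eq_left)
    with \<open>CHAR('k) < _\<close> show ?thesis by (metis degree_0 not_less_zero)
  qed
qed

text \<open>With \<open>A = X^2 q\<close>, a nonzero \<open>s\<close> satisfies
  \<open>A(s) = s\<close> iff \<open>s q(s) = 1\<close>. The polynomial \<open>X q - 1\<close> is
  nonconstant and does not vanish at 0.\<close>

lemma ex_fixed_point_poly:
  fixes A :: "'k poly"
  assumes "monom 1 2 dvd A" "A \<noteq> 0"
  obtains s where "s \<noteq> 0" "poly A s = s"
proof -
  obtain q where q: "A = monom 1 2 * q" using assms(1) by (rule dvdE)
  with assms(2) have "q \<noteq> 0" by auto
  then have "degree (pCons 0 q) > 0" by simp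
  then have "degree (pCons (-1) q) > 0" by simp
  then obtain s where "poly (pCons (-1) q) s = 0" using alg_closed_imp_poly_has_root by blast
  then have "s * poly q s = 1" by simp
  then have "s \<noteq> 0" "s * (s * poly q s) = s" by auto
  then show ?thesis by (intro that[of s]) (simp_all add: q poly_monom power2_eq_square mult.assoc)
qed

lemma ex_artin_schreier_root: "\<exists>g. g ^ CHAR('k) - g + d = (0 :: 'k)"
proof -
  let ?p = "CHAR('k)"
  have p: "1 < ?p" using prime_gt_1_nat[OF prime_CHAR] .
  have "degree (monom 1 ?p + [:d, -1:] :: 'k poly) = ?p"
    using p by (subst degree_add_eq_left) (auto simp: degree_monom_eq)
  then obtain g where "poly (monom 1 ?p + [:d, -1:]) g = 0"
    using alg_closed_imp_poly_has_root[of "monom 1 ?p + [:d, -1:] :: 'k poly"] p by auto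
  then show ?thesis by (intro exI[of _ g]) (simp add: poly_monom algebra_simps)
qed

lemma \<sigma>_sum: "\<sigma> (\<Sum>i\<in>A. f i) = (\<Sum>i\<in>A. \<sigma> (f i))"
  by (rule \<sigma>.sum)

text \<open>This is Lang's theorem for \<open>GL\<^sub>n\<close>.\<close>

theorem ex_fixed_basis:
  assumes S: "subspace S" and \<sigma>S: "\<sigma> ` S = S"
  obtains E where "E \<subseteq> S" "independent E" "span E = S" "\<And>e. e \<in> E \<Longrightarrow> \<sigma> e = e"
proof -
  \<comment> \<open>A maximal independent set of fixed vectors; a vector of \<open>S\<close> outside
    its span will produce a fixed vector outside its span.\<close>
  obtain E where E: "E \<subseteq> {x \<in> S. \<sigma> x = x}" "independent E" "{x \<in> S. \<sigma> x = x} \<subseteq> span E"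
    using maximal_independent_subset[of "{x \<in> S. \<sigma> x = x}"] by blast
  define U where "U = span E"
  have U: "subspace U" by (simp add: U_def)
  have US: "U \<subseteq> S" unfolding U_def using E(1) S by (intro span_minimal) auto
  have finE: "finite E" using finiteI_independent[OF E(2)] .
  have "\<sigma> ` E = E" using E(1) by force
  then have \<sigma>U: "\<sigma> ` U = U" unfolding U_def span_image_\<sigma>[symmetric] by simp
  note inj = inj_on_if_image_eq[OF S \<sigma>S]
  have "S \<subseteq> U"
  proof (rule ccontr)
    assume "\<not> S \<subseteq> U"
    then obtain w where w: "w \<in> S" "w \<notin> U" by blast
    define W where "W i = (\<sigma> ^^ i) w" for i
    have W_Suc: "\<sigma> (W i) = W (Suc i)" for i by (simp add: W_def)
    have WS: "W i \<in> S" for i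
      by (induction i) (use w(1) \<sigma>S in \<open>auto simp: W_def\<close>)
    have WU: "W i \<notin> U" for i
    proof (induction i)
      case (Suc i)
      show ?case
      proof
        assume "W (Suc i) \<in> U"
        then have "\<sigma> (W i) \<in> \<sigma> ` U" by (simp add: \<sigma>U W_Suc)
        then obtain u where u: "u \<in> U" "\<sigma> u = \<sigma> (W i)" by (metis imageE)
        then have "u = W i" using inj US WS by (auto dest: inj_onD)
        with u Suc show False by simp
      qed
    qed (use w in \<open>simp add: W_def\<close>)
    \<comment> \<open>Dependence of \<open>W n\<close> on the earlier iterates modulo
      \<open>U\<close>. Finite dimension forces some relation; for the least \<open>n\<close> the
      iterates before \<open>W n\<close> are independent modulo \<open>U\<close>, which is
      \<open>comb\<close>.\<close>
    define R where "R n c \<longleftrightarrow> W n - (\<Sum>i<n. scale (c i) (W i)) \<in> U" for n c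
    have "\<exists>n c. R n c"
    proof (rule ccontr)
      assume no: "\<not> (\<exists>n c. R n c)"
      have new: "W n \<notin> span (W ` {..<n})" for n
      proof
        assume "W n \<in> span (W ` {..<n})"
        then obtain c where "W n = (\<Sum>i<n. scale (c i) (W i))"
          using span_image_finite[of "{..<n}"] by blast
        then have "R n c" using subspace_0[OF U] by (simp add: R_def)
        with no show False by blast
      qed
      have "independent (W ` {..<n}) \<and> card (W ` {..<n}) = n" for n
      proof (induction n)
        case (Suc n)
        have "W n \<notin> W ` {..<n}" using new[of n] span_base[of "W n" "W ` {..<n}"] by blast
        with Suc new[of n] show ?case by (simp add: lessThan_Suc independent_insertI)
      qed (simp add: independent_empty)
      from this[of "Suc dimension"] show False
        using independent_card_le_dim[of "W ` {..<Suc dimension}" UNIV] by (simp add: dim_UNIV dimension_def)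
    qed
    then obtain n where ex: "\<exists>c. R n c" and least: "\<And>m. m < n \<Longrightarrow> \<not> (\<exists>c. R m c)"
      using exists_least_iff[of "\<lambda>n. \<exists>c. R n c"] by blast
    from ex obtain c where "R n c" by blast
    then have c: "W n - (\<Sum>i<n. scale (c i) (W i)) \<in> U" by (simp add: R_def)
    have comb: "(\<Sum>i<n. scale (a i) (W i)) \<notin> U" if "\<exists>i<n. a i \<noteq> 0" for a
    proof
      assume mem: "(\<Sum>i<n. scale (a i) (W i)) \<in> U"
      define m where "m = Max {i. i < n \<and> a i \<noteq> 0}"
      have fin: "finite {i. i < n \<and> a i \<noteq> 0}" by simp
      have "m \<in> {i. i < n \<and> a i \<noteq> 0}" unfolding m_def using that by (intro Max_in fin) auto
      then have m: "m < n" "a m \<noteq> 0" by auto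
      have "a i = 0" if "m < i" "i < n" for i
      proof (rule ccontr)
        assume "a i \<noteq> 0"
        with that have "i \<le> m" unfolding m_def by (intro Max_ge fin) simp
        with that show False by simp
      qed
      then have "(\<Sum>i<n. scale (a i) (W i)) = (\<Sum>i<Suc m. scale (a i) (W i))"
        using m by (intro sum.mono_neutral_right) auto
      then have "scale (inverse (a m)) (\<Sum>i<Suc m. scale (a i) (W i)) \<in> U"
        using mem subspace_scale[OF U] by simp
      then have "R m (\<lambda>i. - (inverse (a m) * a i))"
        using m(2) by (simp add: R_def scale_right_distrib scale_sum_right sum_negf add.commute)
      with least[OF m(1)] show False by blast
    qed
    have "n \<noteq> 0"
    proof
      assume "n = 0"
      with c WU[of 0] show False by simp
    qed
    then obtain k where n: "n = Suc k" using not0_implies_Suc by blast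
    have "\<exists>j<n. c j \<noteq> 0"
    proof (rule ccontr)
      assume "\<not> (\<exists>j<n. c j \<noteq> 0)"
      then have "(\<Sum>i<n. scale (c i) (W i)) = 0" by (intro sum.neutral) auto
      with c WU[of n] show False by simp
    qed
    then obtain j where j: "j \<le> k" "c j \<noteq> 0" by (auto simp: n less_Suc_eq_le)
    \<comment> \<open>Comparing coefficients in \<sigma>(v) = v modulo \<open>U\<close> determines
      all of them from the top one, \<open>s\<close>; the equation for \<open>s\<close> closes the
      recursion. As \<open>s\<close> is nonzero, \<open>v\<close> stays outside
      \<open>U\<close>.\<close>
    obtain s where s: "s \<noteq> 0" "poly (cyclic_poly c k) s = s"
      using ex_fixed_point_poly[OF cyclic_poly_dvd cyclic_poly_nonzero[of c j k]] j by blast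
    define a where "a i = poly (cyclic_poly c i) s" for i
    define v where "v = (\<Sum>i<n. scale (a i) (W i))"
    have vU: "v \<notin> U" unfolding v_def
      by (rule comb) (use s in \<open>auto simp: n a_def intro!: exI[of _ k]\<close>)
    have vS: "v \<in> S" unfolding v_def by (intro subspace_sum[OF S] subspace_scale[OF S] WS)
    let ?p = "CHAR('k)"
    have a0: "a 0 = c 0 * s ^ ?p" and aS: "a (Suc i) = a i ^ ?p + c (Suc i) * s ^ ?p" for i
      by (simp_all add: a_def poly_monom)
    have "\<sigma> v - v = scale (s ^ ?p) (W n - (\<Sum>i<n. scale (c i) (W i)))"
    proof -
      have "\<sigma> v = (\<Sum>i<n. scale (a i ^ ?p) (W (Suc i)))"
        by (simp add: v_def \<sigma>_sum \<sigma>_scale W_Suc)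
      also have "\<dots> = (\<Sum>i<k. scale (a i ^ ?p) (W (Suc i))) + scale (s ^ ?p) (W n)"
        using s(2) by (simp add: n a_def)
      also have "(\<Sum>i<k. scale (a i ^ ?p) (W (Suc i))) =
          (\<Sum>i<k. scale (a (Suc i)) (W (Suc i))) - (\<Sum>i<k. scale (c (Suc i) * s ^ ?p) (W (Suc i)))"
        by (simp add: aS scale_left_distrib sum.distrib)
      also have "\<dots> = v - (\<Sum>i<n. scale (c i * s ^ ?p) (W i))"
        unfolding v_def n sum.lessThan_Suc_shift by (simp add: a0)
      finally show ?thesis
        by (simp add: scale_right_diff_distrib scale_sum_right mult.commute)
    qed
    then have "\<sigma> v - v \<in> U" using c subspace_scale[OF U] by simp
    then obtain d where d: "\<sigma> v - v = (\<Sum>e\<in>E. scale (d e) e)"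
      unfolding U_def span_finite[OF finE] by auto
    \<comment> \<open>\<open>v\<close> is fixed only modulo \<open>U\<close>. Adding a combination
      of the fixed vectors \<open>e\<close> with coefficients \<open>g e\<close> changes the defect
      by \<open>g e ^ p - g e\<close>, so an Artin-Schreier equation for each \<open>e\<close>
      removes it.\<close>
    have "\<forall>e. \<exists>g. g ^ ?p - g + d e = 0" using ex_artin_schreier_root by blast
    from choice[OF this] obtain g where g: "\<And>e. g e ^ ?p - g e + d e = 0" by blast
    have dg: "d e + g e ^ ?p = g e" for e using g[of e] by (simp add: algebra_simps)
    define v' where "v' = v + (\<Sum>e\<in>E. scale (g e) e)"
    have "\<sigma> v' = v + (\<Sum>e\<in>E. scale (d e) e) + (\<Sum>e\<in>E. scale (g e ^ ?p) e)"
    proof -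
      have "(\<Sum>e\<in>E. \<sigma> (scale (g e) e)) = (\<Sum>e\<in>E. scale (g e ^ ?p) e)"
        using E(1) by (intro sum.cong) (auto simp: \<sigma>_scale)
      then show ?thesis using d by (simp add: v'_def \<sigma>_add \<sigma>_sum algebra_simps)
    qed
    also have "\<dots> = v + (\<Sum>e\<in>E. scale (d e + g e ^ ?p) e)"
      by (simp add: scale_left_distrib sum.distrib add.assoc)
    also have "\<dots> = v'" by (simp add: dg v'_def)
    finally have "\<sigma> v' = v'" .
    moreover have gU: "(\<Sum>e\<in>E. scale (g e) e) \<in> U"
      unfolding U_def by (intro span_sum span_scale span_base)
    then have "v' \<in> S" unfolding v'_def using vS US by (intro subspace_add[OF S]) auto
    ultimately have "v' \<in> U" using E(3) by (auto simp: U_def)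
    from subspace_diff[OF U this gU] vU show False by (simp add: v'_def)
  qed
  with US have "span E = S" by (simp add: U_def)
  then show ?thesis using E by (intro that[of E]) auto
qed

end

section \<open>Classification of semilinear maps by the dimensions of the images of their powers\<close>

locale fd_frobenius_space_pair =
  L: fd_frobenius_space sL \<sigma>L BL + H: fd_frobenius_space sH \<sigma>H BH
  for sL :: "'k::alg_closed_field \<Rightarrow> 'l::ab_group_add \<Rightarrow> 'l" and \<sigma>L BL
    and sH :: "'k \<Rightarrow> 'h::ab_group_add \<Rightarrow> 'h" and \<sigma>H BH
begin

sublocale finite_dimensional_vector_space_pair sL BL sH BH
  by unfold_locales

text \<open>Isomorphisms between subspaces are represented by globally linear maps whose behaviour
  off \<open>S\<close> is unconstrained; no subspace types occur.\<close>

definition iso_on :: "'l set \<Rightarrow> 'h set \<Rightarrow> ('l \<Rightarrow> 'h) \<Rightarrow> bool"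
  where "iso_on S T \<psi> \<longleftrightarrow> Vector_Spaces.linear sL sH \<psi> \<and> inj_on \<psi> S \<and> \<psi> ` S = T \<and>
    (\<forall>x\<in>S. \<psi> (\<sigma>L x) = \<sigma>H (\<psi> x))"

lemma commute_on_span:
  assumes "Vector_Spaces.linear sL sH \<psi>" "\<And>x. x \<in> E \<Longrightarrow> \<psi> (\<sigma>L x) = \<sigma>H (\<psi> x)" "x \<in> L.span E"
  shows "\<psi> (\<sigma>L x) = \<sigma>H (\<psi> x)"
proof -
  interpret \<psi>: Vector_Spaces.linear sL sH \<psi> by fact
  have "L.subspace {x. \<psi> (\<sigma>L x) = \<sigma>H (\<psi> x)}"
    by (rule L.subspaceI)
      (simp_all add: L.\<sigma>_0 H.\<sigma>_0 \<psi>.zero L.\<sigma>_add H.\<sigma>_add \<psi>.add L.\<sigma>_scale H.\<sigma>_scale \<psi>.scale)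
  moreover have "E \<subseteq> {x. \<psi> (\<sigma>L x) = \<sigma>H (\<psi> x)}" using assms(2) by blast
  ultimately have "L.span E \<subseteq> {x. \<psi> (\<sigma>L x) = \<sigma>H (\<psi> x)}" by (rule L.span_minimal[rotated])
  then show ?thesis using assms(3) by blast
qed

text \<open>Lang's theorem gives bases of fixed vectors on both sides; a linear bijection matching
  them commutes with the semilinear maps on the basis, hence on its span.\<close>

lemma ex_iso_on_bijective:
  assumes S: "L.subspace S" "\<sigma>L ` S = S" and T: "H.subspace T" "\<sigma>H ` T = T"
    and dim: "L.dim S = H.dim T"
  shows "\<exists>\<psi>. iso_on S T \<psi>"
proof -
  obtain E where E: "E \<subseteq> S" "L.independent E" "L.span E = S" "\<And>e. e \<in> E \<Longrightarrow> \<sigma>L e = e"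
    using L.ex_fixed_basis[OF S] by blast
  obtain F where F: "F \<subseteq> T" "H.independent F" "H.span F = T" "\<And>e. e \<in> F \<Longrightarrow> \<sigma>H e = e"
    using H.ex_fixed_basis[OF T] by blast
  have cards: "card E = L.dim S" "card F = H.dim T"
    using L.dim_span_eq_card_independent[OF E(2)] H.dim_span_eq_card_independent[OF F(2)]
    by (simp_all only: E F)
  obtain \<psi> where \<psi>: "Vector_Spaces.linear sL sH \<psi>" "\<psi> ` E = F" "\<psi> ` S = T" "inj_on \<psi> S"
    using finite_basis_to_basis_subspace_isomorphism[OF S(1) T(1) dim
        L.finiteI_independent[OF E(2)] E(1,2) _ cards(1) H.finiteI_independent[OF F(2)] F(1,2) _ cards(2)]
      E(3) F(3) by blast
  have "\<psi> (\<sigma>L x) = \<sigma>H (\<psi> x)" if "x \<in> S" for x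
    by (rule commute_on_span[OF \<psi>(1), of E]) (use E F \<psi> that in auto)
  with \<psi> show ?thesis unfolding iso_on_def by blast
qed

text \<open>The extension must agree with \<open>\<psi>\<close> on the image \<open>S1\<close>, map
  the kernel \<open>K\<close> onto the other kernel, and send \<open>b\<close> to a preimage of
  \<open>\<psi> (\<sigma>L b)\<close>. A basis adapted to the chain K \<inter> S1, S1, S1 + K, S
  makes these demands compatible; rank-nullity gives kernels of equal dimension.\<close>

lemma ex_iso_on_step:
  assumes S: "L.subspace S" "\<sigma>L ` S \<subseteq> S" and T: "H.subspace T" "\<sigma>H ` T \<subseteq> T"
    and dim: "L.dim S = H.dim T" and iso: "iso_on (\<sigma>L ` S) (\<sigma>H ` T) \<psi>"
  shows "\<exists>\<psi>. iso_on S T \<psi>"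
proof -
  let ?S1 = "\<sigma>L ` S" and ?T1 = "\<sigma>H ` T"
  from iso have lin: "Vector_Spaces.linear sL sH \<psi>" and inj: "inj_on \<psi> ?S1"
    and img: "\<psi> ` ?S1 = ?T1" and comm: "\<And>x. x \<in> ?S1 \<Longrightarrow> \<psi> (\<sigma>L x) = \<sigma>H (\<psi> x)"
    by (auto simp: iso_on_def)
  interpret \<psi>: Vector_Spaces.linear sL sH \<psi> by fact
  have S1: "L.subspace ?S1" by (rule L.subspace_image_\<sigma>) (rule S)
  have T1: "H.subspace ?T1" by (rule H.subspace_image_\<sigma>) (rule T)
  let ?K = "L.kern S" and ?N = "H.kern T"
  have K: "L.subspace ?K" by (rule L.subspace_kern) (rule S)
  have N: "H.subspace ?N" by (rule H.subspace_kern) (rule T)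
  have spanS1: "L.span ?S1 = ?S1" using S1 by (rule L.span_eq_iff[THEN iffD2])
  have "H.dim ?T1 = L.dim ?S1"
    unfolding img[symmetric] by (rule dim_image_eq[OF lin]) (simp add: spanS1 inj)
  then have dimK: "L.dim ?K = H.dim ?N"
    using L.rank_nullity[OF S(1)] H.rank_nullity[OF T(1)] dim by simp
  have inj0: "x = 0" if "x \<in> ?S1" "\<psi> x = 0" for x
    using inj that L.subspace_0[OF S1] \<psi>.zero by (metis inj_onD)
  obtain A where A: "A \<subseteq> ?K \<inter> ?S1" "L.independent A" "?K \<inter> ?S1 \<subseteq> L.span A"
    using L.maximal_independent_subset[of "?K \<inter> ?S1"] by blast
  have AS1: "A \<subseteq> ?S1" using A(1) by blast
  obtain C where C: "A \<subseteq> C" "C \<subseteq> ?S1" "L.independent C" "?S1 \<subseteq> L.span C"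
    using L.maximal_independent_subset_extend[OF AS1 A(2)] by blast
  have spanC: "L.span C = ?S1" using C S1 by (intro antisym L.span_minimal)
  have CK: "C \<subseteq> ?S1 \<union> ?K" using C(2) by blast
  obtain M where M: "C \<subseteq> M" "M \<subseteq> ?S1 \<union> ?K" "L.independent M" "?S1 \<union> ?K \<subseteq> L.span M"
    using L.maximal_independent_subset_extend[OF CK C(3)] by blast
  have MS: "M \<subseteq> S" using M(2) S(2) by (auto simp: L.kern_def)
  obtain B where B: "M \<subseteq> B" "B \<subseteq> S" "L.independent B" "S \<subseteq> L.span B"
    using L.maximal_independent_subset_extend[OF MS M(3)] by blast
  have indep\<psi>C: "H.independent (\<psi> ` C)"
    by (rule \<psi>.independent_injective_image[OF C(3)]) (simp add: spanC inj)
  have \<psi>CN: "\<psi> ` C \<subseteq> ?T1 \<union> ?N" using C(2) img by blast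
  obtain M' where M': "\<psi> ` C \<subseteq> M'" "M' \<subseteq> ?T1 \<union> ?N" "H.independent M'" "?T1 \<union> ?N \<subseteq> H.span M'"
    using H.maximal_independent_subset_extend[OF \<psi>CN indep\<psi>C] by blast
  have span\<psi>C: "H.span (\<psi> ` C) = ?T1" by (simp add: \<psi>.span_image spanC img)
  define D where "D = M - C"
  define D' where "D' = M' - \<psi> ` C"
  have DK: "D \<subseteq> ?K"
  proof
    fix d assume d: "d \<in> D"
    have "d \<notin> L.span C"
    proof
      assume "d \<in> L.span C"
      then have "d \<in> L.span (M - {d})" using d M(1) L.span_mono[of C "M - {d}"] by (auto simp: D_def)
      with d M(3) show False by (auto simp: L.dependent_def D_def)
    qed
    with d M(2) show "d \<in> ?K" by (auto simp: D_def spanC)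
  qed
  have DN: "D' \<subseteq> ?N"
  proof
    fix d assume d: "d \<in> D'"
    have "d \<notin> H.span (\<psi> ` C)"
    proof
      assume "d \<in> H.span (\<psi> ` C)"
      then have "d \<in> H.span (M' - {d})" using d M'(1) H.span_mono[of "\<psi> ` C" "M' - {d}"] by (auto simp: D'_def)
      with d M'(3) show False by (auto simp: H.dependent_def D'_def)
    qed
    with d M'(2) show "d \<in> ?N" by (auto simp: D'_def span\<psi>C)
  qed
  have AD_disj: "A \<inter> D = {}" "\<psi> ` A \<inter> D' = {}" using C(1) by (auto simp: D_def D'_def)
  have AD_indep: "L.independent (A \<union> D)" "H.independent (\<psi> ` A \<union> D')"
  proof -
    have "A \<union> D \<subseteq> M" "\<psi> ` A \<union> D' \<subseteq> M'" using C(1) M(1) M'(1) by (auto simp: D_def D'_def)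
    then show "L.independent (A \<union> D)" "H.independent (\<psi> ` A \<union> D')"
      using L.independent_mono[OF M(3)] H.independent_mono[OF M'(3)] by blast+
  qed
  \<comment> \<open>Split a kernel vector along \<open>C\<close> and \<open>D\<close>. The
    \<open>D\<close>-part lies in the kernel, hence so does the \<open>C\<close>-part, which is then
    in the span of \<open>A\<close>.\<close>
  have AD_span: "?K \<subseteq> L.span (A \<union> D)"
  proof
    fix x assume x: "x \<in> ?K"
    have "M = C \<union> D" using M(1) by (auto simp: D_def)
    then obtain c d where cd: "x = c + d" "c \<in> L.span C" "d \<in> L.span D"
      using x M(4) L.span_Un[of C D] by auto
    have "d \<in> ?K" using cd(3) L.span_minimal[OF DK K] by blast
    then have "c \<in> ?K" using L.subspace_diff[OF K x, of d] cd(1) by simp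
    then have "c \<in> L.span A" using cd(2) A(3) by (auto simp: spanC)
    then show "x \<in> L.span (A \<union> D)" unfolding cd(1)
      using cd(3) L.span_mono[of A "A \<union> D"] L.span_mono[of D "A \<union> D"] by (intro L.span_add) auto
  qed
  have \<psi>A: "\<psi> ` A \<subseteq> ?N"
  proof
    fix y assume "y \<in> \<psi> ` A"
    then obtain a where a: "a \<in> A" "y = \<psi> a" by blast
    then have "a \<in> ?S1" "\<sigma>L a = 0" using A(1) by (auto simp: L.kern_def)
    then have "\<sigma>H y = 0" "y \<in> ?T1" using comm[of a] img a \<psi>.zero by auto
    then show "y \<in> ?N" using T(2) by (auto simp: H.kern_def)
  qed
  have AD'_span: "?N \<subseteq> H.span (\<psi> ` A \<union> D')"
  proof
    fix x assume x: "x \<in> ?N"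
    have "M' = \<psi> ` C \<union> D'" using M'(1) by (auto simp: D'_def)
    then obtain c d where cd: "x = c + d" "c \<in> H.span (\<psi> ` C)" "d \<in> H.span D'"
      using x M'(4) H.span_Un[of "\<psi> ` C" D'] by auto
    have "d \<in> ?N" using cd(3) H.span_minimal[OF DN N] by blast
    then have cN: "c \<in> ?N" using H.subspace_diff[OF N x, of d] cd(1) by simp
    have "c \<in> \<psi> ` ?S1" using cd(2) by (simp add: span\<psi>C img)
    then obtain a where a: "a \<in> ?S1" "c = \<psi> a" by (rule imageE)
    have "\<psi> (\<sigma>L a) = 0" using comm[OF a(1)] cN a(2) by (simp add: H.kern_def)
    then have "\<sigma>L a = 0" using inj0 a(1) S(2) by blast
    then have "a \<in> ?K \<inter> ?S1" using a(1) S(2) by (auto simp: L.kern_def)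
    then have "c \<in> H.span (\<psi> ` A)" using A(3) by (auto simp: a(2) \<psi>.span_image)
    then show "x \<in> H.span (\<psi> ` A \<union> D')" unfolding cd(1)
      using cd(3) H.span_mono[of "\<psi> ` A" "\<psi> ` A \<union> D'"] H.span_mono[of D' "\<psi> ` A \<union> D'"]
      by (intro H.span_add) auto
  qed
  have cA: "card (\<psi> ` A) = card A"
    by (rule card_image) (rule inj_on_subset[OF inj AS1])
  have fin: "finite A" "finite D" "finite D'"
    using L.finiteI_independent AD_indep(1) H.finiteI_independent[OF AD_indep(2)] by (auto dest: L.finiteI_independent)
  have "card (A \<union> D) = L.dim ?K"
    using A(1) DK by (intro L.basis_card_eq_dim AD_span AD_indep) auto
  moreover have "card (\<psi> ` A \<union> D') = H.dim ?N"
    using \<psi>A DN by (intro H.basis_card_eq_dim AD'_span AD_indep) auto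
  ultimately have "card D = card D'"
    using AD_disj fin cA dimK by (simp add: card_Un_disjoint)
  then obtain h where h: "bij_betw h D D'"
    using finite_same_card_bij fin by blast
  define \<tau> where "\<tau> b = (if b \<in> C then \<psi> b else if b \<in> D then h b
    else SOME y. y \<in> T \<and> \<sigma>H y = \<psi> (\<sigma>L b))" for b
  have \<tau>: "\<tau> b \<in> T \<and> \<sigma>H (\<tau> b) = \<psi> (\<sigma>L b)" if "b \<in> B" for b
  proof -
    consider "b \<in> C" | "b \<notin> C" "b \<in> D" | "b \<notin> C" "b \<notin> D" by blast
    then show ?thesis
    proof cases
      case 1
      then have "b \<in> ?S1" using C(2) by blast
      moreover from this have "\<psi> b \<in> T" using img T(2) by blast
      ultimately show ?thesis using comm[of b] 1 by (simp add: \<tau>_def)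
    next
      case 2
      then have "h b \<in> ?N" using h DN by (auto simp: bij_betw_def)
      moreover have "\<sigma>L b = 0" using 2 DK by (auto simp: L.kern_def)
      ultimately show ?thesis using 2 by (simp add: \<tau>_def H.kern_def \<psi>.zero)
    next
      case 3
      have "\<psi> (\<sigma>L b) \<in> ?T1" using img that B(2) by blast
      then have "\<exists>y. y \<in> T \<and> \<sigma>H y = \<psi> (\<sigma>L b)" by force
      from someI_ex[OF this] show ?thesis using 3 by (simp add: \<tau>_def)
    qed
  qed
  obtain \<phi> where \<phi>: "Vector_Spaces.linear sL sH \<phi>" "\<And>b. b \<in> B \<Longrightarrow> \<phi> b = \<tau> b"
    using linear_independent_extend[OF B(3), of \<tau>] by blast
  interpret \<phi>: Vector_Spaces.linear sL sH \<phi> by (rule \<phi>)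
  have spanB: "L.span B = S" using B(2,4) S(1) by (intro antisym L.span_minimal)
  have \<phi>_S1: "\<phi> x = \<psi> x" if "x \<in> ?S1" for x
  proof (rule linear_eq_on[OF \<phi>(1) lin])
    show "x \<in> L.span C" using that by (simp add: spanC)
    show "\<phi> b = \<psi> b" if "b \<in> C" for b using that M(1) B(1) by (subst \<phi>(2)) (auto simp: \<tau>_def)
  qed
  have \<phi>_comm: "\<phi> (\<sigma>L x) = \<sigma>H (\<phi> x)" if "x \<in> S" for x
  proof (rule commute_on_span[OF \<phi>(1)])
    show "x \<in> L.span B" using that by (simp add: spanB)
    show "\<phi> (\<sigma>L b) = \<sigma>H (\<phi> b)" if "b \<in> B" for b
      using that \<tau>[OF that] B(2) \<phi>_S1[of "\<sigma>L b"] by (auto simp: \<phi>(2))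
  qed
  have "\<phi> ` S = H.span (\<phi> ` B)" by (simp add: \<phi>.span_image spanB)
  also have "\<dots> \<subseteq> T" using \<tau> T(1) by (intro H.span_minimal) (auto simp: \<phi>(2))
  finally have \<phi>ST: "\<phi> ` S \<subseteq> T" .
  have \<phi>_AD: "\<phi> b = (if b \<in> A then \<psi> b else h b)" if "b \<in> A \<union> D" for b
    using that C(1) M(1) B(1) by (subst \<phi>(2)) (auto simp: \<tau>_def D_def)
  have "\<phi> ` A = \<psi> ` A" "\<phi> ` D = h ` D"
    using AD_disj by (auto simp: \<phi>_AD intro!: image_cong)
  then have img_AD: "\<phi> ` (A \<union> D) = \<psi> ` A \<union> D'"
    using h by (simp add: image_Un bij_betw_def)
  have "card (\<phi> ` (A \<union> D)) = card (A \<union> D)"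
    using AD_disj fin cA \<open>card D = card D'\<close> by (simp add: img_AD card_Un_disjoint)
  then have inj_AD: "inj_on \<phi> (A \<union> D)" using fin by (intro eq_card_imp_inj_on) auto
  \<comment> \<open>A vector killed by \<open>\<phi>\<close> satisfies
    \<open>\<psi> (\<sigma>L x) = 0\<close>, so it lies in the kernel of \<open>\<sigma>L\<close>,
    where \<open>\<phi>\<close> maps the basis \<open>A \<union> D\<close> injectively to an
    independent set.\<close>
  have "x = 0" if x: "x \<in> S" "\<phi> x = 0" for x
  proof -
    have "\<psi> (\<sigma>L x) = 0"
      using \<phi>_comm[OF x(1)] \<phi>_S1[of "\<sigma>L x"] x by (simp add: H.\<sigma>_0)
    then have "\<sigma>L x = 0" using inj0 x(1) by blast
    then have "x \<in> L.span (A \<union> D)" using AD_span x(1) by (auto simp: L.kern_def)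
    then show "x = 0"
      using linear_indep_image_lemma[OF \<phi>(1) _ _ inj_AD _ x(2)] fin AD_indep(2) img_AD by simp
  qed
  then have \<phi>_inj: "inj_on \<phi> S" by (auto simp: \<phi>.inj_on_iff_eq_0[OF S(1)])
  have "H.dim (\<phi> ` S) = L.dim S"
    using S(1) by (intro dim_image_eq[OF \<phi>(1)]) (simp add: L.span_eq_iff[THEN iffD2] \<phi>_inj)
  then have "\<phi> ` S = T"
    using dim \<phi>ST by (intro H.subspace_dim_equal \<phi>.subspace_image S(1) T(1)) auto
  then show ?thesis using \<phi>(1) \<phi>_inj \<phi>_comm unfolding iso_on_def by blast
qed

theorem ex_iso:
  assumes dim: "\<And>k. L.dim ((\<sigma>L ^^ k) ` UNIV) = H.dim ((\<sigma>H ^^ k) ` UNIV)"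
  shows "\<exists>\<psi>. Vector_Spaces.linear sL sH \<psi> \<and> bij \<psi> \<and> (\<forall>x. \<psi> (\<sigma>L x) = \<sigma>H (\<psi> x))"
proof -
  define S where "S k = (\<sigma>L ^^ k) ` UNIV" for k
  define T where "T k = (\<sigma>H ^^ k) ` UNIV" for k
  have step: "S (Suc k) = \<sigma>L ` S k" "T (Suc k) = \<sigma>H ` T k" for k
    by (simp_all add: S_def T_def image_comp)
  have S: "L.subspace (S k)" for k
    by (induction k) (auto simp: step L.subspace_image_\<sigma>, simp add: S_def)
  have T: "H.subspace (T k)" for k
    by (induction k) (auto simp: step H.subspace_image_\<sigma>, simp add: T_def)
  have mono: "S (Suc k) \<subseteq> S k" "T (Suc k) \<subseteq> T k" for k
    by (auto simp: S_def T_def funpow_swap1 intro: range_eqI simp del: funpow.simps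
        simp add: funpow_Suc_right)
  \<comment> \<open>The images decrease, so they are stable from an index of least dimension; equal
    dimensions make the same index work for \<open>T\<close>.\<close>
  define N where "N = (ARG_MIN (\<lambda>k. L.dim (S k)) k. True)"
  have "L.dim (S N) \<le> L.dim (S (Suc N))"
    unfolding N_def by (rule arg_min_nat_le) simp
  then have SN: "\<sigma>L ` S N = S N"
    using mono(1)[of N] unfolding step[symmetric] by (intro L.subspace_dim_equal S) auto
  have dimST: "L.dim (S k) = H.dim (T k)" for k by (simp add: S_def T_def dim)
  have TN: "\<sigma>H ` T N = T N"
    using mono(2)[of N] \<open>L.dim (S N) \<le> _\<close> unfolding step[symmetric] dimST
    by (intro H.subspace_dim_equal T) auto
  \<comment> \<open>Induction on \<open>j\<close> climbs back from the stable image to power 0, the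
    whole spaces.\<close>
  have "\<exists>\<psi>. iso_on (S (N - j)) (T (N - j)) \<psi>" if "j \<le> N" for j
    using that
  proof (induction j)
    case 0
    show ?case using ex_iso_on_bijective[OF S SN T TN dimST] by simp
  next
    case (Suc j)
    define k where "k = N - Suc j"
    have k: "N - j = Suc k" using Suc.prems by (simp add: k_def)
    from Suc obtain \<psi> where "iso_on (S (Suc k)) (T (Suc k)) \<psi>" by (auto simp: k)
    then show ?case
      using ex_iso_on_step[OF S _ T _ dimST, of k \<psi>] mono[of k] by (simp add: step k_def)
  qed
  from this[of N] obtain \<psi> where "iso_on (S 0) (T 0) \<psi>" by auto
  then show ?thesis by (auto simp: iso_on_def S_def T_def bij_def)
qed

end

section \<open>Powers in the enveloping algebra of an abelian restricted Lie algebra\<close>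

text \<open>A dimension bound in the quotient by \<open>J\<close>, without forming it: changing each
  \<open>f i\<close> by an element of \<open>J\<close> moves it into the span of \<open>TM\<close>,
  and independence modulo \<open>J\<close> makes the new family injective and independent.\<close>

lemma (in vector_space) card_le_if_independent_modulo:
  fixes f :: "'i \<Rightarrow> 'b"
  assumes J: "subspace J" and TM: "finite TM" and A: "finite A"
    and f: "\<And>i. i \<in> A \<Longrightarrow> f i \<in> span (TM \<union> J)"
    and indep: "\<And>c. (\<Sum>i\<in>A. scale (c i) (f i)) \<in> J \<Longrightarrow> \<forall>i\<in>A. c i = 0"
  shows "card A \<le> card TM"
proof -
  have "\<exists>g. g \<in> span TM \<and> f i - g \<in> J" if i: "i \<in> A" for i
  proof -
    obtain g h where "f i = g + h" "g \<in> span TM" "h \<in> span J"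
      using f[OF i] by (auto simp: span_Un)
    moreover have "span J = J" using J by (rule span_eq_iff[THEN iffD2])
    ultimately show ?thesis by (intro exI[of _ g]) simp
  qed
  then obtain g where g: "\<And>i. i \<in> A \<Longrightarrow> g i \<in> span TM" "\<And>i. i \<in> A \<Longrightarrow> f i - g i \<in> J"
    by metis
  have zero: "\<forall>i\<in>A. c i = 0" if "(\<Sum>i\<in>A. scale (c i) (g i)) = 0" for c
  proof (rule indep)
    have "(\<Sum>i\<in>A. scale (c i) (f i - g i)) \<in> J"
      by (intro subspace_sum J subspace_scale g)
    with that show "(\<Sum>i\<in>A. scale (c i) (f i)) \<in> J"
      by (simp add: scale_right_diff_distrib sum_subtractf)
  qed
  have inj: "inj_on g A"
  proof (rule inj_onI, rule ccontr)
    fix i j assume ij: "i \<in> A" "j \<in> A" "g i = g j" "i \<noteq> j"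
    define c :: "'i \<Rightarrow> 'a" where "c l = (if l = i then 1 else 0) - (if l = j then 1 else 0)" for l
    have "(\<Sum>l\<in>A. scale (c l) (g l)) =
        (\<Sum>l\<in>A. if l = i then g l else 0) - (\<Sum>l\<in>A. if l = j then g l else 0)"
      by (simp add: c_def scale_left_diff_distrib sum_subtractf if_distrib[of "\<lambda>a. scale a _"] cong: if_cong)
    also have "\<dots> = 0" using ij A by simp
    finally have "\<forall>l\<in>A. c l = 0" by (rule zero)
    then have "c i = 0" using ij(1) by blast
    with ij(4) show False by (simp add: c_def)
  qed
  have "independent (g ` A)"
  proof (rule independent_if_scalars_zero)
    fix c x assume c: "(\<Sum>x\<in>g ` A. scale (c x) x) = 0" and x: "x \<in> g ` A"
    have "(\<Sum>i\<in>A. scale ((c \<circ> g) i) (g i)) = 0"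
      using c by (simp add: sum.reindex[OF inj])
    from zero[OF this] x show "c x = 0" by auto
  qed (use A in simp)
  then have "card (g ` A) \<le> card TM"
    using independent_span_bound[OF TM] g(1) by blast
  then show ?thesis by (simp add: card_image[OF inj])
qed

context frobenius_space_basis
begin

text \<open>This is why powers are taken: modulo \<open>J\<close>, the \<open>p^k\<close>-th power
  of a linear form sees only the image of the \<open>k\<close>-th iterate of \<sigma>.\<close>

lemma \<iota>_pow_mem_J: "\<iota> x ^ (CHAR('k) ^ k) - \<iota> ((\<sigma> ^^ k) x) \<in> J"
proof (induction k)
  case 0
  then show ?case by (simp add: J_0)
next
  case (Suc k)
  let ?p = "CHAR('k)"
  let ?a = "\<iota> x ^ (?p ^ k)" and ?b = "\<iota> ((\<sigma> ^^ k) x)"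
  have "(?a - ?b) ^ ?p + ?b ^ ?p = ?a ^ ?p"
    using freshmans_dream[OF prime_CHAR_mpoly, of ?p "?a - ?b" ?b] by simp
  moreover have "(?a - ?b) ^ ?p = (?a - ?b) ^ (?p - 1) * (?a - ?b)"
    using CHAR_pos by (metis power_minus_mult)
  then have "(?a - ?b) ^ ?p \<in> J" using J_mult[OF Suc] by simp
  moreover have "?b ^ ?p - \<iota> (\<sigma> ((\<sigma> ^^ k) x)) \<in> J"
    using prel_mem_J[of "(\<sigma> ^^ k) x"] by (simp add: prel_def)
  ultimately have "?a ^ ?p - \<iota> (\<sigma> ((\<sigma> ^^ k) x)) \<in> J"
    using J_add[of "(?a - ?b) ^ ?p" "?b ^ ?p - \<iota> (\<sigma> ((\<sigma> ^^ k) x))"] by (simp add: algebra_simps)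
  then show ?case by (simp add: mult.commute flip: power_mult)
qed

lemma J_mult_cong: "a - b \<in> J \<Longrightarrow> c - d \<in> J \<Longrightarrow> a * c - b * d \<in> J"
  using J_add[OF J_mult_right[of "a - b" c] J_mult[of "c - d" b]] by (simp add: algebra_simps)

lemma J_power_cong: "a - b \<in> J \<Longrightarrow> a ^ n - b ^ n \<in> J"
  by (induction n) (simp_all add: J_0 J_mult_cong)

lemma J_prod_cong: "finite E \<Longrightarrow> (\<And>e. e \<in> E \<Longrightarrow> f e - g e \<in> J) \<Longrightarrow> prod f E - prod g E \<in> J"
  by (induction E rule: finite_induct) (simp_all add: J_0 J_mult_cong)

definition truncated_mons :: "'l set \<Rightarrow> ('l, 'k) mpoly set"
  where "truncated_mons E = {mon \<alpha> | \<alpha>. Poly_Mapping.keys \<alpha> \<subseteq> E \<and> truncated \<alpha>}"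

lemma truncated_mons:
  assumes "finite E"
  shows "finite (truncated_mons E)" "card (truncated_mons E) \<le> CHAR('k) ^ card E"
proof -
  let ?A = "{\<alpha> :: 'l \<Rightarrow>\<^sub>0 nat. Poly_Mapping.keys \<alpha> \<subseteq> E \<and> truncated \<alpha>}"
  let ?F = "PiE E (\<lambda>_. {..<CHAR('k)})"
  have F: "finite ?F" "card ?F = CHAR('k) ^ card E"
    using assms by (auto simp: finite_PiE card_PiE)
  have img: "(\<lambda>\<alpha>. restrict (Poly_Mapping.lookup \<alpha>) E) ` ?A \<subseteq> ?F"
    by (auto simp: truncated_def)
  have inj: "inj_on (\<lambda>\<alpha>. restrict (Poly_Mapping.lookup \<alpha>) E) ?A"
  proof (rule inj_onI, rule poly_mapping_eqI)
    fix \<alpha> \<beta> v assume *: "\<alpha> \<in> ?A" "\<beta> \<in> ?A"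
      "restrict (Poly_Mapping.lookup \<alpha>) E = restrict (Poly_Mapping.lookup \<beta>) E"
    show "Poly_Mapping.lookup \<alpha> v = Poly_Mapping.lookup \<beta> v"
    proof (cases "v \<in> E")
      case True
      then show ?thesis using fun_cong[OF *(3), of v] by simp
    next
      case False
      then have "v \<notin> Poly_Mapping.keys \<alpha>" "v \<notin> Poly_Mapping.keys \<beta>" using *(1,2) by blast+
      then show ?thesis by (simp add: in_keys_iff)
    qed
  qed
  have A: "finite ?A" "card ?A \<le> CHAR('k) ^ card E"
    using inj_on_finite[OF inj img F(1)] card_inj_on_le[OF inj img F(1)] F(2) by auto
  have eq: "truncated_mons E = mon ` ?A" by (auto simp: truncated_mons_def)
  show "finite (truncated_mons E)" unfolding eq using A(1) by simp
  show "card (truncated_mons E) \<le> CHAR('k) ^ card E"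
    unfolding eq using card_image_le[OF A(1), of "mon :: _ \<Rightarrow> ('l, 'k) mpoly"] A(2) by linarith
qed

section \<open>Upper bound for the space spanned by the p^k-th powers\<close>

context
  fixes E :: "'l set"
  assumes EB: "E \<subseteq> B" and stable: "\<And>e. e \<in> E \<Longrightarrow> \<sigma> e \<in> span E"
begin

text \<open>Modulo \<open>J\<close> this is the image of \<open>PE\<close>, the polynomials in the
  variables \<open>E\<close>, with a spanning set of at most \<open>p ^ card E\<close>
  elements.\<close>

definition V :: "('l, 'k) mpoly set"
  where "V = mvec.span (truncated_mons E \<union> J)"

definition PE :: "('l, 'k) mpoly set"
  where "PE = mvec.span {mon \<gamma> | \<gamma>. Poly_Mapping.keys \<gamma> \<subseteq> E}"

lemma subspace_V: "mvec.subspace V"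
  unfolding V_def by (rule mvec.subspace_span)

text \<open>Replacing \<open>var v ^ p\<close> by \<open>\<iota> (\<sigma> v)\<close> stays within
  the variables of \<open>E\<close> by stability, and lowers the degree.\<close>

lemma mon_mem_V: "Poly_Mapping.keys \<gamma> \<subseteq> E \<Longrightarrow> mon \<gamma> \<in> V"
proof (induction "mdeg \<gamma>" arbitrary: \<gamma> rule: less_induct)
  case less
  show ?case
  proof (cases "truncated \<gamma>")
    case True
    with less.prems show ?thesis
      unfolding V_def truncated_mons_def by (intro mvec.span_base) auto
  next
    case False
    let ?p = "CHAR('k)"
    obtain v where v: "?p \<le> Poly_Mapping.lookup \<gamma> v" using False by (auto simp: truncated_def not_less)
    let ?\<delta> = "\<gamma> - Poly_Mapping.single v ?p"
    have "v \<in> Poly_Mapping.keys \<gamma>" using v CHAR_pos by (simp add: in_keys_iff)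
    then have vE: "v \<in> E" using less.prems by blast
    have \<gamma>: "?\<delta> + Poly_Mapping.single v ?p = \<gamma>" by (rule minus_add_single) (rule v)
    have keys\<delta>: "Poly_Mapping.keys ?\<delta> \<subseteq> E"
      using less.prems by (auto simp: in_keys_iff lookup_minus)
    have deg: "mdeg \<gamma> = mdeg ?\<delta> + ?p"
      using mdeg_add[of ?\<delta> "Poly_Mapping.single v ?p"] by (simp add: \<gamma>)
    have step: "\<iota> x * mon ?\<delta> \<in> V" if "x \<in> span E" for x
    proof -
      have "subspace {x. \<iota> x * mon ?\<delta> \<in> V}"
        by (rule subspaceI) (auto simp: \<iota>.zero \<iota>.add \<iota>.scale distrib_right mscale_mult_left
            mvec.subspace_0[OF subspace_V] mvec.subspace_add[OF subspace_V] mvec.subspace_scale[OF subspace_V])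
      moreover have "\<iota> e * mon ?\<delta> \<in> V" if "e \<in> E" for e
      proof -
        have "mon (Poly_Mapping.single e 1 + ?\<delta>) \<in> V"
        proof (rule less.hyps)
          show "mdeg (Poly_Mapping.single e 1 + ?\<delta>) < mdeg \<gamma>"
            using prime_gt_1_nat[OF prime_CHAR] by (simp add: mdeg_add deg)
          show "Poly_Mapping.keys (Poly_Mapping.single e 1 + ?\<delta>) \<subseteq> E"
            using keys\<delta> that Poly_Mapping.keys_add[of "Poly_Mapping.single e 1" ?\<delta>] by auto
        qed
        then show ?thesis using that EB by (auto simp: \<iota>_basis var_def mult_single)
      qed
      ultimately show ?thesis using span_minimal[of E "{x. \<iota> x * mon ?\<delta> \<in> V}"] that by blast
    qed
    have "mon \<gamma> = mon ?\<delta> * prel v + \<iota> (\<sigma> v) * mon ?\<delta>"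
    proof -
      have "\<iota> v = var v" using vE EB \<iota>_basis by blast
      then have "mon ?\<delta> * prel v + \<iota> (\<sigma> v) * mon ?\<delta> = mon ?\<delta> * var v ^ ?p"
        by (simp add: prel_def algebra_simps)
      then show ?thesis by (simp add: var_power mult_single \<gamma>)
    qed
    moreover have "mon ?\<delta> * prel v \<in> V"
      unfolding V_def by (intro mvec.span_base UnI2 J_mult prel_mem_J)
    ultimately show ?thesis
      using mvec.subspace_add[OF subspace_V _ step[OF stable[OF vE]]] by simp
  qed
qed

lemma PE_subset_V: "PE \<subseteq> V"
  unfolding PE_def by (rule mvec.span_minimal) (auto simp: mon_mem_V subspace_V)

lemma PE_1: "1 \<in> PE"
  unfolding PE_def by (rule mvec.span_base) (auto intro!: exI[of _ 0])

lemma PE_mult: "f \<in> PE \<Longrightarrow> x \<in> span E \<Longrightarrow> \<iota> x * f \<in> PE"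
proof -
  assume f: "f \<in> PE" and x: "x \<in> span E"
  have PE: "mvec.subspace PE" unfolding PE_def by (rule mvec.subspace_span)
  have "var e * f \<in> PE" if "e \<in> E" for e
  proof -
    have "mvec.subspace {f. var e * f \<in> PE}"
      by (rule mvec.subspaceI) (auto simp: distrib_left mscale_mult_right
          mvec.subspace_0[OF PE] mvec.subspace_add[OF PE] mvec.subspace_scale[OF PE])
    moreover have "var e * mon \<gamma> \<in> PE" if "Poly_Mapping.keys \<gamma> \<subseteq> E" for \<gamma>
    proof -
      have "Poly_Mapping.keys (Poly_Mapping.single e 1 + \<gamma>) \<subseteq> E"
        using that \<open>e \<in> E\<close> Poly_Mapping.keys_add[of "Poly_Mapping.single e 1" \<gamma>] by auto
      then show ?thesis unfolding PE_def var_def mult_single by (intro mvec.span_base) auto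
    qed
    ultimately have "PE \<subseteq> {f. var e * f \<in> PE}"
      using mvec.span_minimal[of "{mon \<gamma> | \<gamma>. Poly_Mapping.keys \<gamma> \<subseteq> E}" "{f. var e * f \<in> PE}"]
      unfolding PE_def[symmetric] by blast
    with f show ?thesis by blast
  qed
  moreover have "\<iota> e = var e" if "e \<in> E" for e using that EB \<iota>_basis by blast
  moreover have "subspace {x. \<iota> x * f \<in> PE}"
    by (rule subspaceI) (auto simp: \<iota>.zero \<iota>.add \<iota>.scale distrib_right mscale_mult_left
        mvec.subspace_0[OF PE] mvec.subspace_add[OF PE] mvec.subspace_scale[OF PE])
  moreover have "E \<subseteq> {x. \<iota> x * f \<in> PE}" using calculation(1,2) by auto
  ultimately have "span E \<subseteq> {x. \<iota> x * f \<in> PE}" by (intro span_minimal)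
  with x show "\<iota> x * f \<in> PE" by blast
qed

text \<open>Taking \<open>p^k\<close>-th powers is additive and turns a word, modulo
  \<open>J\<close>, into a product of linear forms from the span of \<open>E\<close>.\<close>

lemma \<pi>_power_mem_V:
  assumes k: "\<And>x. (\<sigma> ^^ k) x \<in> span E"
  shows "\<pi> t ^ (CHAR('k) ^ k) \<in> V"
proof -
  let ?q = "CHAR('k) ^ k"
  have word: "\<exists>f\<in>PE. \<pi> (mon (Word xs)) ^ ?q - f \<in> J" for xs
  proof (induction xs)
    case Nil
    then show ?case by (intro bexI[of _ 1]) (simp_all add: mon_Word_Nil J_0 PE_1)
  next
    case (Cons x xs)
    then obtain f where f: "f \<in> PE" "\<pi> (mon (Word xs)) ^ ?q - f \<in> J" by blast
    have "\<pi> (mon (Word (x # xs))) ^ ?q - \<iota> ((\<sigma> ^^ k) x) * f \<in> J"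
      using J_mult_cong[OF \<iota>_pow_mem_J[of x k] f(2)]
      by (simp add: mon_Word_Cons power_mult_distrib)
    with PE_mult[OF f(1) k[of x]] show ?case by blast
  qed
  have mon_V: "\<pi> (mon w) ^ ?q \<in> V" for w
  proof -
    obtain xs where w: "w = Word xs" by (cases w)
    obtain f where f: "f \<in> PE" "\<pi> (mon w) ^ ?q - f \<in> J" using word unfolding w by blast
    have "\<pi> (mon w) ^ ?q - f \<in> V" unfolding V_def by (intro mvec.span_base UnI2 f(2))
    from mvec.subspace_add[OF subspace_V this, of f] f(1) PE_subset_V show ?thesis by auto
  qed
  have "\<pi> t = (\<Sum>w\<in>Poly_Mapping.keys t. mscale (Poly_Mapping.lookup t w) (\<pi> (mon w)))"
    by (subst mon_sum_expansion[of t]) (simp add: \<pi>.sum \<pi>.scale del: mscale_single)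
  then have "\<pi> t ^ ?q = (\<Sum>w\<in>Poly_Mapping.keys t. mscale (Poly_Mapping.lookup t w) (\<pi> (mon w)) ^ ?q)"
    using frobenius_sum[OF prime_CHAR_mpoly, of _ _ k] by simp
  also have "\<dots> \<in> V"
    by (intro mvec.subspace_sum[OF subspace_V])
      (auto simp: mscale_power intro!: mvec.subspace_scale[OF subspace_V] mon_V)
  finally show ?thesis .
qed

end

text \<open>The list fixes an order of the factors, as the free algebra is not commutative. In use
  \<open>f e\<close> is a preimage of \<open>e\<close> under the \<open>k\<close>-th iterate of
  \<sigma>, so this is a \<open>p^k\<close>-th root of a monomial modulo \<open>J\<close>.\<close>

definition root_mon :: "('l \<Rightarrow> 'l) \<Rightarrow> 'l list \<Rightarrow> ('l \<Rightarrow> nat) \<Rightarrow> ('l, 'k) free_algebra"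
  where "root_mon f es \<alpha> = prod_list (map (\<lambda>e. generator (f e) ^ \<alpha> e) es)"

lemma \<pi>_prod_list: "\<pi> (prod_list ts) = prod_list (map \<pi> ts)"
  by (induction ts) simp_all

text \<open>Modulo \<open>J\<close> the powers are distinct truncated monomials, so
  \<open>truncated_mem_J\<close> forces all coefficients to vanish.\<close>

lemma root_mons_independent:
  assumes es: "distinct es" "set es \<subseteq> B"
    and f: "\<And>e. e \<in> set es \<Longrightarrow> (\<sigma> ^^ k) (f e) = e"
    and sum: "(\<Sum>\<alpha>\<in>PiE (set es) (\<lambda>_. {..<CHAR('k)}).
        mscale (c \<alpha>) (\<pi> (root_mon f es \<alpha>) ^ (CHAR('k) ^ k))) \<in> J"
    and \<alpha>: "\<alpha> \<in> PiE (set es) (\<lambda>_. {..<CHAR('k)})"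
  shows "c \<alpha> = 0"
proof -
  let ?E = "set es" and ?q = "CHAR('k) ^ k"
  let ?A = "PiE ?E (\<lambda>_. {..<CHAR('k)})"
  define \<beta> where "\<beta> \<alpha> = (\<Sum>e\<in>?E. Poly_Mapping.single e (\<alpha> e))" for \<alpha> :: "'l \<Rightarrow> nat"
  have lookup_\<beta>: "Poly_Mapping.lookup (\<beta> \<alpha>) v = (if v \<in> ?E then \<alpha> v else 0)" for \<alpha> v
    by (simp add: \<beta>_def lookup_sum lookup_single when_def)
  have root: "\<pi> (root_mon f es \<alpha>) ^ ?q - mon (\<beta> \<alpha>) \<in> J" for \<alpha>
  proof -
    have "\<pi> (root_mon f es \<alpha>) ^ ?q = (\<Prod>e\<in>?E. (\<iota> (f e) ^ ?q) ^ \<alpha> e)"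
      using es(1)
      by (simp add: root_mon_def \<pi>_prod_list o_def prod.distinct_set_conv_list[symmetric]
          prod_power_distrib mult.commute flip: power_mult)
    moreover have "mon (\<beta> \<alpha>) = (\<Prod>e\<in>?E. \<iota> e ^ \<alpha> e)"
    proof -
      have "(\<Prod>e\<in>F. mon (Poly_Mapping.single e (\<alpha> e)) :: ('l, 'k) mpoly) =
          mon (\<Sum>e\<in>F. Poly_Mapping.single e (\<alpha> e))" for F
        by (induction F rule: infinite_finite_induct) (simp_all add: mult_single)
      moreover have "(\<Prod>e\<in>?E. \<iota> e ^ \<alpha> e) = (\<Prod>e\<in>?E. mon (Poly_Mapping.single e (\<alpha> e)))"
        using es(2) by (intro prod.cong) (auto simp: \<iota>_basis var_power)
      ultimately show ?thesis by (simp add: \<beta>_def)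
    qed
    moreover have "(\<Prod>e\<in>?E. (\<iota> (f e) ^ ?q) ^ \<alpha> e) - (\<Prod>e\<in>?E. \<iota> e ^ \<alpha> e) \<in> J"
    proof (intro J_prod_cong J_power_cong)
      fix e assume "e \<in> ?E"
      then show "\<iota> (f e) ^ ?q - \<iota> e \<in> J" using \<iota>_pow_mem_J[of "f e" k] f by simp
    qed simp
    ultimately show ?thesis by simp
  qed
  let ?s = "\<Sum>\<alpha>\<in>?A. mscale (c \<alpha>) (mon (\<beta> \<alpha>))"
  have "(\<Sum>\<alpha>\<in>?A. mscale (c \<alpha>) (\<pi> (root_mon f es \<alpha>) ^ ?q - mon (\<beta> \<alpha>))) \<in> J"
    by (intro J_sum J_scale root)
  from J_diff[OF sum this] have "?s \<in> J"
    by (simp add: mvec.scale_right_diff_distrib sum_subtractf)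
  moreover have "truncated \<gamma>" if "\<gamma> \<in> Poly_Mapping.keys ?s" for \<gamma>
  proof -
    have "\<gamma> \<in> (\<Union>\<alpha>\<in>?A. Poly_Mapping.keys (mscale (c \<alpha>) (mon (\<beta> \<alpha>))))"
      by (rule subsetD[OF Poly_Mapping.keys_sum that])
    then obtain \<alpha> where "\<alpha> \<in> ?A" "\<gamma> = \<beta> \<alpha>" by (auto split: if_splits)
    then show ?thesis using CHAR_pos by (auto simp: truncated_def lookup_\<beta>)
  qed
  ultimately have "?s = 0" by (rule truncated_mem_J)
  have "\<gamma> = \<alpha>" if "\<gamma> \<in> ?A" "\<beta> \<gamma> = \<beta> \<alpha>" for \<gamma>
  proof (rule PiE_ext[OF that(1) \<alpha>])
    show "\<gamma> v = \<alpha> v" if "v \<in> ?E" for v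
      using lookup_\<beta>[of \<gamma> v] lookup_\<beta>[of \<alpha> v] that \<open>\<beta> \<gamma> = \<beta> \<alpha>\<close> by simp
  qed
  then have "Poly_Mapping.lookup ?s (\<beta> \<alpha>) = (\<Sum>\<gamma>\<in>?A. if \<gamma> = \<alpha> then c \<gamma> else 0)"
    unfolding lookup_sum by (intro sum.cong) (auto simp: lookup_single when_def)
  also have "\<dots> = c \<alpha>" using \<alpha> finite_PiE[of ?E "\<lambda>_. {..<CHAR('k)}"] by simp
  finally show ?thesis using \<open>?s = 0\<close> by simp
qed

end

section \<open>Comparing abelian restricted Lie algebras with isomorphic enveloping algebras\<close>

text \<open>
  An isomorphism of enveloping algebras is used through the relation between representatives in
  the free algebras which it induces.
\<close>

locale free_algebra_correspondence =
  fixes I :: "('a, 'k::field) free_algebra set" and I' :: "('c, 'k) free_algebra set"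
    and R :: "('a, 'k) free_algebra \<Rightarrow> ('c, 'k) free_algebra \<Rightarrow> bool"
  assumes left_total: "\<exists>u. R t u" and right_total: "\<exists>t. R t u"
    and add: "R t u \<Longrightarrow> R t' u' \<Longrightarrow> R (t + t') (u + u')"
    and mult: "R t u \<Longrightarrow> R t' u' \<Longrightarrow> R (t * t') (u * u')"
    and mscale: "R t u \<Longrightarrow> R (mscale c t) (mscale c u)"
    and mem_iff: "R t u \<Longrightarrow> t \<in> I \<longleftrightarrow> u \<in> I'"
begin

lemma converse: "free_algebra_correspondence I' I (\<lambda>u t. R t u)"
  by unfold_locales (auto intro: left_total right_total add mult mscale simp: mem_iff)

lemma zero: "R 0 0"
proof -
  obtain u where "R 0 u" using left_total by blast
  from mscale[OF this, of 0] show ?thesis by simp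
qed

lemma sum: "(\<And>i. i \<in> A \<Longrightarrow> R (f i) (g i)) \<Longrightarrow> R (sum f A) (sum g A)"
  by (induction A rule: infinite_finite_induct) (auto intro: zero add)

text \<open>Exponent 0 is excluded because a relation between the two units is not among the
  assumptions.\<close>

lemma power: "R t u \<Longrightarrow> n > 0 \<Longrightarrow> R (t ^ n) (u ^ n)"
proof (induction n)
  case (Suc n)
  then show ?case by (cases "n = 0") (auto intro: mult)
qed simp

lemma diff: "R t u \<Longrightarrow> R t' u' \<Longrightarrow> R (t - t') (u - u')"
  using add[OF _ mscale[of t' u' "-1"]] by simp

end

text \<open>There are \<open>p ^ card E\<close> independent \<open>p^k\<close>-th powers on one
  side; their counterparts on the other side lie in a space of dimension at most
  \<open>p ^ card F\<close>. As \<open>E\<close> is merely finite and independent, the case k = 0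
  applies before the first space is known to be finite-dimensional.\<close>

lemma card_le_if_correspondence:
  fixes sA :: "'k::field \<Rightarrow> 'a::ab_group_add \<Rightarrow> 'a" and sC :: "'k \<Rightarrow> 'c::ab_group_add \<Rightarrow> 'c"
  assumes A: "frobenius_space sA \<sigma>A" and C: "frobenius_space sC \<sigma>C"
    and R: "free_algebra_correspondence (envelope_ideal sA (\<lambda>_ _. 0) \<sigma>A) (envelope_ideal sC (\<lambda>_ _. 0) \<sigma>C) R"
    and E: "finite E" "\<not> module.dependent sA E" "E \<subseteq> (\<sigma>A ^^ k) ` UNIV"
    and F: "finite F" "\<not> module.dependent sC F" "F \<subseteq> (\<sigma>C ^^ k) ` UNIV"
      "(\<sigma>C ^^ k) ` UNIV \<subseteq> module.span sC F"
  shows "card E \<le> card F"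
proof -
  interpret A0: frobenius_space sA \<sigma>A by (rule A)
  interpret C0: frobenius_space sC \<sigma>C by (rule C)
  interpret R: free_algebra_correspondence "envelope_ideal sA (\<lambda>_ _. 0) \<sigma>A" "envelope_ideal sC (\<lambda>_ _. 0) \<sigma>C" R
    by (rule R)
  interpret A: frobenius_space_basis sA \<sigma>A "A0.extend_basis E"
    by unfold_locales (use E A0.independent_extend_basis A0.span_extend_basis in auto)
  interpret C: frobenius_space_basis sC \<sigma>C "C0.extend_basis F"
    by unfold_locales (use F C0.independent_extend_basis C0.span_extend_basis in auto)
  let ?p = "CHAR('k)"
  obtain es where es: "set es = E" "distinct es" using finite_distinct_list[OF E(1)] by blast
  have esB: "set es \<subseteq> A0.extend_basis E" using A0.extend_basis_superset[OF E(2)] es(1) by simp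
  have FB: "F \<subseteq> C0.extend_basis F" using C0.extend_basis_superset[OF F(2)] .
  have "\<forall>e\<in>E. \<exists>x. (\<sigma>A ^^ k) x = e" using E(3) by blast
  then obtain f where f: "\<And>e. e \<in> E \<Longrightarrow> (\<sigma>A ^^ k) (f e) = e" by metis
  define N where "N = PiE E (\<lambda>_. {..<?p})"
  have N: "finite N" "card N = ?p ^ card E"
    using E(1) by (auto simp: N_def finite_PiE card_PiE)
  have "\<forall>\<alpha>. \<exists>u. R (A.root_mon f es \<alpha>) u" using R.left_total by blast
  then obtain u where u: "\<And>\<alpha>. R (A.root_mon f es \<alpha>) (u \<alpha>)" by metis
  have stable: "\<sigma>C e \<in> C0.span F" if e: "e \<in> F" for e
  proof -
    obtain x where "e = (\<sigma>C ^^ k) x" using e F(3) by blast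
    then have "\<sigma>C e = (\<sigma>C ^^ k) (\<sigma>C x)" by (simp add: funpow_swap1)
    with F(4) show ?thesis by blast
  qed
  have all: "(\<sigma>C ^^ k) x \<in> C0.span F" for x using F(4) by blast
  have "card N \<le> card (C.truncated_mons F)"
  proof (rule mvec.card_le_if_independent_modulo[OF C.subspace_J C.truncated_mons(1)[OF F(1)] N(1)])
    show "C.\<pi> (u \<alpha>) ^ (?p ^ k) \<in> mvec.span (C.truncated_mons F \<union> C.J)" if "\<alpha> \<in> N" for \<alpha>
      using C.\<pi>_power_mem_V[OF FB stable all, of "u \<alpha>"] by (simp only: C.V_def[OF FB stable])
    \<comment> \<open>A relation between the powers is pulled back along \<open>R\<close>, which
      respects sums, scalars, positive powers and membership in the ideals.\<close>
    show "\<forall>\<alpha>\<in>N. c \<alpha> = 0" if c: "(\<Sum>\<alpha>\<in>N. mscale (c \<alpha>) (C.\<pi> (u \<alpha>) ^ (?p ^ k))) \<in> C.J" for c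
    proof -
      have "C.\<pi> (\<Sum>\<alpha>\<in>N. mscale (c \<alpha>) (u \<alpha> ^ (?p ^ k))) \<in> C.J"
        using c by (simp add: C.\<pi>.sum C.\<pi>.scale)
      then have "(\<Sum>\<alpha>\<in>N. mscale (c \<alpha>) (u \<alpha> ^ (?p ^ k))) \<in> C.I" by (simp add: C.mem_I_iff)
      moreover have "R (\<Sum>\<alpha>\<in>N. mscale (c \<alpha>) (A.root_mon f es \<alpha> ^ (?p ^ k)))
          (\<Sum>\<alpha>\<in>N. mscale (c \<alpha>) (u \<alpha> ^ (?p ^ k)))"
        using A0.CHAR_pos by (intro R.sum R.mscale R.power u) simp
      ultimately have "(\<Sum>\<alpha>\<in>N. mscale (c \<alpha>) (A.root_mon f es \<alpha> ^ (?p ^ k))) \<in> A.I"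
        using R.mem_iff by (simp add: A.I_def C.I_def)
      then have "(\<Sum>\<alpha>\<in>N. mscale (c \<alpha>) (A.\<pi> (A.root_mon f es \<alpha>) ^ (?p ^ k))) \<in> A.J"
        by (simp add: A.mem_I_iff A.\<pi>.sum A.\<pi>.scale)
      then show ?thesis
        using A.root_mons_independent[OF es(2) esB] f es(1) unfolding N_def by blast
    qed
  qed
  also have "\<dots> \<le> ?p ^ card F" by (rule C.truncated_mons(2)[OF F(1)])
  finally show ?thesis
    using prime_gt_1_nat[OF A0.prime_CHAR] by (simp add: N(2))
qed

lemma (in restricted_lie_algebra) frobenius_space_if_abelian:
  assumes "abelian"
  shows "frobenius_space scale pmap"
proof
  have "bracket x y \<in> centre" for x y using assms by (simp add: abelian_def centre_def)
  from pmap_add_class_two[OF this] show "pmap (x + y) = pmap x + pmap y" for x y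
    using assms by (simp add: abelian_def)
qed (rule CHAR_pos pmap_scale)+

lemma coset_eq_ideal_iff:
  fixes I :: "'r::ring_1 set"
  assumes "ideal I ring_of_type_algebra"
  shows "I +>\<^bsub>ring_of_type_algebra\<^esub> t = I \<longleftrightarrow> t \<in> I"
proof -
  note I = ideal_ring_of_type_algebraD[OF assms]
  have coset: "I +>\<^bsub>ring_of_type_algebra\<^esub> t = (\<lambda>i. i + t) ` I"
    by (auto simp: a_r_coset_def' ring_of_type_algebra_def)
  show ?thesis
  proof
    assume "I +>\<^bsub>ring_of_type_algebra\<^esub> t = I"
    moreover have "0 + t \<in> (\<lambda>i. i + t) ` I" using I(1) by blast
    ultimately show "t \<in> I" by (simp add: coset)
  next
    assume t: "t \<in> I"
    have "i \<in> (\<lambda>i. i + t) ` I" if "i \<in> I" for i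
      using I(5)[OF that t] by (rule rev_image_eqI) simp
    with t I(2) show "I +>\<^bsub>ring_of_type_algebra\<^esub> t = I" unfolding coset by blast
  qed
qed

lemma correspondence_if_assoc_algebra_iso:
  fixes sL :: "'k::field \<Rightarrow> 'l::ab_group_add \<Rightarrow> 'l" and bL pL
    and sH :: "'k \<Rightarrow> 'h::ab_group_add \<Rightarrow> 'h" and bH pH
  defines "IL \<equiv> envelope_ideal sL bL pL" and "IH \<equiv> envelope_ideal sH bH pH"
  assumes \<Phi>: "\<Phi> \<in> assoc_algebra_iso (restricted_enveloping_algebra sL bL pL) (restricted_enveloping_algebra sH bH pH)"
  shows "free_algebra_correspondence IL IH
    (\<lambda>t u. \<Phi> (IL +>\<^bsub>ring_of_type_algebra\<^esub> t) = IH +>\<^bsub>ring_of_type_algebra\<^esub> u)"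
proof -
  let ?UL = "restricted_enveloping_algebra sL bL pL" and ?UH = "restricted_enveloping_algebra sH bH pH"
  let ?TL = "ring_of_type_algebra :: ('l, 'k) free_algebra ring"
    and ?TH = "ring_of_type_algebra :: ('h, 'k) free_algebra ring"
  interpret L: ideal IL ?TL unfolding IL_def by (rule ideal_envelope_ideal)
  interpret H: ideal IH ?TH unfolding IH_def by (rule ideal_envelope_ideal)
  have iso: "\<Phi> \<in> ring_hom ?UL ?UH" "bij_betw \<Phi> (carrier ?UL) (carrier ?UH)"
    and smult: "\<And>c a. a \<in> carrier ?UL \<Longrightarrow> \<Phi> (c \<odot>\<^bsub>?UL\<^esub> a) = c \<odot>\<^bsub>?UH\<^esub> \<Phi> a"
    using \<Phi> by (auto simp: assoc_algebra_iso_def ring_iso_def)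
  have carrier_L: "carrier ?UL = range (\<lambda>t. IL +>\<^bsub>?TL\<^esub> t)"
    and carrier_H: "carrier ?UH = range (\<lambda>t. IH +>\<^bsub>?TH\<^esub> t)"
    by (auto simp: restricted_enveloping_algebra_def Let_def ring.defs FactRing_def
        A_RCOSETS_def' ring_of_type_algebra_def IL_def IH_def)
  have add_L: "(IL +>\<^bsub>?TL\<^esub> t) \<oplus>\<^bsub>?UL\<^esub> (IL +>\<^bsub>?TL\<^esub> u) = IL +>\<^bsub>?TL\<^esub> (t + u)" for t u
    using L.a_rcos_sum[of t u]
    by (simp add: restricted_enveloping_algebra_def Let_def ring.defs FactRing_def
        ring_of_type_algebra_def IL_def)
  have add_H: "(IH +>\<^bsub>?TH\<^esub> t) \<oplus>\<^bsub>?UH\<^esub> (IH +>\<^bsub>?TH\<^esub> u) = IH +>\<^bsub>?TH\<^esub> (t + u)" for t u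
    using H.a_rcos_sum[of t u]
    by (simp add: restricted_enveloping_algebra_def Let_def ring.defs FactRing_def
        ring_of_type_algebra_def IH_def)
  have mult_L: "(IL +>\<^bsub>?TL\<^esub> t) \<otimes>\<^bsub>?UL\<^esub> (IL +>\<^bsub>?TL\<^esub> u) = IL +>\<^bsub>?TL\<^esub> (t * u)" for t u
    using L.rcoset_mult_add[of t u]
    by (simp add: restricted_enveloping_algebra_def Let_def ring.defs FactRing_def
        ring_of_type_algebra_def IL_def)
  have mult_H: "(IH +>\<^bsub>?TH\<^esub> t) \<otimes>\<^bsub>?UH\<^esub> (IH +>\<^bsub>?TH\<^esub> u) = IH +>\<^bsub>?TH\<^esub> (t * u)" for t u
    using H.rcoset_mult_add[of t u]
    by (simp add: restricted_enveloping_algebra_def Let_def ring.defs FactRing_def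
        ring_of_type_algebra_def IH_def)
  have zero_L: "\<zero>\<^bsub>?UL\<^esub> = IL" and zero_H: "\<zero>\<^bsub>?UH\<^esub> = IH"
    by (simp_all add: restricted_enveloping_algebra_def Let_def ring.defs FactRing_def IL_def IH_def)
  have coset_L: "IL +>\<^bsub>?TL\<^esub> t = IL \<longleftrightarrow> t \<in> IL" for t
    by (rule coset_eq_ideal_iff) (rule L.ideal_axioms)
  have coset_H: "IH +>\<^bsub>?TH\<^esub> t = IH \<longleftrightarrow> t \<in> IH" for t
    by (rule coset_eq_ideal_iff) (rule H.ideal_axioms)
  have \<Phi>_zero: "\<Phi> IL = IH"
    using ring_hom_zero[OF iso(1) ring_restricted_enveloping_algebra ring_restricted_enveloping_algebra]
    by (simp only: zero_L zero_H)
  show ?thesis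
  proof
    show "\<exists>u. \<Phi> (IL +>\<^bsub>?TL\<^esub> t) = IH +>\<^bsub>?TH\<^esub> u" for t
    proof -
      have "\<Phi> (IL +>\<^bsub>?TL\<^esub> t) \<in> carrier ?UH" by (rule bij_betwE[OF iso(2), rule_format]) (simp add: carrier_L)
      then show ?thesis by (auto simp: carrier_H)
    qed
    show "\<exists>t. \<Phi> (IL +>\<^bsub>?TL\<^esub> t) = IH +>\<^bsub>?TH\<^esub> u" for u
    proof -
      have "IH +>\<^bsub>?TH\<^esub> u \<in> \<Phi> ` carrier ?UL" using iso(2) by (simp add: bij_betw_def carrier_H)
      then show ?thesis by (auto simp: carrier_L)
    qed
  next
    fix t t' u u'
    assume R: "\<Phi> (IL +>\<^bsub>?TL\<^esub> t) = IH +>\<^bsub>?TH\<^esub> u" "\<Phi> (IL +>\<^bsub>?TL\<^esub> t') = IH +>\<^bsub>?TH\<^esub> u'"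
    show "\<Phi> (IL +>\<^bsub>?TL\<^esub> (t + t')) = IH +>\<^bsub>?TH\<^esub> (u + u')"
      unfolding add_L[symmetric] add_H[symmetric]
      by (subst ring_hom_add[OF iso(1)]) (simp_all add: carrier_L R)
    show "\<Phi> (IL +>\<^bsub>?TL\<^esub> (t * t')) = IH +>\<^bsub>?TH\<^esub> (u * u')"
      unfolding mult_L[symmetric] mult_H[symmetric]
      by (subst ring_hom_mult[OF iso(1)]) (simp_all add: carrier_L R)
  next
    fix t u c assume R: "\<Phi> (IL +>\<^bsub>?TL\<^esub> t) = IH +>\<^bsub>?TH\<^esub> u"
    have "\<Phi> (c \<odot>\<^bsub>?UL\<^esub> (IL +>\<^bsub>?TL\<^esub> t)) = c \<odot>\<^bsub>?UH\<^esub> (IH +>\<^bsub>?TH\<^esub> u)"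
      by (subst smult) (simp_all add: carrier_L R)
    then show "\<Phi> (IL +>\<^bsub>?TL\<^esub> mscale c t) = IH +>\<^bsub>?TH\<^esub> mscale c u"
      unfolding IL_def IH_def smult_restricted_enveloping_algebra scalar_mult_eq_mscale .
    have "IL +>\<^bsub>?TL\<^esub> t = IL \<longleftrightarrow> \<Phi> (IL +>\<^bsub>?TL\<^esub> t) = \<Phi> IL"
    proof -
      have "IL +>\<^bsub>?TL\<^esub> t \<in> carrier ?UL" "IL +>\<^bsub>?TL\<^esub> 0 \<in> carrier ?UL" by (auto simp: carrier_L)
      moreover have "IL +>\<^bsub>?TL\<^esub> 0 = IL"
        using ideal_ring_of_type_algebraD(1)[OF L.ideal_axioms] by (simp add: coset_L)
      ultimately show ?thesis using iso(2) by (auto simp: bij_betw_def inj_on_eq_iff)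
    qed
    then show "t \<in> IL \<longleftrightarrow> u \<in> IH" by (simp add: coset_L coset_H R \<Phi>_zero)
  qed
qed

theorem corollary2p8:
  fixes scale\<^sub>L :: "'k::alg_closed_field \<Rightarrow> 'l::ab_group_add \<Rightarrow> 'l"
    and bracket\<^sub>L :: "'l \<Rightarrow> 'l \<Rightarrow> 'l" and pmap\<^sub>L :: "'l \<Rightarrow> 'l"
    and scale\<^sub>H :: "'k \<Rightarrow> 'h::ab_group_add \<Rightarrow> 'h"
    and bracket\<^sub>H :: "'h \<Rightarrow> 'h \<Rightarrow> 'h" and pmap\<^sub>H :: "'h \<Rightarrow> 'h"
    and p :: nat
  assumes "CHAR('k) = p" and "p > 0"
    and "restricted_lie_algebra scale\<^sub>L bracket\<^sub>L pmap\<^sub>L"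
    and "\<exists>B. finite_dimensional_vector_space scale\<^sub>L B"
    and "lie_algebra.abelian bracket\<^sub>L"
    and "restricted_lie_algebra scale\<^sub>H bracket\<^sub>H pmap\<^sub>H"
    and "\<exists>\<Phi>. \<Phi> \<in> assoc_algebra_iso
           (restricted_enveloping_algebra scale\<^sub>L bracket\<^sub>L pmap\<^sub>L)
           (restricted_enveloping_algebra scale\<^sub>H bracket\<^sub>H pmap\<^sub>H)"
  shows "\<exists>\<phi>. restricted_lie_iso scale\<^sub>L bracket\<^sub>L pmap\<^sub>L scale\<^sub>H bracket\<^sub>H pmap\<^sub>H \<phi>"
proof -
  interpret L: restricted_lie_algebra scale\<^sub>L bracket\<^sub>L pmap\<^sub>L by fact
  interpret H: restricted_lie_algebra scale\<^sub>H bracket\<^sub>H pmap\<^sub>H by fact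
  obtain BL where "finite_dimensional_vector_space scale\<^sub>L BL" using assms(4) by blast
  then interpret Lf: finite_dimensional_vector_space scale\<^sub>L BL .
  have frob_L: "frobenius_space scale\<^sub>L pmap\<^sub>L"
    by (rule L.frobenius_space_if_abelian) (rule assms(5))
  interpret LB: frobenius_space_basis scale\<^sub>L pmap\<^sub>L BL
    by (intro frobenius_space_basis.intro frob_L frobenius_space_basis_axioms.intro
        Lf.independent_Basis Lf.span_Basis)
  have bracket_L: "bracket\<^sub>L = (\<lambda>_ _. 0)"
    using assms(5) by (intro ext) (simp add: L.abelian_def)
  obtain R where "free_algebra_correspondence (envelope_ideal scale\<^sub>L bracket\<^sub>L pmap\<^sub>L)
      (envelope_ideal scale\<^sub>H bracket\<^sub>H pmap\<^sub>H) R"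
    using assms(7) correspondence_if_assoc_algebra_iso by blast
  then interpret R: free_algebra_correspondence "envelope_ideal scale\<^sub>L bracket\<^sub>L pmap\<^sub>L"
    "envelope_ideal scale\<^sub>H bracket\<^sub>H pmap\<^sub>H" R .
  have "generator x * generator y - generator y * generator x
      \<in> envelope_ideal scale\<^sub>H bracket\<^sub>H pmap\<^sub>H" for x y
  proof -
    obtain t u where tu: "R t (generator x)" "R u (generator y)" using R.right_total by meson
    \<comment> \<open>\<open>\<pi>\<close> has values in a commutative ring, so it kills the
      commutator; \<open>R\<close> transports this to arbitrary generators of
      \<open>u(H)\<close>.\<close>
    have "t * u - u * t \<in> LB.I" by (simp add: LB.mem_I_iff LB.\<pi>.diff mult.commute LB.J_0)
    moreover have "R (t * u - u * t) (generator x * generator y - generator y * generator x)"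
      by (intro R.diff R.mult tu)
    ultimately show ?thesis using R.mem_iff by (simp add: LB.I_def bracket_L)
  qed
  then have abelian_H: "H.abelian" by (rule H.commutative_envelope_imp_abelian)
  have bracket_H: "bracket\<^sub>H = (\<lambda>_ _. 0)"
    using abelian_H by (intro ext) (simp add: H.abelian_def)
  have frob_H: "frobenius_space scale\<^sub>H pmap\<^sub>H"
    by (rule H.frobenius_space_if_abelian) (rule abelian_H)
  have corr: "free_algebra_correspondence (envelope_ideal scale\<^sub>L (\<lambda>_ _. 0) pmap\<^sub>L)
      (envelope_ideal scale\<^sub>H (\<lambda>_ _. 0) pmap\<^sub>H) R"
    using R.free_algebra_correspondence_axioms unfolding bracket_L bracket_H .
  note corr' = free_algebra_correspondence.converse[OF corr]
  define BH where "BH = H.extend_basis {}"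
  have BH: "H.independent BH" "H.span BH = UNIV"
    unfolding BH_def
    by (rule H.independent_extend_basis[OF H.independent_empty] H.span_extend_basis[OF H.independent_empty])+
  \<comment> \<open>For k = 0 the images are the whole spaces: any finite part of a basis of
    \<open>H\<close> has at most \<open>card BL\<close> elements, so that basis is finite.\<close>
  have "card E \<le> card BL" if "finite E" "E \<subseteq> BH" for E
    using that BH(1) H.independent_mono
    by (intro card_le_if_correspondence[OF frob_H frob_L corr', where k = 0])
      (auto simp: Lf.finite_Basis Lf.independent_Basis Lf.span_Basis)
  then have "finite BH"
    by (metis infinite_arbitrarily_large not_less_eq_eq)
  then interpret Hf: finite_dimensional_vector_space scale\<^sub>H BH
    by unfold_locales (use BH in auto)
  interpret P: fd_frobenius_space_pair scale\<^sub>L pmap\<^sub>L BL scale\<^sub>H pmap\<^sub>H BH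
    by (intro fd_frobenius_space_pair.intro fd_frobenius_space.intro frob_L frob_H
        Lf.finite_dimensional_vector_space_axioms Hf.finite_dimensional_vector_space_axioms)
  have "L.dim (range (pmap\<^sub>L ^^ k)) = H.dim (range (pmap\<^sub>H ^^ k))" for k
  proof -
    obtain E where E: "E \<subseteq> range (pmap\<^sub>L ^^ k)" "L.independent E" "range (pmap\<^sub>L ^^ k) \<subseteq> L.span E"
        "card E = L.dim (range (pmap\<^sub>L ^^ k))"
      using L.basis_exists by blast
    obtain F where F: "F \<subseteq> range (pmap\<^sub>H ^^ k)" "H.independent F" "range (pmap\<^sub>H ^^ k) \<subseteq> H.span F"
        "card F = H.dim (range (pmap\<^sub>H ^^ k))"
      using H.basis_exists by blast
    note fin = Lf.finiteI_independent[OF E(2)] Hf.finiteI_independent[OF F(2)]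
    show ?thesis
      using card_le_if_correspondence[OF frob_L frob_H corr fin(1) E(2,1) fin(2) F(2,1,3)]
        card_le_if_correspondence[OF frob_H frob_L corr' fin(2) F(2,1) fin(1) E(2,1,3)] E(4) F(4)
      by simp
  qed
  from P.ex_iso[OF this] obtain \<psi> where \<psi>: "Vector_Spaces.linear scale\<^sub>L scale\<^sub>H \<psi>" "bij \<psi>"
    "\<forall>x. \<psi> (pmap\<^sub>L x) = pmap\<^sub>H (\<psi> x)" by blast
  have "\<psi> 0 = 0" using module_hom.zero[OF Vector_Spaces.linear.axioms(3)[OF \<psi>(1)]] .
  with \<psi> have "restricted_lie_iso scale\<^sub>L bracket\<^sub>L pmap\<^sub>L scale\<^sub>H bracket\<^sub>H pmap\<^sub>H \<psi>"
    by (simp add: restricted_lie_iso_def bracket_L bracket_H)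
  then show ?thesis by blast
qed

end
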